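(* Let $X$ be a continuous Itô process in $\mathbb{R}^d$, $$dX_t=b(X_t,t)\,dt+\sigma(X_t,t)\,dW_t,$$ where $W$ is a (finite-dimensional) Brownian motion and $b$ and $\sigma$ are locally bounded. Let $\Phi\in C^{1,2}([0,\infty)\times\mathbb{R}^d)$, and define $Y_t:=\Phi(t,X_t)$ and $\tau:=\inf\{t\ge0:Y_t\ge0\}$. Suppose that for every $T>0$ there exist $\eta>0$ and $c>0$ such that $$\|\sigma(x,t)^{\top}\nabla_x\Phi(t,x)\|\ge c\qquad\text{for all }(t,x)\text{ with }0\le t\le T,\ |\Phi(t,x)|\le\eta .$$ Then almost surely on $\{\tau<\infty\}$, $Y$ satisfies (NT+): for every $\varepsilon>0$, $\sup_{s\in[\tau,\tau+\varepsilon]}Y_s>0$. Moreover, on $\{\tau=\infty\}$ one has $\sup_{0\le s\le T}Y_s<0$ for every $T>0$, so that the condition NT holds almost surely for $(X,\Phi)$.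
   Context: $C^{1,2}$ means continuously differentiable once in $t$ and twice in $x$. Convention: $\inf\varnothing=\infty$, $\sup\varnothing=-\infty$. Condition NT for a pair (path $x$, continuous function $\Phi$ on $[0,\infty)\times\mathbb{R}^d$), with $y(t)=\Phi(t,x(t))$ and $\tau=\inf\{t\ge0:y(t)\ge0\}$: one of the following holds. (i) $\tau=\infty$ and for every $T>0$, $\sup_{0\le s\le T}y(s)<0$. (ii) $\tau<\infty$, and (NT-) for all $T<\tau$, $\sup_{0\le s\le T}y(s)<0$, and (NT+) for all $\varepsilon>0$, $\sup_{s\in[\tau,\tau+\varepsilon]}y(s)>0$. *)

theory Defs
  imports "HOL-Probability.Probability"
begin

section \<open>Hitting time and the condition NT\<close>

text \<open>Suprema and infima are taken in \<^typ>\<open>ereal\<close>, so that the infimum of the empty set is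
  \<open>\<infinity>\<close> and its supremum is \<open>-\<infinity>\<close>. Only the values of a path at times \<open>t \<ge> 0\<close> matter.\<close>

definition hit_time :: "(real \<Rightarrow> real) \<Rightarrow> ereal" where
  "hit_time y = Inf (ereal ` {t. 0 \<le> t \<and> 0 \<le> y t})"

definition NT_minus :: "(real \<Rightarrow> real) \<Rightarrow> bool" where
  "NT_minus y \<longleftrightarrow> (\<forall>T. ereal T < hit_time y \<longrightarrow> (SUP s\<in>{0..T}. ereal (y s)) < 0)"

definition NT_plus :: "(real \<Rightarrow> real) \<Rightarrow> bool" where
  "NT_plus y \<longleftrightarrow> (\<forall>\<epsilon>::real. 0 < \<epsilon> \<longrightarrow>
     0 < (SUP s\<in>{s. hit_time y \<le> ereal s \<and> ereal s \<le> hit_time y + ereal \<epsilon>}. ereal (y s)))"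

definition NT :: "(real \<Rightarrow> 'x) \<Rightarrow> (real \<Rightarrow> 'x \<Rightarrow> real) \<Rightarrow> bool" where
  "NT x \<Phi> \<longleftrightarrow> (let y = (\<lambda>t. \<Phi> t (x t)) in
     (hit_time y = \<infinity> \<and> (\<forall>T>0. (SUP s\<in>{0..T}. ereal (y s)) < 0)) \<or>
     (hit_time y < \<infinity> \<and> NT_minus y \<and> NT_plus y))"


section \<open>Regularity of functions\<close>

definition locally_bounded_on ::
  "'a::topological_space set \<Rightarrow> ('a \<Rightarrow> 'b::metric_space) \<Rightarrow> bool" where
  "locally_bounded_on S f \<longleftrightarrow> (\<forall>p\<in>S. \<exists>U. open U \<and> p \<in> U \<and> bounded (f ` (U \<inter> S)))"

definition grad :: "('a::real_inner \<Rightarrow> real) \<Rightarrow> 'a \<Rightarrow> 'a" where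
  "grad f x = (THE D. GDERIV f x :> D)"

lemma grad_eq:
  assumes "GDERIV f x :> D"
  shows "grad f x = D"
  unfolding grad_def
proof (rule the_equality[where P = "\<lambda>D. GDERIV f x :> D", OF assms])
  fix E assume "GDERIV f x :> E"
  then have "(\<lambda>h. inner h E) = (\<lambda>h. inner h D)"
    using assms unfolding gderiv_def by (rule has_derivative_unique)
  then show "E = D"
    by (metis inner_commute vector_eq_ldot)
qed

text \<open>\<open>C12 \<Phi>\<close>: \<open>\<Phi>\<close> is of class \<open>C\<^sup>1\<^sup>,\<^sup>2\<close> on \<open>[0,\<infinity>) \<times> \<real>\<^sup>d\<close>, with time
  derivative \<open>Dt\<close> (one-sided at \<open>t = 0\<close>), spatial gradient \<open>Dx\<close> and spatial Hessian \<open>Dxx\<close>.\<close>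

definition C12 :: "(real \<Rightarrow> real^'d \<Rightarrow> real) \<Rightarrow> bool" where
  "C12 \<Phi> \<longleftrightarrow> (\<exists>(Dt :: real \<Rightarrow> real^'d \<Rightarrow> real) (Dx :: real \<Rightarrow> real^'d \<Rightarrow> real^'d)
       (Dxx :: real \<Rightarrow> real^'d \<Rightarrow> real^'d^'d).
     (\<forall>t\<ge>0. \<forall>x.
        ((\<lambda>s. \<Phi> s x) has_real_derivative Dt t x) (at t within {0..}) \<and>
        (GDERIV (\<Phi> t) x :> Dx t x) \<and>
        (Dx t has_derivative (\<lambda>h. Dxx t x *v h)) (at x)) \<and>
     continuous_on ({0..} \<times> UNIV) (\<lambda>(t, x). \<Phi> t x) \<and>
     continuous_on ({0..} \<times> UNIV) (\<lambda>(t, x). Dt t x) \<and>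
     continuous_on ({0..} \<times> UNIV) (\<lambda>(t, x). Dx t x) \<and>
     continuous_on ({0..} \<times> UNIV) (\<lambda>(t, x). Dxx t x))"


section \<open>Processes on a filtered probability space\<close>

text \<open>Time is \<^typ>\<open>real\<close>; the members of \<open>F\<close> at negative times play no role. The filtration need
  not be complete or right-continuous.\<close>

definition filtered_prob_space :: "'a measure \<Rightarrow> (real \<Rightarrow> 'a measure) \<Rightarrow> bool" where
  "filtered_prob_space M F \<longleftrightarrow>
     prob_space M \<and> filtration (space M) F \<and> (\<forall>t\<ge>0. subalgebra M (F t))"

definition adapted :: "(real \<Rightarrow> 'a measure) \<Rightarrow> (real \<Rightarrow> 'a \<Rightarrow> 'b::topological_space) \<Rightarrow> bool" where
  "adapted F Z \<longleftrightarrow> (\<forall>t\<ge>0. Z t \<in> borel_measurable (F t))"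

definition prog_measurable ::
  "(real \<Rightarrow> 'a measure) \<Rightarrow> (real \<Rightarrow> 'a \<Rightarrow> 'b::topological_space) \<Rightarrow> bool" where
  "prog_measurable F Z \<longleftrightarrow> (\<forall>T\<ge>0.
     (\<lambda>(t, \<omega>). Z t \<omega>) \<in> borel_measurable (restrict_space borel {0..T} \<Otimes>\<^sub>M F T))"

definition brownian_motion ::
  "'a measure \<Rightarrow> (real \<Rightarrow> 'a measure) \<Rightarrow> (real \<Rightarrow> 'a \<Rightarrow> real^'m) \<Rightarrow> bool" where
  "brownian_motion M F W \<longleftrightarrow>
     adapted F W \<and>
     (AE \<omega> in M. W 0 \<omega> = 0) \<and>
     (AE \<omega> in M. continuous_on {0..} (\<lambda>t. W t \<omega>)) \<and>
     (\<forall>s t. 0 \<le> s \<and> s < t \<longrightarrow>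
        prob_space.indep_set M (sets (F s))
          (sets (vimage_algebra (space M) (\<lambda>\<omega>. W t \<omega> - W s \<omega>) borel)) \<and>
        distributed M lborel (\<lambda>\<omega>. W t \<omega> - W s \<omega>)
          (\<lambda>x. ennreal (\<Prod>i\<in>UNIV. normal_density 0 (sqrt (t - s)) (x $ i))))"


section \<open>The It\^o integral\<close>

text \<open>Simple integrands \<open>H\<^sub>t = (\<Sum>i<n. \<xi>\<^sub>i 1\<^bsub>(s\<^sub>i, s\<^sub>i\<^sub>+\<^sub>1]\<^esub>(t))\<close> with \<open>\<xi>\<^sub>i\<close> bounded and
  \<open>F(s\<^sub>i)\<close>-measurable.\<close>

definition simple_integrand :: "'a measure \<Rightarrow> (real \<Rightarrow> 'a measure) \<Rightarrow>
    nat \<Rightarrow> (nat \<Rightarrow> real) \<Rightarrow> (nat \<Rightarrow> 'a \<Rightarrow> real^'m^'d) \<Rightarrow> bool" where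
  "simple_integrand M F n s \<xi> \<longleftrightarrow>
     0 \<le> s 0 \<and> (\<forall>i<n. s i \<le> s (Suc i)) \<and>
     (\<forall>i<n. \<xi> i \<in> borel_measurable (F (s i)) \<and> bounded (\<xi> i ` space M))"

definition simple_process ::
  "nat \<Rightarrow> (nat \<Rightarrow> real) \<Rightarrow> (nat \<Rightarrow> 'a \<Rightarrow> real^'m^'d) \<Rightarrow> real \<Rightarrow> 'a \<Rightarrow> real^'m^'d" where
  "simple_process n s \<xi> t \<omega> = (\<Sum>i<n. indicat_real {s i<..s (Suc i)} t *\<^sub>R \<xi> i \<omega>)"

definition simple_integral :: "(real \<Rightarrow> 'a \<Rightarrow> real^'m) \<Rightarrow>
    nat \<Rightarrow> (nat \<Rightarrow> real) \<Rightarrow> (nat \<Rightarrow> 'a \<Rightarrow> real^'m^'d) \<Rightarrow> real \<Rightarrow> 'a \<Rightarrow> real^'d" where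
  "simple_integral W n s \<xi> t \<omega> =
     (\<Sum>i<n. \<xi> i \<omega> *v (W (min (s (Suc i)) t) \<omega> - W (min (s i) t) \<omega>))"

text \<open>Measurability is part of the definition because \<^const>\<open>measure\<close> assigns the value 0 to
  non-measurable sets.\<close>

definition tends_to_0_in_prob :: "'a measure \<Rightarrow> (nat \<Rightarrow> 'a \<Rightarrow> ennreal) \<Rightarrow> bool" where
  "tends_to_0_in_prob M Z \<longleftrightarrow> (\<forall>k. Z k \<in> borel_measurable M) \<and>
     (\<forall>\<epsilon>>0. (\<lambda>k. measure M {\<omega> \<in> space M. ennreal \<epsilon> < Z k \<omega>}) \<longlonglongrightarrow> 0)"

text \<open>\<open>ito_integral M F W H I\<close>: the process \<open>I\<close> is (a version of) \<open>\<integral>\<^sub>0\<^sup>t H\<^sub>s dW\<^sub>s\<close>, for \<open>H\<close>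
  progressively measurable and almost surely locally square integrable. Such an \<open>I\<close> exists and
  is unique up to indistinguishability, and does not depend on the approximating sequence.
  The norm on matrices is the Frobenius norm.\<close>

definition ito_integral :: "'a measure \<Rightarrow> (real \<Rightarrow> 'a measure) \<Rightarrow> (real \<Rightarrow> 'a \<Rightarrow> real^'m) \<Rightarrow>
    (real \<Rightarrow> 'a \<Rightarrow> real^'m^'d) \<Rightarrow> (real \<Rightarrow> 'a \<Rightarrow> real^'d) \<Rightarrow> bool" where
  "ito_integral M F W H I \<longleftrightarrow>
     prog_measurable F H \<and>
     (AE \<omega> in M. \<forall>T\<ge>0. (\<integral>\<^sup>+ r\<in>{0..T}. ennreal ((norm (H r \<omega>))\<^sup>2) \<partial>lborel) < \<infinity>) \<and>
     adapted F I \<and>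
     (AE \<omega> in M. continuous_on {0..} (\<lambda>t. I t \<omega>)) \<and>
     (\<exists>n s \<xi>. (\<forall>k::nat. simple_integrand M F (n k) (s k) (\<xi> k)) \<and>
        (\<forall>T\<ge>0. tends_to_0_in_prob M (\<lambda>k \<omega>.
           \<integral>\<^sup>+ r\<in>{0..T}. ennreal ((norm (simple_process (n k) (s k) (\<xi> k) r \<omega> - H r \<omega>))\<^sup>2) \<partial>lborel)) \<and>
        (\<forall>t\<ge>0. tends_to_0_in_prob M (\<lambda>k \<omega>.
           ennreal (norm (simple_integral W (n k) (s k) (\<xi> k) t \<omega> - I t \<omega>)))))"


section \<open>It\^o processes\<close>

text \<open>\<open>ito_process M F W b \<sigma> X\<close>: \<open>X\<close> is a continuous adapted process with
  \<open>dX\<^sub>t = b(X\<^sub>t,t) dt + \<sigma>(X\<^sub>t,t) dW\<^sub>t\<close>. Measurability is required of the coefficient processes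
  rather than of \<open>b\<close> and \<open>\<sigma>\<close> themselves; it is automatic if \<open>b\<close> and \<open>\<sigma>\<close> are Borel.\<close>

definition ito_process :: "'a measure \<Rightarrow> (real \<Rightarrow> 'a measure) \<Rightarrow> (real \<Rightarrow> 'a \<Rightarrow> real^'m) \<Rightarrow>
    (real^'d \<Rightarrow> real \<Rightarrow> real^'d) \<Rightarrow> (real^'d \<Rightarrow> real \<Rightarrow> real^'m^'d) \<Rightarrow> (real \<Rightarrow> 'a \<Rightarrow> real^'d) \<Rightarrow> bool" where
  "ito_process M F W b \<sigma> X \<longleftrightarrow>
     adapted F X \<and>
     (\<forall>\<omega>\<in>space M. continuous_on {0..} (\<lambda>t. X t \<omega>)) \<and>
     prog_measurable F (\<lambda>t \<omega>. b (X t \<omega>) t) \<and>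
     (AE \<omega> in M. \<forall>T\<ge>0. set_integrable lborel {0..T} (\<lambda>r. b (X r \<omega>) r)) \<and>
     (\<exists>I. ito_integral M F W (\<lambda>t \<omega>. \<sigma> (X t \<omega>) t) I \<and>
        (AE \<omega> in M. \<forall>t\<ge>0. X t \<omega> = X 0 \<omega> + (LINT r:{0..t}|lborel. b (X r \<omega>) r) + I t \<omega>))"

end

theory Submission
  imports Defs
begin

text \<open>Suppose \<open>Y\<close> stays in \<open>[-1/\<lambda>, 0]\<close> for some time after \<open>\<tau>\<close>, while \<open>X\<close> stays in a ball.
  There the drift of \<open>Y\<close> is bounded and its quadratic variation grows at least at a rate \<open>c\<^sup>2\<close>, so for
  large \<open>\<lambda>\<close> the process \<open>Y + \<lambda>/2 Y\<^sup>2\<close> is a submartingale with drift at least 1. But it starts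
  at 0 and is never positive on this stretch, so the stretch has length 0.

  No Ito formula is used. The submartingale inequality is obtained on a time grid by a second
  order Taylor bound for \<open>\<Phi>\<close>, which suffices because the test function is quadratic. On each grid
  step, the stochastic integral is compared with the integral of a truncated simple integrand;
  the two agree up to a small error off an event of small probability, because an integral of a
  simple integrand is small in probability as soon as its quadratic variation is. Second and fourth
  moments of the truncated integrals then control the contribution of the exceptional events.\<close>

section \<open>Local bounds for the coefficients and measurability of path events\<close>

text \<open>The definition of the Ito integral gives an approximating sequence and convergence in
  probability, hence no moments of \<open>I\<close>. Therefore every expectation below is taken of
  truncated simple integrals, and exceptional events have to be carried along. These are not known
  at the left end of a grid step, so they must stay out of the events on which martingale identities
  are used; they are collected in one set \<open>Bad\<close>. The factor in front of
  \<open>prob Bad\<close> does not depend on the mesh, so \<open>Bad\<close> is made small after all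
  other constants are fixed.

  A large \<lambda> is harmless because on [-1/\<lambda>, 0] the derivative 1 + \<lambda> y of the
  test function lies in [0, 1]: drift and Taylor remainder cost an amount free of \<lambda>, while
  the quadratic variation gains a multiple of \<lambda> c^2.

  What the grid argument yields is a bound on the expected time spent in the active state. Markov's
  inequality turns it into the statement that a stretch of length \<epsilon> has probability at most
  e, for every e > 0.\<close>

lemma locally_bounded_on_compact:
  assumes "locally_bounded_on S f" "compact K" "K \<subseteq> S"
  shows "bounded (f ` K)"
proof -
  have "\<forall>p\<in>K. \<exists>U. open U \<and> p \<in> U \<and> bounded (f ` (U \<inter> S))"
    using assms unfolding locally_bounded_on_def by blast
  then obtain U where U: "\<And>p. p \<in> K \<Longrightarrow> open (U p) \<and> p \<in> U p \<and> bounded (f ` (U p \<inter> S))"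
    by metis
  obtain D where D: "D \<subseteq> K" "finite D" "K \<subseteq> (\<Union>p\<in>D. U p)"
    by (rule compactE_image[OF assms(2), of K U]) (use U in auto)
  have "f ` K \<subseteq> (\<Union>p\<in>D. f ` (U p \<inter> S))"
    using D(3) assms(3) by blast
  moreover have "bounded (\<Union>p\<in>D. f ` (U p \<inter> S))"
    using D U by (intro bounded_UN) auto
  ultimately show ?thesis by (rule bounded_subset[rotated])
qed

lemma norm_matrix_vector_mult_le:
  fixes A :: "real^'n^'m"
  shows "norm (A *v x) \<le> norm A * norm x"
proof -
  have "(norm (A *v x))\<^sup>2 = (\<Sum>i\<in>UNIV. (A $ i \<bullet> x)\<^sup>2)"
    by (simp add: norm_vec_def L2_set_def sum_nonneg matrix_vector_mult_def inner_vec_def)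
  also have "\<dots> \<le> (\<Sum>i\<in>UNIV. (norm (A $ i))\<^sup>2 * (norm x)\<^sup>2)"
    by (intro sum_mono) (metis Cauchy_Schwarz_ineq2 abs_ge_zero power2_abs power_mono power_mult_distrib)
  also have "\<dots> = (norm A * norm x)\<^sup>2"
    by (simp add: norm_vec_def[of A] L2_set_def sum_nonneg power_mult_distrib sum_distrib_right)
  finally show ?thesis
    by (rule power2_le_imp_le) simp
qed

lemma norm_transpose: "norm (transpose A) = norm (A :: real^'n^'m)"
proof -
  have "(\<Sum>i\<in>UNIV. \<Sum>j\<in>UNIV. (A $ j $ i)\<^sup>2) = (\<Sum>j\<in>UNIV. \<Sum>i\<in>UNIV. (A $ j $ i)\<^sup>2)"
    by (rule sum.swap)
  then show ?thesis
    by (simp add: norm_vec_def L2_set_def sum_nonneg transpose_def)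
qed

lemma norm_transpose_mult_le: "norm (transpose A *v p) \<le> norm (A :: real^'n^'m) * norm p"
  by (metis norm_matrix_vector_mult_le norm_transpose)

lemma inner_matrix_vector: "p \<bullet> (A *v w) = (transpose A *v p) \<bullet> (w :: real^'n)"
  by (simp add: dot_lmul_matrix[symmetric])

text \<open>Time enters to first order and space to second order, which is the same order for one
  diffusion step. The time increment is taken at the fixed point \<open>x + u\<close>, the spatial
  one at the fixed time \<open>t\<close>. The derivatives are bounded on the ball of radius
  \<open>N + 1\<close> because \<open>x + u\<close> may leave the ball of radius
  \<open>N\<close>.\<close>

lemma C12_local_bounds:
  fixes \<Phi> :: "real \<Rightarrow> real^'d \<Rightarrow> real"
  assumes C: "C12 \<Phi>" and T: "0 < T" and N: "0 < N"
  shows "\<exists>P>0. \<exists>K>0. (\<forall>t\<in>{0..T}. \<forall>x. norm x \<le> N \<longrightarrow> norm (grad (\<Phi> t) x) \<le> P) \<and>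
    (\<forall>t s x u. 0 \<le> t \<and> t \<le> s \<and> s \<le> T \<and> norm x \<le> N \<and> norm u \<le> 1 \<longrightarrow>
       \<bar>\<Phi> s (x + u) - \<Phi> t x - grad (\<Phi> t) x \<bullet> u\<bar> \<le> K * ((s - t) + (norm u)\<^sup>2))"
proof -
  obtain Dt Dx Dxx where
    dt: "\<And>t x. t \<ge> 0 \<Longrightarrow> ((\<lambda>s. \<Phi> s x) has_real_derivative Dt t x) (at t within {0..})" and
    dx: "\<And>t x. t \<ge> 0 \<Longrightarrow> GDERIV (\<Phi> t) x :> Dx t x" and
    dxx: "\<And>t x. t \<ge> 0 \<Longrightarrow> (Dx t has_derivative (\<lambda>h. Dxx t x *v h)) (at x)" and
    cdt: "continuous_on ({0..} \<times> UNIV) (\<lambda>(t, x). Dt t x)" and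
    cdx: "continuous_on ({0..} \<times> UNIV) (\<lambda>(t, x). Dx t x)" and
    cdxx: "continuous_on ({0..} \<times> UNIV) (\<lambda>(t, x). Dxx t x :: real^'d^'d)"
    using C unfolding C12_def by metis
  let ?Kc = "{0..T} \<times> cball (0::real^'d) (N + 1)"
  have cpt: "compact ?Kc" by (intro compact_Times) auto
  have sub: "?Kc \<subseteq> {0..} \<times> UNIV" by auto
  have bd: "\<exists>B>0. \<forall>t\<in>{0..T}. \<forall>x. norm x \<le> N + 1 \<longrightarrow> norm (g t x) \<le> B"
    if "continuous_on ({0..} \<times> UNIV) (\<lambda>(t, x). g t x)"
    for g :: "real \<Rightarrow> real^'d \<Rightarrow> 'z::real_normed_vector"
  proof -
    have "compact ((\<lambda>(t, x). g t x) ` ?Kc)"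
      by (rule compact_continuous_image[OF continuous_on_subset[OF that sub] cpt])
    then have "bounded ((\<lambda>(t, x). g t x) ` ?Kc)" by (rule compact_imp_bounded)
    then obtain B where "B > 0" "\<forall>y\<in>(\<lambda>(t, x). g t x) ` ?Kc. norm y \<le> B"
      unfolding bounded_pos by blast
    then show ?thesis by (intro exI[of _ B]) force
  qed
  obtain P where P: "P > 0" "\<And>t x. t \<in> {0..T} \<Longrightarrow> norm x \<le> N + 1 \<Longrightarrow> norm (Dx t x) \<le> P"
    using bd[OF cdx] by blast
  obtain K1 where K1: "K1 > 0" "\<And>t x. t \<in> {0..T} \<Longrightarrow> norm x \<le> N + 1 \<Longrightarrow> norm (Dt t x) \<le> K1"
    using bd[OF cdt] by blast
  obtain K2 where K2: "K2 > 0" "\<And>t x. t \<in> {0..T} \<Longrightarrow> norm x \<le> N + 1 \<Longrightarrow> norm (Dxx t x) \<le> K2"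
    using bd[OF cdxx] by blast
  have gr: "grad (\<Phi> t) x = Dx t x" if "t \<ge> 0" for t x
    using grad_eq[OF dx[OF that]] .
  have taylor: "\<bar>\<Phi> s (x + u) - \<Phi> t x - grad (\<Phi> t) x \<bullet> u\<bar> \<le> (K1 + K2) * ((s - t) + (norm u)\<^sup>2)"
    if A: "0 \<le> t" "t \<le> s" "s \<le> T" "norm x \<le> N" "norm u \<le> 1" for t s x u
  proof -
    have seg: "norm y \<le> N + 1" "norm (y - x) \<le> norm u" if "y \<in> cball x (norm u)" for y
      using that A norm_triangle_sub[of y x] by (auto simp: dist_norm norm_minus_commute)
    have "norm (\<Phi> s (x + u) - \<Phi> t (x + u)) \<le> K1 * norm (s - t)"
    proof (rule field_differentiable_bound[where S = "{t..s}" and f' = "\<lambda>r. Dt r (x + u)"])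
      show "((\<lambda>s. \<Phi> s (x + u)) has_real_derivative Dt r (x + u)) (at r within {t..s})"
        if "r \<in> {t..s}" for r
        using that A by (intro DERIV_subset[OF dt]) auto
      show "norm (Dt r (x + u)) \<le> K1" if "r \<in> {t..s}" for r
        using that A by (intro K1) (auto intro: norm_triangle_le)
    qed (use A in auto)
    then have 1: "\<bar>\<Phi> s (x + u) - \<Phi> t (x + u)\<bar> \<le> K1 * (s - t)"
      using A by simp
    have lip: "norm (Dx t y - Dx t x) \<le> K2 * norm u" if y: "y \<in> cball x (norm u)" for y
    proof -
      have "norm (Dx t y - Dx t x) \<le> K2 * norm (y - x)"
      proof (rule differentiable_bound[where S = "cball x (norm u)" and f' = "\<lambda>z h. Dxx t z *v h"])
        show "(Dx t has_derivative (\<lambda>h. Dxx t z *v h)) (at z within cball x (norm u))" for z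
          by (rule has_derivative_at_withinI[OF dxx[OF A(1)]])
        show "onorm (\<lambda>h. Dxx t z *v h) \<le> K2" if z: "z \<in> cball x (norm u)" for z
        proof (rule onorm_le)
          fix h
          have "norm (Dxx t z *v h) \<le> norm (Dxx t z) * norm h" by (rule norm_matrix_vector_mult_le)
          also have "\<dots> \<le> K2 * norm h"
            using K2(2)[of t z] seg[OF z] A by (intro mult_right_mono) auto
          finally show "norm (Dxx t z *v h) \<le> K2 * norm h" .
        qed
      qed (use y in auto)
      also have "\<dots> \<le> K2 * norm u" using seg[OF y] K2 by simp
      finally show ?thesis .
    qed
    \<comment> \<open>Without its tangent at \<open>x\<close> the function has a gradient of norm at
      most \<open>K2 * norm u\<close> on the ball of radius \<open>norm u\<close>, so the mean value
      inequality gives a quadratic remainder.\<close>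
    let ?g = "\<lambda>y. \<Phi> t y - Dx t x \<bullet> y"
    have "norm (?g (x + u) - ?g x) \<le> (K2 * norm u) * norm (x + u - x)"
    proof (rule differentiable_bound[where S = "cball x (norm u)" and f' = "\<lambda>z h. (Dx t z - Dx t x) \<bullet> h"])
      show "(?g has_derivative (\<lambda>h. (Dx t z - Dx t x) \<bullet> h)) (at z within cball x (norm u))" for z
      proof (rule has_derivative_at_withinI)
        have "(\<Phi> t has_derivative (\<lambda>h. h \<bullet> Dx t z)) (at z)"
          using dx[of t z] A by (simp add: gderiv_def)
        then have "(?g has_derivative (\<lambda>h. h \<bullet> Dx t z - Dx t x \<bullet> h)) (at z)"
          by (auto intro!: derivative_eq_intros)
        then show "(?g has_derivative (\<lambda>h. (Dx t z - Dx t x) \<bullet> h)) (at z)"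
          by (simp add: inner_diff_left inner_diff_right inner_commute)
      qed
      show "onorm (\<lambda>h. (Dx t z - Dx t x) \<bullet> h) \<le> K2 * norm u" if z: "z \<in> cball x (norm u)" for z
      proof (rule onorm_le)
        fix h
        have "norm ((Dx t z - Dx t x) \<bullet> h) \<le> norm (Dx t z - Dx t x) * norm h"
          using Cauchy_Schwarz_ineq2 by simp
        also have "\<dots> \<le> K2 * norm u * norm h"
          using lip[OF z] by (intro mult_right_mono) auto
        finally show "norm ((Dx t z - Dx t x) \<bullet> h) \<le> K2 * norm u * norm h" .
      qed
    qed (auto simp: dist_norm)
    then have 2: "\<bar>\<Phi> t (x + u) - \<Phi> t x - Dx t x \<bullet> u\<bar> \<le> K2 * (norm u)\<^sup>2"
      by (simp add: inner_add_right power2_eq_square algebra_simps)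
    have "\<bar>\<Phi> s (x + u) - \<Phi> t x - grad (\<Phi> t) x \<bullet> u\<bar> \<le> K1 * (s - t) + K2 * (norm u)\<^sup>2"
      using 1 2 A by (simp add: gr)
    also have "\<dots> \<le> (K1 + K2) * ((s - t) + (norm u)\<^sup>2)"
    proof -
      have "0 \<le> K2 * (s - t)" "0 \<le> K1 * (norm u)\<^sup>2" using K1 K2 A by auto
      then show ?thesis by (simp add: algebra_simps)
    qed
    finally show ?thesis .
  qed
  have "\<forall>t\<in>{0..T}. \<forall>x. norm x \<le> N \<longrightarrow> norm (grad (\<Phi> t) x) \<le> P"
    using P by (auto simp: gr)
  then show ?thesis
    using P(1) K1(1) K2(1) taylor by (intro exI[of _ P] exI[of _ "K1 + K2"] conjI) auto
qed

lemma C12_continuous: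
  fixes \<Phi> :: "real \<Rightarrow> real^'d \<Rightarrow> real"
  assumes "C12 \<Phi>"
  shows "continuous_on ({0..} \<times> UNIV) (\<lambda>(t, x). \<Phi> t x)"
    and "continuous_on ({0..} \<times> UNIV) (\<lambda>(t, x). grad (\<Phi> t) x)"
proof -
  obtain Dx where
    dx: "\<And>t x. t \<ge> 0 \<Longrightarrow> GDERIV (\<Phi> t) x :> Dx t x" and
    cdx: "continuous_on ({0..} \<times> UNIV) (\<lambda>(t, x). Dx t x)"
    using assms unfolding C12_def by metis
  show "continuous_on ({0..} \<times> UNIV) (\<lambda>(t, x). \<Phi> t x)"
    using assms unfolding C12_def by auto
  show "continuous_on ({0..} \<times> UNIV) (\<lambda>(t, x). grad (\<Phi> t) x)"
    using cdx by (rule continuous_on_eq) (auto simp: grad_eq[OF dx])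
qed

lemma uniformly_close_on_cball:
  fixes g :: "real \<Rightarrow> real^'d \<Rightarrow> 'z::metric_space"
  assumes "continuous_on ({0..} \<times> UNIV) (\<lambda>(t, x). g t x)" "0 < e"
  shows "\<exists>d>0. \<forall>s\<in>{0..T}. \<forall>r\<in>{0..T}. \<forall>x y. norm x \<le> N \<and> norm y \<le> N \<and> \<bar>s - r\<bar> \<le> d \<and>
      norm (x - y) \<le> d \<longrightarrow> dist (g s x) (g r y) < e"
proof -
  let ?K = "{0..T} \<times> cball (0::real^'d) N"
  have "continuous_on ?K (\<lambda>(t, x). g t x)"
    using assms(1) by (rule continuous_on_subset) auto
  moreover have "compact ?K" by (intro compact_Times) auto
  ultimately have "uniformly_continuous_on ?K (\<lambda>(t, x). g t x)"
    by (rule compact_uniformly_continuous)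
  then obtain d where d: "d > 0" "\<And>p q. p \<in> ?K \<Longrightarrow> q \<in> ?K \<Longrightarrow> dist q p < d \<Longrightarrow>
      dist ((\<lambda>(t, x). g t x) q) ((\<lambda>(t, x). g t x) p) < e"
    using assms(2) unfolding uniformly_continuous_on_def by metis
  have "dist (g s x) (g r y) < e"
    if A: "s \<in> {0..T}" "r \<in> {0..T}" "norm x \<le> N" "norm y \<le> N" "\<bar>s - r\<bar> \<le> d / 3" "norm (x - y) \<le> d / 3"
    for s r x y
  proof -
    have "dist (s, x) (r, y) \<le> dist s r + dist x y"
      by (simp add: dist_Pair_Pair sqrt_sum_squares_le_sum)
    also have "\<dots> < d" using A d(1) by (auto simp: dist_norm)
    finally show ?thesis using d(2)[of "(r, y)" "(s, x)"] A by auto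
  qed
  then show ?thesis using d(1) by (intro exI[of _ "d / 3"]) auto
qed

text \<open>Reduction to countably many times, for measurability. The rationals are taken in the
  parameter interval [0, 1] rather than in \<open>{s..t}\<close>, because a degenerate interval at
  an irrational point contains no rational.\<close>

lemma ball_interval_iff_rat:
  fixes u :: "real \<Rightarrow> real"
  assumes "continuous_on {s..t} u" "s \<le> t"
  shows "(\<forall>r\<in>{s..t}. u r \<le> a) \<longleftrightarrow> (\<forall>q\<in>\<rat> \<inter> {0..1}. u (s + q * (t - s)) \<le> a)"
proof
  assume "\<forall>r\<in>{s..t}. u r \<le> a"
  moreover have "s + q * (t - s) \<in> {s..t}" if "q \<in> {0..1}" for q
    using that assms(2) mult_right_mono[of q 1 "t - s"] by auto
  ultimately show "\<forall>q\<in>\<rat> \<inter> {0..1}. u (s + q * (t - s)) \<le> a" by blast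
next
  assume R: "\<forall>q\<in>\<rat> \<inter> {0..1}. u (s + q * (t - s)) \<le> a"
  let ?v = "\<lambda>q. u (s + q * (t - s))"
  have inn: "s + q * (t - s) \<in> {s..t}" if "q \<in> {0..1}" for q
    using that assms(2) mult_right_mono[of q 1 "t - s"] by auto
  have cv: "continuous_on {0..1} ?v"
  proof (rule continuous_on_compose2[OF assms(1)])
    show "continuous_on {0..1} (\<lambda>q. s + q * (t - s))" by (intro continuous_intros)
    show "(\<lambda>q. s + q * (t - s)) ` {0..1} \<subseteq> {s..t}" using inn by blast
  qed
  have v: "?v q \<le> a" if q: "q \<in> {0..1}" for q
  proof (rule ccontr)
    assume "\<not> ?v q \<le> a"
    then have "\<exists>d>0. \<forall>x'\<in>{0..1}. dist x' q < d \<longrightarrow> dist (?v x') (?v q) < ?v q - a"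
      using cv[unfolded continuous_on_iff, rule_format, OF q, of "?v q - a"] by simp
    then obtain d where d: "d > 0" "\<And>x'. x' \<in> {0..1} \<Longrightarrow> dist x' q < d \<Longrightarrow> dist (?v x') (?v q) < ?v q - a"
      by blast
    have "max 0 (q - d) < min 1 (q + d)" using q d(1) by auto
    then obtain x' where x': "x' \<in> \<rat>" "max 0 (q - d) < x'" "x' < min 1 (q + d)"
      using Rats_dense_in_real by blast
    have "dist (?v x') (?v q) < ?v q - a"
      using x' by (intro d(2)) (auto simp: dist_real_def)
    moreover have "?v x' \<le> a" using R x' by auto
    ultimately show False by (simp add: dist_real_def)
  qed
  show "\<forall>r\<in>{s..t}. u r \<le> a"
  proof
    fix r assume r: "r \<in> {s..t}"
    show "u r \<le> a"
    proof (cases "s = t")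
      case True
      then show ?thesis using r v[of 0] by auto
    next
      case False
      have "s + (r - s) / (t - s) * (t - s) = r" using False by simp
      moreover have "(r - s) / (t - s) \<in> {0..1}" using r assms(2) False by (auto simp: field_simps)
      ultimately show ?thesis using v[of "(r - s) / (t - s)"] by metis
    qed
  qed
qed

lemma sets_Collect_ball_interval:
  fixes u :: "real \<Rightarrow> 'a \<Rightarrow> real"
  assumes "\<And>r. r \<in> {s..t} \<Longrightarrow> u r \<in> borel_measurable M"
    and "\<And>\<omega>. \<omega> \<in> space M \<Longrightarrow> continuous_on {s..t} (\<lambda>r. u r \<omega>)" and "s \<le> t"
  shows "{\<omega>\<in>space M. \<forall>r\<in>{s..t}. u r \<omega> \<le> a} \<in> sets M"
proof -
  have inn: "s + q * (t - s) \<in> {s..t}" if "q \<in> {0..1}" for q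
    using that assms(3) mult_right_mono[of q 1 "t - s"] by auto
  have "{\<omega>\<in>space M. \<forall>r\<in>{s..t}. u r \<omega> \<le> a} =
    {\<omega>\<in>space M. \<forall>q\<in>\<rat> \<inter> {0..1}. u (s + q * (t - s)) \<omega> \<le> a}"
    using ball_interval_iff_rat[OF assms(2) assms(3)] by auto
  also have "\<dots> = (\<Inter>q\<in>\<rat> \<inter> {0..1}. {\<omega>\<in>space M. u (s + q * (t - s)) \<omega> \<le> a})"
    using Rats_0 by fastforce
  also have "\<dots> \<in> sets M"
  proof (rule sets.countable_INT')
    show "countable (\<rat> \<inter> {0..1::real})" using countable_rat by blast
    show "\<rat> \<inter> {0..1::real} \<noteq> {}" using Rats_0 by fastforce
    have "{\<omega>\<in>space M. u (s + q * (t - s)) \<omega> \<le> a} \<in> sets M" if q: "q \<in> \<rat> \<inter> {0..1}" for q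
    proof -
      have [measurable]: "u (s + q * (t - s)) \<in> borel_measurable M"
        by (rule assms(1)) (use q inn in auto)
      show ?thesis by measurable
    qed
    then show "(\<lambda>q. {\<omega>\<in>space M. u (s + q * (t - s)) \<omega> \<le> a}) ` (\<rat> \<inter> {0..1}) \<subseteq> sets M" by blast
  qed
  finally show ?thesis .
qed

text \<open>By compactness a path that is negative on all of \<open>{s..t}\<close> has a negative
  maximum there and stays below some -1/(k+1); hence the complement is a countable union of events
  of the preceding kind. Applied with a member of the filtration in place of \<open>M\<close>, this
  makes "hit before a grid time" an adapted event.\<close>

lemma sets_Collect_hit_interval:
  fixes u :: "real \<Rightarrow> 'a \<Rightarrow> real"
  assumes "\<And>r. r \<in> {s..t} \<Longrightarrow> u r \<in> borel_measurable M"
    and "\<And>\<omega>. \<omega> \<in> space M \<Longrightarrow> continuous_on {s..t} (\<lambda>r. u r \<omega>)" and "s \<le> t"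
  shows "{\<omega>\<in>space M. \<exists>r\<in>{s..t}. 0 \<le> u r \<omega>} \<in> sets M"
proof -
  have "{\<omega>\<in>space M. \<exists>r\<in>{s..t}. 0 \<le> u r \<omega>} =
    space M - (\<Union>k. {\<omega>\<in>space M. \<forall>r\<in>{s..t}. u r \<omega> \<le> - inverse (real (Suc k))})"
  proof (intro equalityI subsetI)
    fix \<omega> assume "\<omega> \<in> {\<omega>\<in>space M. \<exists>r\<in>{s..t}. 0 \<le> u r \<omega>}"
    then obtain r where "\<omega> \<in> space M" "r \<in> {s..t}" "0 \<le> u r \<omega>" by auto
    moreover have "- inverse (real (Suc k)) < 0" for k by simp
    ultimately show "\<omega> \<in> space M - (\<Union>k. {\<omega>\<in>space M. \<forall>r\<in>{s..t}. u r \<omega> \<le> - inverse (real (Suc k))})"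
      using order.strict_trans2 order.strict_trans1 not_less by blast
  next
    fix \<omega> assume A: "\<omega> \<in> space M - (\<Union>k. {\<omega>\<in>space M. \<forall>r\<in>{s..t}. u r \<omega> \<le> - inverse (real (Suc k))})"
    have "\<exists>r\<in>{s..t}. 0 \<le> u r \<omega>"
    proof (rule ccontr)
      assume "\<not> ?thesis"
      then have neg: "\<And>r. r \<in> {s..t} \<Longrightarrow> u r \<omega> < 0" by (meson not_less)
      obtain r0 where r0: "r0 \<in> {s..t}" "\<And>r. r \<in> {s..t} \<Longrightarrow> u r \<omega> \<le> u r0 \<omega>"
        using continuous_attains_sup[of "{s..t}" "\<lambda>r. u r \<omega>"] assms(2,3) A by auto
      obtain k where "inverse (real (Suc k)) < - u r0 \<omega>"
        using reals_Archimedean[of "- u r0 \<omega>"] neg[OF r0(1)] by auto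
      then have "\<forall>r\<in>{s..t}. u r \<omega> \<le> - inverse (real (Suc k))"
        using r0(2) by force
      then show False using A by blast
    qed
    then show "\<omega> \<in> {\<omega>\<in>space M. \<exists>r\<in>{s..t}. 0 \<le> u r \<omega>}" using A by blast
  qed
  also have "\<dots> \<in> sets M"
    using sets_Collect_ball_interval[OF assms] by auto
  finally show ?thesis .
qed

section \<open>Gaussian moments of Brownian increments\<close>

lemma nn_integral_lborel_vec_prod:
  fixes f :: "'m::finite \<Rightarrow> real \<Rightarrow> ennreal"
  assumes [measurable]: "\<And>i. f i \<in> borel_measurable borel"
  shows "(\<integral>\<^sup>+x. (\<Prod>i\<in>UNIV. f i (x $ i)) \<partial>(lborel :: (real^'m) measure)) = (\<Prod>i\<in>UNIV. \<integral>\<^sup>+x. f i x \<partial>lborel)"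
proof -
  let ?e = "\<lambda>i. axis i (1::real) :: real^'m"
  have inj: "inj ?e" by (auto simp: inj_on_def axis_eq_axis)
  have B: "(Basis :: (real^'m) set) = range ?e" by (auto simp: Basis_vec_def)
  have P: "(\<Prod>b\<in>Basis. h (inv ?e b) b) = (\<Prod>i\<in>UNIV. h i (?e i))" for h :: "'m \<Rightarrow> real^'m \<Rightarrow> ennreal"
    unfolding B by (subst prod.reindex[OF inj]) (simp add: inv_f_f[OF inj])
  have "(\<integral>\<^sup>+x. (\<Prod>b\<in>Basis. f (inv ?e b) (x \<bullet> b)) \<partial>(lborel :: (real^'m) measure)) =
      (\<Prod>b\<in>(Basis :: (real^'m) set). \<integral>\<^sup>+x. f (inv ?e b) x \<partial>lborel)"
    by (rule nn_integral_lborel_prod[OF assms]) simp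
  then show ?thesis
    using P[of "\<lambda>i b. \<integral>\<^sup>+x. f i x \<partial>lborel"]
    by (subst (asm) P) (simp add: cart_eq_inner_axis[symmetric])
qed

text \<open>A diagonal map with entries 1 and -1 has Jacobian of modulus 1. The symmetry serves to
  make odd Gaussian integrals vanish without computing them.\<close>

lemma lborel_distr_reflect:
  fixes b :: "'m::finite"
  defines "R \<equiv> (\<lambda>x::real^'m. \<chi> i. if i = b then - x $ i else x $ i)"
  shows "lborel = distr lborel borel R"
proof -
  let ?e = "\<lambda>i. axis i (1::real) :: real^'m"
  have inj: "inj ?e" by (auto simp: inj_on_def axis_eq_axis)
  have B: "(Basis :: (real^'m) set) = range ?e" by (auto simp: Basis_vec_def)
  let ?c = "\<lambda>j::real^'m. if j = ?e b then -1 else 1 :: real"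
  have R: "R = (\<lambda>x. 0 + (\<Sum>j\<in>Basis. (?c j * (x \<bullet> j)) *\<^sub>R j))"
  proof (rule ext)
    fix x :: "real^'m"
    have "(\<Sum>j\<in>Basis. (?c j * (x \<bullet> j)) *\<^sub>R j) = (\<Sum>i\<in>UNIV. (?c (?e i) * x $ i) *\<^sub>R ?e i)"
      unfolding B by (subst sum.reindex[OF inj]) (simp add: cart_eq_inner_axis[symmetric])
    also have "\<dots> = (\<Sum>i\<in>UNIV. (R x $ i) *\<^sub>R ?e i)"
      by (rule sum.cong) (auto simp: R_def axis_eq_axis)
    also have "\<dots> = R x"
      using basis_expansion[of "R x"] by (simp add: scalar_mult_eq_scaleR)
    finally show "R x = 0 + (\<Sum>j\<in>Basis. (?c j * (x \<bullet> j)) *\<^sub>R j)" by simp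
  qed
  have "lborel = density (distr lborel borel R) (\<lambda>_. (\<Prod>j\<in>(Basis :: (real^'m) set). \<bar>?c j\<bar>))"
    unfolding R by (rule lborel_affine_euclidean) auto
  also have "(\<Prod>j\<in>(Basis :: (real^'m) set). \<bar>?c j\<bar>) = 1"
    by (rule prod.neutral) auto
  finally show ?thesis by (simp add: density_1)
qed

text \<open>Cauchy-Schwarz for the squared coordinates against the constant 1. It reduces fourth
  moments of vectors to those of their coordinates.\<close>

lemma norm_power4_le_sum:
  fixes x :: "real^'d"
  shows "norm x ^ 4 \<le> real CARD('d) * (\<Sum>a\<in>UNIV. (x $ a) ^ 4)"
proof -
  have "norm x ^ 4 = ((norm x)\<^sup>2)\<^sup>2" by simp
  also have "\<dots> = (\<Sum>b\<in>UNIV. 1 * (x $ b)\<^sup>2)\<^sup>2"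
    by (simp add: norm_vec_def L2_set_def sum_nonneg)
  also have "\<dots> \<le> (\<Sum>b\<in>(UNIV::'d set). 1\<^sup>2) * (\<Sum>b\<in>UNIV. ((x $ b)\<^sup>2)\<^sup>2)"
    by (rule Cauchy_Schwarz_ineq_sum)
  finally show ?thesis by simp
qed

definition gauss_density :: "real \<Rightarrow> real^'m \<Rightarrow> real" where
  "gauss_density \<sigma> x = (\<Prod>i\<in>UNIV. normal_density 0 \<sigma> (x $ i))"

lemma gauss_density_nonneg [simp]: "0 \<le> gauss_density \<sigma> x"
  unfolding gauss_density_def by (intro prod_nonneg) auto

lemma borel_measurable_vec_component [measurable]: "(\<lambda>x::real^'m. x $ i) \<in> borel_measurable borel"
  by (intro borel_measurable_continuous_onI continuous_intros)

lemma gauss_density_measurable [measurable]: "gauss_density \<sigma> \<in> borel_measurable borel"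
  unfolding gauss_density_def[abs_def] by measurable

text \<open>The reflection of coordinate \<open>b\<close> preserves Lebesgue measure and the density
  and flips the sign of \<open>g\<close>, so the integral equals its own negative.\<close>

lemma gauss_odd_integral:
  fixes g :: "real^'m \<Rightarrow> real" and b :: 'm
  assumes [measurable]: "g \<in> borel_measurable borel"
    and odd: "\<And>x. g (\<chi> i. if i = b then - x $ i else x $ i) = - g x"
  shows "(LINT x|lborel. gauss_density \<sigma> x * g x) = 0"
proof -
  let ?R = "\<lambda>x::real^'m. \<chi> i. if i = b then - x $ i else x $ i"
  have [measurable]: "?R \<in> borel_measurable borel"
  proof (intro borel_measurable_continuous_onI continuous_on_vec_lambda)
    show "continuous_on UNIV (\<lambda>x::real^'m. if i = b then - x $ i else x $ i)" for i
      by (cases "i = b") (auto intro!: continuous_intros)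
  qed
  have dens: "gauss_density \<sigma> (?R x) = gauss_density \<sigma> x" for x :: "real^'m"
    unfolding gauss_density_def by (intro prod.cong) (auto simp: normal_density_def)
  have "(LINT x|lborel. gauss_density \<sigma> x * g x) = (LINT x|distr lborel borel ?R. gauss_density \<sigma> x * g x)"
    using lborel_distr_reflect[of b] by simp
  also have "\<dots> = (LINT x|lborel. gauss_density \<sigma> (?R x) * g (?R x))"
    by (subst integral_distr) auto
  also have "\<dots> = - (LINT x|lborel. gauss_density \<sigma> x * g x)"
    by (simp add: dens odd)
  finally show ?thesis by simp
qed

text \<open>The density is a product, so the integral splits over the coordinates, and every factor
  except that of \<open>b\<close> is 1. The value is (2k-1)!! times the 2k-th power of
  \<sigma>.\<close>

lemma gauss_even_moment:
  fixes b :: "'m::finite"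
  assumes s: "0 < \<sigma>"
  shows "(\<integral>\<^sup>+x. ennreal (gauss_density \<sigma> x) * ennreal ((x $ b) ^ (2 * k)) \<partial>(lborel :: (real^'m) measure)) =
    ennreal (fact (2 * k) / ((2 / \<sigma>\<^sup>2)^k * fact k))"
proof -
  let ?f = "\<lambda>i y. ennreal (normal_density 0 \<sigma> y * (if i = b then y ^ (2 * k) else 1))"
  have "(\<integral>\<^sup>+x. ennreal (gauss_density \<sigma> x) * ennreal ((x $ b) ^ (2 * k)) \<partial>(lborel :: (real^'m) measure)) =
     (\<integral>\<^sup>+x. (\<Prod>i\<in>UNIV. ?f i (x $ i)) \<partial>(lborel :: (real^'m) measure))"
  proof (rule nn_integral_cong)
    fix x :: "real^'m"
    have "(\<Prod>i\<in>UNIV. ?f i (x $ i)) = ennreal (\<Prod>i\<in>UNIV. normal_density 0 \<sigma> (x $ i) * (if i = b then (x $ i) ^ (2 * k) else 1))"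
      by (rule prod_ennreal) (auto simp: zero_le_even_power)
    also have "(\<Prod>i\<in>UNIV. normal_density 0 \<sigma> (x $ i) * (if i = b then (x $ i) ^ (2 * k) else 1)) =
        gauss_density \<sigma> x * (x $ b) ^ (2 * k)"
      unfolding gauss_density_def prod.distrib by (simp add: prod.delta)
    finally show "ennreal (gauss_density \<sigma> x) * ennreal ((x $ b) ^ (2 * k)) = (\<Prod>i\<in>UNIV. ?f i (x $ i))"
      by (simp add: ennreal_mult' zero_le_even_power)
  qed
  also have "\<dots> = (\<Prod>i\<in>UNIV. \<integral>\<^sup>+y. ?f i y \<partial>lborel)"
    by (rule nn_integral_lborel_vec_prod) measurable
  also have "\<dots> = (\<Prod>i\<in>UNIV. if i = b then ennreal (fact (2 * k) / ((2 / \<sigma>\<^sup>2)^k * fact k)) else 1)"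
  proof (rule prod.cong[OF refl])
    fix i
    show "(\<integral>\<^sup>+y. ?f i y \<partial>lborel) = (if i = b then ennreal (fact (2 * k) / ((2 / \<sigma>\<^sup>2)^k * fact k)) else 1)"
    proof (cases "i = b")
      case True
      have hb: "has_bochner_integral lborel (\<lambda>x. normal_density 0 \<sigma> x * (x - 0) ^ (2 * k)) (fact (2 * k) / ((2 / \<sigma>\<^sup>2)^k * fact k))"
        using normal_moment_even[OF s] .
      have "(\<integral>\<^sup>+y. ?f i y \<partial>lborel) = ennreal (integral\<^sup>L lborel (\<lambda>x. normal_density 0 \<sigma> x * x ^ (2 * k)))"
      proof -
        have "(\<integral>\<^sup>+y. ?f i y \<partial>lborel) = (\<integral>\<^sup>+y. ennreal (normal_density 0 \<sigma> y * y ^ (2 * k)) \<partial>lborel)"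
          using True by simp
        also have "\<dots> = ennreal (integral\<^sup>L lborel (\<lambda>x. normal_density 0 \<sigma> x * x ^ (2 * k)))"
          by (rule nn_integral_eq_integral)
            (use hb in \<open>auto simp: has_bochner_integral_iff intro!: mult_nonneg_nonneg zero_le_even_power\<close>)
        finally show ?thesis .
      qed
      then show ?thesis using hb True by (simp add: has_bochner_integral_iff)
    next
      case False
      then have "(\<integral>\<^sup>+y. ?f i y \<partial>lborel) = (\<integral>\<^sup>+y. ennreal (normal_density 0 \<sigma> y) \<partial>lborel)" by simp
      also have "\<dots> = 1"
        by (subst nn_integral_eq_integral) (auto simp: s)
      finally show ?thesis using False by simp
    qed
  qed
  also have "\<dots> = ennreal (fact (2 * k) / ((2 / \<sigma>\<^sup>2)^k * fact k))"
    by (simp add: prod.delta)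
  finally show ?thesis .
qed

section \<open>Brownian increments: independence, moments, one-step martingale identities\<close>

locale brownian =
  fixes M :: "'a measure" and F :: "real \<Rightarrow> 'a measure" and W :: "real \<Rightarrow> 'a \<Rightarrow> real^'m"
  assumes fps: "filtered_prob_space M F" and bm: "brownian_motion M F W"
begin

sublocale prob_space M
  using fps by (simp add: filtered_prob_space_def)

lemma space_F [simp]: "space (F t) = space M"
  using fps by (auto simp: filtered_prob_space_def filtration_def)

lemma sets_F_mono: "s \<le> t \<Longrightarrow> sets (F s) \<subseteq> sets (F t)"
  using fps by (auto simp: filtered_prob_space_def filtration_def)

lemma sets_F_M: "0 \<le> t \<Longrightarrow> sets (F t) \<subseteq> sets M"
  using fps by (auto simp: filtered_prob_space_def subalgebra_def)

lemma measurable_F_mono: "f \<in> measurable (F s) N \<Longrightarrow> s \<le> t \<Longrightarrow> f \<in> measurable (F t) N"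
  using measurable_mono[of N N "F s" "F t"] sets_F_mono by auto

lemma measurable_F_M: "f \<in> measurable (F s) N \<Longrightarrow> 0 \<le> s \<Longrightarrow> f \<in> measurable M N"
  using measurable_mono[of N N "F s" M] sets_F_M by auto

lemma W_measurable: "0 \<le> t \<Longrightarrow> W t \<in> borel_measurable (F t)"
  using bm by (auto simp: brownian_motion_def adapted_def)

lemma W_measurable_M: "0 \<le> t \<Longrightarrow> W t \<in> borel_measurable M"
  using W_measurable measurable_F_M by blast

lemma distributed_inc:
  assumes "0 \<le> s" "s < t"
  shows "distributed M lborel (\<lambda>\<omega>. W t \<omega> - W s \<omega>) (\<lambda>x. ennreal (gauss_density (sqrt (t - s)) x))"
  using bm assms by (simp add: brownian_motion_def gauss_density_def)

text \<open>The \<sigma>-algebras generated by \<open>Z\<close> and by the function of the increment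
  lie inside the two independent ones, so expectations factor. The case \<open>s = t\<close>, on
  which the definition of Brownian motion is silent, has the constant \<phi>(0) as second
  factor.\<close>

lemma indep_inc:
  fixes \<phi> :: "real^'m \<Rightarrow> real"
  assumes st: "0 \<le> s" "s \<le> t"
    and Z: "Z \<in> borel_measurable (F s)" "integrable M Z"
    and \<phi>: "\<phi> \<in> borel_measurable borel" "integrable M (\<lambda>\<omega>. \<phi> (W t \<omega> - W s \<omega>))"
  shows "integrable M (\<lambda>\<omega>. Z \<omega> * \<phi> (W t \<omega> - W s \<omega>))"
    and "expectation (\<lambda>\<omega>. Z \<omega> * \<phi> (W t \<omega> - W s \<omega>)) = expectation Z * expectation (\<lambda>\<omega>. \<phi> (W t \<omega> - W s \<omega>))"
proof -
  let ?D = "\<lambda>\<omega>. W t \<omega> - W s \<omega>"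
  have "integrable M (\<lambda>\<omega>. Z \<omega> * \<phi> (?D \<omega>)) \<and>
    expectation (\<lambda>\<omega>. Z \<omega> * \<phi> (?D \<omega>)) = expectation Z * expectation (\<lambda>\<omega>. \<phi> (?D \<omega>))"
  proof (cases "s = t")
    case True
    then show ?thesis using Z prob_space by simp
  next
    case False
    then have lt: "s < t" using st by simp
    have I: "indep_set (sets (F s)) (sets (vimage_algebra (space M) ?D borel))"
      using bm st lt by (auto simp: brownian_motion_def)
    have [measurable]: "?D \<in> borel_measurable M"
      using W_measurable_M st by (intro borel_measurable_diff) auto
    have [measurable]: "Z \<in> borel_measurable M" using Z(2) by auto
    have [measurable]: "\<phi> \<in> borel_measurable borel" by fact
    have s1: "sigma_sets (space M) {Z -` A \<inter> space M |A. A \<in> sets borel} \<subseteq> sets (F s)"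
    proof -
      have "{Z -` A \<inter> space M |A. A \<in> sets borel} \<subseteq> sets (F s)"
        using measurable_sets[OF Z(1)] by auto
      then show ?thesis using sets.sigma_sets_subset[of _ "F s"] by simp
    qed
    have s2: "sigma_sets (space M) {(\<lambda>\<omega>. \<phi> (?D \<omega>)) -` A \<inter> space M |A. A \<in> sets borel}
        \<subseteq> sets (vimage_algebra (space M) ?D borel)"
    proof -
      have "(\<lambda>\<omega>. \<phi> (?D \<omega>)) -` A \<inter> space M \<in> sets (vimage_algebra (space M) ?D borel)" if "A \<in> sets borel" for A
      proof -
        have "(\<lambda>\<omega>. \<phi> (?D \<omega>)) -` A \<inter> space M = ?D -` (\<phi> -` A \<inter> space borel) \<inter> space M" by auto
        moreover have "\<phi> -` A \<inter> space borel \<in> sets borel"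
          using \<phi>(1) that by (rule measurable_sets)
        ultimately show ?thesis by (simp add: in_vimage_algebra)
      qed
      then have "{(\<lambda>\<omega>. \<phi> (?D \<omega>)) -` A \<inter> space M |A. A \<in> sets borel} \<subseteq> sets (vimage_algebra (space M) ?D borel)"
        by auto
      then show ?thesis using sets.sigma_sets_subset[of _ "vimage_algebra (space M) ?D borel"] by simp
    qed
    have "indep_var borel Z borel (\<lambda>\<omega>. \<phi> (?D \<omega>))"
      unfolding indep_var_eq
    proof (intro conjI)
      show "indep_set (sigma_sets (space M) {Z -` A \<inter> space M |A. A \<in> sets borel})
        (sigma_sets (space M) {(\<lambda>\<omega>. \<phi> (?D \<omega>)) -` A \<inter> space M |A. A \<in> sets borel})"
        using I s1 s2 unfolding indep_sets2_eq by blast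
    qed measurable
    then show ?thesis
      using indep_var_integrable[OF _ Z(2) \<phi>(2)] indep_var_lebesgue_integral[OF _ Z(2) \<phi>(2)] by blast
  qed
  then show "integrable M (\<lambda>\<omega>. Z \<omega> * \<phi> (?D \<omega>))"
    and "expectation (\<lambda>\<omega>. Z \<omega> * \<phi> (?D \<omega>)) = expectation Z * expectation (\<lambda>\<omega>. \<phi> (?D \<omega>))" by auto
qed

lemma inc_even_moment:
  assumes st: "0 \<le> s" "s \<le> t"
  shows "integrable M (\<lambda>\<omega>. (W t \<omega> $ b - W s \<omega> $ b) ^ 2)"
    and "expectation (\<lambda>\<omega>. (W t \<omega> $ b - W s \<omega> $ b) ^ 2) = t - s"
    and "integrable M (\<lambda>\<omega>. (W t \<omega> $ b - W s \<omega> $ b) ^ 4)"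
    and "expectation (\<lambda>\<omega>. (W t \<omega> $ b - W s \<omega> $ b) ^ 4) = 3 * (t - s)\<^sup>2"
proof -
  have *: "integrable M (\<lambda>\<omega>. (W t \<omega> $ b - W s \<omega> $ b) ^ (2 * k)) \<and>
    expectation (\<lambda>\<omega>. (W t \<omega> $ b - W s \<omega> $ b) ^ (2 * k)) = fact (2 * k) / ((2 / (t - s))^k * fact k)"
    if k: "k > 0" for k
  proof (cases "s = t")
    case True
    \<comment> \<open>The formula remains correct for \<open>s = t\<close>: as \<open>k > 0\<close>,
      its right-hand side is a quotient with denominator 0, which has the value 0.\<close>
    then show ?thesis using k by (simp add: power_0_left)
  next
    case False
    then have lt: "s < t" using st by simp
    have [measurable]: "(\<lambda>\<omega>. (W t \<omega> $ b - W s \<omega> $ b) ^ (2 * k)) \<in> borel_measurable M"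
    proof -
      have [measurable]: "W t \<in> borel_measurable M" "W s \<in> borel_measurable M"
        using W_measurable_M st by auto
      show ?thesis by measurable
    qed
    have "(\<integral>\<^sup>+\<omega>. ennreal ((W t \<omega> $ b - W s \<omega> $ b) ^ (2 * k)) \<partial>M) =
        (\<integral>\<^sup>+\<omega>. (\<lambda>x. ennreal ((x $ b) ^ (2 * k))) (W t \<omega> - W s \<omega>) \<partial>M)" by simp
    also have "\<dots> = ennreal (fact (2 * k) / ((2 / (t - s))^k * fact k))"
      using lt by (subst distributed_nn_integral[OF distributed_inc[OF st(1) lt], symmetric])
        (auto simp: gauss_even_moment)
    finally have nn: "(\<integral>\<^sup>+\<omega>. ennreal ((W t \<omega> $ b - W s \<omega> $ b) ^ (2 * k)) \<partial>M) = ennreal (fact (2 * k) / ((2 / (t - s))^k * fact k))" .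
    have "0 \<le> fact (2 * k) / ((2 / (t - s))^k * fact k)" using lt by auto
    with nn show ?thesis
      by (intro conjI integrableI_nonneg integral_eq_nn_integral[THEN trans])
         (auto simp: zero_le_even_power)
  qed
  show "integrable M (\<lambda>\<omega>. (W t \<omega> $ b - W s \<omega> $ b) ^ 2)"
    and "expectation (\<lambda>\<omega>. (W t \<omega> $ b - W s \<omega> $ b) ^ 2) = t - s"
    using *[of 1] by auto
  show "integrable M (\<lambda>\<omega>. (W t \<omega> $ b - W s \<omega> $ b) ^ 4)"
    using *[of 2] by auto
  have f4: "fact 4 = (24::real)" by (simp add: fact_numeral)
  show "expectation (\<lambda>\<omega>. (W t \<omega> $ b - W s \<omega> $ b) ^ 4) = 3 * (t - s)\<^sup>2"
    using *[of 2] by (auto simp: f4 power_divide)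
qed

text \<open>One factor \<open>CARD('m)\<close> comes from \<open>norm_power4_le_sum\<close>, the
  other from summing over the coordinates. Only the order of magnitude in \<open>t - s\<close>
  matters later.\<close>

lemma inc_norm4:
  assumes st: "0 \<le> s" "s \<le> t"
  shows "integrable M (\<lambda>\<omega>. norm (W t \<omega> - W s \<omega>) ^ 4)"
    and "expectation (\<lambda>\<omega>. norm (W t \<omega> - W s \<omega>) ^ 4) \<le> 3 * (real CARD('m))\<^sup>2 * (t - s)\<^sup>2"
proof -
  have [measurable]: "W t \<in> borel_measurable M" "W s \<in> borel_measurable M"
    using W_measurable_M st by auto
  let ?S = "\<lambda>\<omega>. real CARD('m) * (\<Sum>b\<in>UNIV. (W t \<omega> $ b - W s \<omega> $ b) ^ 4)"
  have le: "norm (W t \<omega> - W s \<omega>) ^ 4 \<le> ?S \<omega>" for \<omega>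
    using norm_power4_le_sum[of "W t \<omega> - W s \<omega>"] by simp
  have int: "integrable M ?S"
    using inc_even_moment(3)[OF st] by (intro integrable_mult_right Bochner_Integration.integrable_sum) auto
  show i: "integrable M (\<lambda>\<omega>. norm (W t \<omega> - W s \<omega>) ^ 4)"
    by (rule Bochner_Integration.integrable_bound[OF int]) (use le in \<open>auto intro: order_trans[OF le abs_ge_self]\<close>)
  have "expectation (\<lambda>\<omega>. norm (W t \<omega> - W s \<omega>) ^ 4) \<le> expectation ?S"
    by (rule integral_mono[OF i int le])
  also have "\<dots> = 3 * (real CARD('m))\<^sup>2 * (t - s)\<^sup>2"
    using inc_even_moment[OF st] by (simp add: Bochner_Integration.integral_sum power2_eq_square)
  finally show "expectation (\<lambda>\<omega>. norm (W t \<omega> - W s \<omega>) ^ 4) \<le> 3 * (real CARD('m))\<^sup>2 * (t - s)\<^sup>2" .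
qed

text \<open>Reflecting coordinate \<open>b\<close> reverses the sign of \<open>x $ b\<close>, and of
  \<open>x $ b * x $ c\<close> if \<open>c\<close> differs from \<open>b\<close>, without changing
  the Gaussian law; so these means vanish. Integrability of the products comes from the bound of |x
  y| by the sum of the squares.\<close>

lemma inc_mixed:
  assumes st: "0 \<le> s" "s \<le> t"
  shows "integrable M (\<lambda>\<omega>. W t \<omega> $ b - W s \<omega> $ b)"
    and "expectation (\<lambda>\<omega>. W t \<omega> $ b - W s \<omega> $ b) = 0"
    and "integrable M (\<lambda>\<omega>. (W t \<omega> $ b - W s \<omega> $ b) * (W t \<omega> $ c - W s \<omega> $ c))"
    and "expectation (\<lambda>\<omega>. (W t \<omega> $ b - W s \<omega> $ b) * (W t \<omega> $ c - W s \<omega> $ c)) = (if b = c then t - s else 0)"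
proof -
  have [measurable]: "W t \<in> borel_measurable M" "W s \<in> borel_measurable M"
    using W_measurable_M st by auto
  show i1: "integrable M (\<lambda>\<omega>. W t \<omega> $ b - W s \<omega> $ b)"
    by (rule square_integrable_imp_integrable) (use inc_even_moment(1)[OF st] in auto)
  have le2: "\<bar>x * y\<bar> \<le> x\<^sup>2 + y\<^sup>2" for x y :: real
  proof -
    have "0 \<le> (\<bar>x\<bar> - \<bar>y\<bar>)\<^sup>2 + x\<^sup>2 + y\<^sup>2" by simp
    then show ?thesis by (simp add: power2_eq_square abs_mult algebra_simps)
  qed
  show i2: "integrable M (\<lambda>\<omega>. (W t \<omega> $ b - W s \<omega> $ b) * (W t \<omega> $ c - W s \<omega> $ c))"
    by (rule Bochner_Integration.integrable_bound[of _ "\<lambda>\<omega>. (W t \<omega> $ b - W s \<omega> $ b)\<^sup>2 + (W t \<omega> $ c - W s \<omega> $ c)\<^sup>2"])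
       (use inc_even_moment(1)[OF st] le2 in \<open>auto simp: abs_of_nonneg\<close>)
  have odd: "expectation (\<lambda>\<omega>. g (W t \<omega> - W s \<omega>)) = 0"
    if [measurable]: "g \<in> borel_measurable borel" and "\<And>x. g (\<chi> i. if i = b then - x $ i else x $ i) = - g x" and "s < t"
    for g :: "real^'m \<Rightarrow> real"
  proof -
    have "expectation (\<lambda>\<omega>. g (W t \<omega> - W s \<omega>)) = (LINT x|lborel. gauss_density (sqrt (t - s)) x * g x)"
      by (rule distributed_integral[OF distributed_inc[OF st(1) that(3)] _ gauss_density_nonneg, symmetric]) simp
    also have "\<dots> = 0"
      by (rule gauss_odd_integral[of g b, OF that(1,2)])
    finally show ?thesis .
  qed
  show "expectation (\<lambda>\<omega>. W t \<omega> $ b - W s \<omega> $ b) = 0"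
  proof (cases "s = t")
    case False
    have a: "(\<lambda>x::real^'m. x $ b) \<in> borel_measurable borel" by (rule borel_measurable_vec_component)
    have b: "(\<chi> i. if i = b then - x $ i else x $ i) $ b = - x $ b" for x :: "real^'m" by simp
    have c: "s < t" using False st by simp
    show ?thesis
      using odd[of "\<lambda>x. x $ b", OF a b c] by (simp only: vector_minus_component)
  next
    case True
    then show ?thesis by simp
  qed
  show "expectation (\<lambda>\<omega>. (W t \<omega> $ b - W s \<omega> $ b) * (W t \<omega> $ c - W s \<omega> $ c)) = (if b = c then t - s else 0)"
  proof (cases "s = t \<or> b = c")
    case True
    then show ?thesis using inc_even_moment(2)[OF st, of b] by (auto simp: power2_eq_square)
  next
    case False
    have a: "(\<lambda>x::real^'m. x $ b * x $ c) \<in> borel_measurable borel"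
      by (intro borel_measurable_times borel_measurable_vec_component)
    have b: "(\<chi> i. if i = b then - x $ i else x $ i) $ b * (\<chi> i. if i = b then - x $ i else x $ i) $ c = - (x $ b * x $ c)"
      for x :: "real^'m" using False by auto
    have c: "s < t" using False st by simp
    have d: "b \<noteq> c" using False by simp
    show ?thesis
      using odd[of "\<lambda>x. x $ b * x $ c", OF a b c] d by (simp only: vector_minus_component if_False)
  qed
qed

text \<open>Martingale property of one step. In coordinates, the products of \<open>Z\<close> with
  the components of \<open>g\<close> are known at time \<open>s\<close> and integrable because
  \<open>g\<close> is bounded, and the increment has mean 0.\<close>

lemma inner_inc_mean:
  assumes st: "0 \<le> s" "s \<le> t"
    and Z: "Z \<in> borel_measurable (F s)" "integrable M Z"
    and g: "g \<in> borel_measurable (F s)" "\<And>\<omega>. \<omega> \<in> space M \<Longrightarrow> norm (g \<omega>) \<le> C"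
  shows "integrable M (\<lambda>\<omega>. Z \<omega> * (g \<omega> \<bullet> (W t \<omega> - W s \<omega>)))"
    and "expectation (\<lambda>\<omega>. Z \<omega> * (g \<omega> \<bullet> (W t \<omega> - W s \<omega>))) = 0"
proof -
  have [measurable]: "g \<in> borel_measurable (F s)" "Z \<in> borel_measurable (F s)" by fact+
  have gM [measurable]: "g \<in> borel_measurable M" using measurable_F_M[OF g(1) st(1)] .
  have eq: "Z \<omega> * (g \<omega> \<bullet> (W t \<omega> - W s \<omega>)) = (\<Sum>b\<in>UNIV. (Z \<omega> * g \<omega> $ b) * (W t \<omega> - W s \<omega>) $ b)" for \<omega>
    by (simp add: inner_vec_def sum_distrib_left mult.assoc)
  have Zg: "integrable M (\<lambda>\<omega>. Z \<omega> * g \<omega> $ b)" for b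
  proof (rule Bochner_Integration.integrable_bound[of _ "\<lambda>\<omega>. C * Z \<omega>"])
    show "AE \<omega> in M. norm (Z \<omega> * g \<omega> $ b) \<le> norm (C * Z \<omega>)"
    proof (rule AE_I2)
      fix \<omega> assume w: "\<omega> \<in> space M"
      have "\<bar>g \<omega> $ b\<bar> \<le> \<bar>C\<bar>" using component_le_norm_cart[of "g \<omega>" b] g(2)[OF w] by linarith
      then show "norm (Z \<omega> * g \<omega> $ b) \<le> norm (C * Z \<omega>)"
        by (metis abs_mult mult.commute mult_left_mono abs_ge_zero real_norm_def)
    qed
  qed (use Z in auto)
  have tm: "integrable M (\<lambda>\<omega>. (Z \<omega> * g \<omega> $ b) * (W t \<omega> - W s \<omega>) $ b)"
    "expectation (\<lambda>\<omega>. (Z \<omega> * g \<omega> $ b) * (W t \<omega> - W s \<omega>) $ b) = 0" for b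
    using indep_inc[OF st, of "\<lambda>\<omega>. Z \<omega> * g \<omega> $ b" "\<lambda>x. x $ b"] Zg inc_mixed(1,2)[OF st, of b] by auto
  show "integrable M (\<lambda>\<omega>. Z \<omega> * (g \<omega> \<bullet> (W t \<omega> - W s \<omega>)))"
    unfolding eq by (intro Bochner_Integration.integrable_sum tm)
  show "expectation (\<lambda>\<omega>. Z \<omega> * (g \<omega> \<bullet> (W t \<omega> - W s \<omega>))) = 0"
    unfolding eq using tm by (subst Bochner_Integration.integral_sum) auto
qed

text \<open>Ito isometry for one step: in the expansion into pairs of coordinates only the diagonal
  survives, as the covariance of the increment is \<open>t - s\<close> times the identity. The
  weight \<open>Z\<close> is carried for the fourth moment, where it is the square of the preceding
  partial sum.\<close>

lemma inner_inc_square: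
  assumes st: "0 \<le> s" "s \<le> t"
    and Z: "Z \<in> borel_measurable (F s)" "integrable M Z"
    and g: "g \<in> borel_measurable (F s)" "\<And>\<omega>. \<omega> \<in> space M \<Longrightarrow> norm (g \<omega>) \<le> C"
  shows "integrable M (\<lambda>\<omega>. Z \<omega> * (g \<omega> \<bullet> (W t \<omega> - W s \<omega>))\<^sup>2)"
    and "expectation (\<lambda>\<omega>. Z \<omega> * (g \<omega> \<bullet> (W t \<omega> - W s \<omega>))\<^sup>2) = (t - s) * expectation (\<lambda>\<omega>. Z \<omega> * (norm (g \<omega>))\<^sup>2)"
proof -
  have [measurable]: "g \<in> borel_measurable (F s)" "Z \<in> borel_measurable (F s)" by fact+
  have gM [measurable]: "g \<in> borel_measurable M" using measurable_F_M[OF g(1) st(1)] .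
  have eq: "Z \<omega> * (g \<omega> \<bullet> (W t \<omega> - W s \<omega>))\<^sup>2 =
      (\<Sum>b\<in>UNIV. \<Sum>c\<in>UNIV. (Z \<omega> * g \<omega> $ b * g \<omega> $ c) * ((W t \<omega> - W s \<omega>) $ b * (W t \<omega> - W s \<omega>) $ c))" for \<omega>
    by (simp add: inner_vec_def power2_eq_square sum_product sum_distrib_left mult_ac)
  have Zg: "integrable M (\<lambda>\<omega>. Z \<omega> * g \<omega> $ b * g \<omega> $ c)" for b c
  proof (rule Bochner_Integration.integrable_bound[of _ "\<lambda>\<omega>. (C * C) * Z \<omega>"])
    show "AE \<omega> in M. norm (Z \<omega> * g \<omega> $ b * g \<omega> $ c) \<le> norm ((C * C) * Z \<omega>)"
    proof (rule AE_I2)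
      fix \<omega> assume w: "\<omega> \<in> space M"
      have "\<bar>g \<omega> $ b\<bar> \<le> \<bar>C\<bar>" "\<bar>g \<omega> $ c\<bar> \<le> \<bar>C\<bar>"
        using component_le_norm_cart[of "g \<omega>" b] component_le_norm_cart[of "g \<omega>" c] g(2)[OF w] by linarith+
      then have "\<bar>Z \<omega>\<bar> * (\<bar>g \<omega> $ b\<bar> * \<bar>g \<omega> $ c\<bar>) \<le> \<bar>Z \<omega>\<bar> * (\<bar>C\<bar> * \<bar>C\<bar>)"
        by (intro mult_left_mono mult_mono) auto
      then show "norm (Z \<omega> * g \<omega> $ b * g \<omega> $ c) \<le> norm ((C * C) * Z \<omega>)"
        unfolding real_norm_def abs_mult by (simp only: mult_ac)
    qed
  qed (use Z in auto)
  have tm: "integrable M (\<lambda>\<omega>. (Z \<omega> * g \<omega> $ b * g \<omega> $ c) * ((W t \<omega> - W s \<omega>) $ b * (W t \<omega> - W s \<omega>) $ c))"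
    "expectation (\<lambda>\<omega>. (Z \<omega> * g \<omega> $ b * g \<omega> $ c) * ((W t \<omega> - W s \<omega>) $ b * (W t \<omega> - W s \<omega>) $ c)) =
      (if b = c then (t - s) * expectation (\<lambda>\<omega>. Z \<omega> * g \<omega> $ b * g \<omega> $ b) else 0)" for b c
    using indep_inc[OF st, of "\<lambda>\<omega>. Z \<omega> * g \<omega> $ b * g \<omega> $ c" "\<lambda>x. x $ b * x $ c"] Zg inc_mixed(3,4)[OF st, of b c] by auto
  show "integrable M (\<lambda>\<omega>. Z \<omega> * (g \<omega> \<bullet> (W t \<omega> - W s \<omega>))\<^sup>2)"
    unfolding eq by (intro Bochner_Integration.integrable_sum tm)
  have "expectation (\<lambda>\<omega>. Z \<omega> * (g \<omega> \<bullet> (W t \<omega> - W s \<omega>))\<^sup>2) =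
     (\<Sum>b\<in>UNIV. \<Sum>c\<in>UNIV. if b = c then (t - s) * expectation (\<lambda>\<omega>. Z \<omega> * g \<omega> $ b * g \<omega> $ b) else 0)"
    unfolding eq
    by (subst Bochner_Integration.integral_sum, intro Bochner_Integration.integrable_sum tm,
        rule sum.cong[OF refl], subst Bochner_Integration.integral_sum, intro tm) (simp only: tm)
  also have "\<dots> = (\<Sum>b\<in>UNIV. (t - s) * expectation (\<lambda>\<omega>. Z \<omega> * g \<omega> $ b * g \<omega> $ b))"
    by simp
  also have "\<dots> = (t - s) * expectation (\<lambda>\<omega>. \<Sum>b\<in>UNIV. Z \<omega> * g \<omega> $ b * g \<omega> $ b)"
    by (subst Bochner_Integration.integral_sum) (auto simp: Zg sum_distrib_left)
  also have "(\<lambda>\<omega>. \<Sum>b\<in>UNIV. Z \<omega> * g \<omega> $ b * g \<omega> $ b) = (\<lambda>\<omega>. Z \<omega> * (norm (g \<omega>))\<^sup>2)"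
    by (simp add: power2_norm_eq_inner inner_vec_def sum_distrib_left mult.assoc)
  finally show "expectation (\<lambda>\<omega>. Z \<omega> * (g \<omega> \<bullet> (W t \<omega> - W s \<omega>))\<^sup>2) = (t - s) * expectation (\<lambda>\<omega>. Z \<omega> * (norm (g \<omega>))\<^sup>2)" .
qed

text \<open>A pointwise Cauchy-Schwarz bound is enough here, because only the order of the fourth
  moment in \<open>t - s\<close> is used.\<close>

lemma inner_inc_4:
  assumes st: "0 \<le> s" "s \<le> t"
    and g: "g \<in> borel_measurable (F s)" "\<And>\<omega>. \<omega> \<in> space M \<Longrightarrow> norm (g \<omega>) \<le> C"
  shows "integrable M (\<lambda>\<omega>. (g \<omega> \<bullet> (W t \<omega> - W s \<omega>)) ^ 4)"
    and "expectation (\<lambda>\<omega>. (g \<omega> \<bullet> (W t \<omega> - W s \<omega>)) ^ 4) \<le> C ^ 4 * (3 * (real CARD('m))\<^sup>2 * (t - s)\<^sup>2)"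
proof -
  have [measurable]: "W t \<in> borel_measurable M" "W s \<in> borel_measurable M"
    using W_measurable_M st by auto
  have gM [measurable]: "g \<in> borel_measurable M" using measurable_F_M[OF g(1) st(1)] .
  let ?b = "\<lambda>\<omega>. C ^ 4 * norm (W t \<omega> - W s \<omega>) ^ 4"
  have le: "(g \<omega> \<bullet> (W t \<omega> - W s \<omega>)) ^ 4 \<le> ?b \<omega>" if w: "\<omega> \<in> space M" for \<omega>
  proof -
    have "\<bar>g \<omega> \<bullet> (W t \<omega> - W s \<omega>)\<bar> \<le> norm (g \<omega>) * norm (W t \<omega> - W s \<omega>)"
      by (rule Cauchy_Schwarz_ineq2)
    also have "\<dots> \<le> C * norm (W t \<omega> - W s \<omega>)" using g(2)[OF w] by (intro mult_right_mono) auto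
    finally have "\<bar>g \<omega> \<bullet> (W t \<omega> - W s \<omega>)\<bar> ^ 4 \<le> (C * norm (W t \<omega> - W s \<omega>)) ^ 4"
      by (intro power_mono) auto
    then show ?thesis by (simp add: power_mult_distrib)
  qed
  have int: "integrable M ?b" using inc_norm4(1)[OF st] by (rule integrable_mult_right)
  show i: "integrable M (\<lambda>\<omega>. (g \<omega> \<bullet> (W t \<omega> - W s \<omega>)) ^ 4)"
    by (rule Bochner_Integration.integrable_bound[OF int]) (use le in auto)
  have "expectation (\<lambda>\<omega>. (g \<omega> \<bullet> (W t \<omega> - W s \<omega>)) ^ 4) \<le> expectation ?b"
    by (rule integral_mono[OF i int le])
  also have "\<dots> \<le> C ^ 4 * (3 * (real CARD('m))\<^sup>2 * (t - s)\<^sup>2)"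
    using inc_norm4(2)[OF st] by (auto intro: mult_left_mono)
  finally show "expectation (\<lambda>\<omega>. (g \<omega> \<bullet> (W t \<omega> - W s \<omega>)) ^ 4) \<le> C ^ 4 * (3 * (real CARD('m))\<^sup>2 * (t - s)\<^sup>2)" .
qed

end

section \<open>Discrete stochastic integrals\<close>

text \<open>In the binomial expansion the term 4 x y^3 is absorbed by 4 x y^3 \<le> 2 x^2 y^2 + 2
  y^4, since its expectation is not controlled by the identities at hand. The term with x^3 y is
  kept: for a martingale increment y it has mean 0.\<close>

lemma power4_add_le:
  fixes x y :: real
  shows "(x + y) ^ 4 \<le> x ^ 4 + 4 * (x ^ 3 * y) + 8 * (x\<^sup>2 * y\<^sup>2) + 3 * y ^ 4"
proof -
  have "0 \<le> 2 * (x * y - y\<^sup>2)\<^sup>2" by simp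
  then show ?thesis
    by (simp add: power2_eq_square power3_eq_cube power4_eq_xxxx algebra_simps)
qed

context brownian
begin

definition stoch_sum :: "nat \<Rightarrow> (nat \<Rightarrow> real) \<Rightarrow> (nat \<Rightarrow> real) \<Rightarrow> (nat \<Rightarrow> 'a \<Rightarrow> real^'m) \<Rightarrow> 'a \<Rightarrow> real" where
  "stoch_sum n u v g \<omega> = (\<Sum>j<n. g j \<omega> \<bullet> (W (v j) \<omega> - W (u j) \<omega>))"

text \<open>Scalar step integrands on ordered intervals inside \<open>{s..t}\<close>, each
  coefficient known at the left end of its interval. Left and right ends are separate sequences, so
  gaps and degenerate intervals are allowed.\<close>

definition admissible :: "real \<Rightarrow> real \<Rightarrow> nat \<Rightarrow> (nat \<Rightarrow> real) \<Rightarrow> (nat \<Rightarrow> real) \<Rightarrow> (nat \<Rightarrow> 'a \<Rightarrow> real^'m) \<Rightarrow> real \<Rightarrow> bool" where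
  "admissible s t n u v g C \<longleftrightarrow> 0 \<le> s \<and> s \<le> t \<and>
     (\<forall>j<n. s \<le> u j \<and> u j \<le> v j \<and> v j \<le> t \<and> g j \<in> borel_measurable (F (u j)) \<and> (\<forall>\<omega>\<in>space M. norm (g j \<omega>) \<le> C)) \<and>
     (\<forall>i j. i < j \<and> j < n \<longrightarrow> v i \<le> u j)"

lemma admissible_Suc: "admissible s t (Suc n) u v g C \<Longrightarrow> admissible s t n u v g C"
  unfolding admissible_def by auto

lemma admissible_length:
  assumes "admissible s t n u v g C"
  shows "(\<Sum>j<n. v j - u j) \<le> t - s"
proof -
  \<comment> \<open>The induction has to carry the last right endpoint, because this is what can be
    compared with the next left endpoint.\<close>
  have "(\<Sum>j<k. v j - u j) \<le> (if k = 0 then 0 else v (k - 1) - s)" if "k \<le> n" for k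
    using that
  proof (induction k)
    case (Suc k)
    show ?case
    proof (cases "k = 0")
      case True
      then show ?thesis using assms Suc.prems by (auto simp: admissible_def)
    next
      case False
      then have "v (k - 1) \<le> u k" using assms Suc.prems by (auto simp: admissible_def)
      then show ?thesis using Suc False by simp
    qed
  qed simp
  from this[of n] show ?thesis
    using assms by (cases "n = 0") (auto simp: admissible_def intro: order_trans)
qed

lemma stoch_sum_measurable:
  assumes "admissible s t n u v g C" "\<And>j. j < n \<Longrightarrow> v j \<le> r"
  shows "stoch_sum n u v g \<in> borel_measurable (F r)"
  unfolding stoch_sum_def
proof (intro borel_measurable_sum borel_measurable_inner borel_measurable_diff)
  fix j assume "j \<in> {..<n}"
  then have j: "0 \<le> u j" "u j \<le> v j" "g j \<in> borel_measurable (F (u j))" "v j \<le> r"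
    using assms by (force simp: admissible_def)+
  show "g j \<in> borel_measurable (F r)" "W (v j) \<in> borel_measurable (F r)" "W (u j) \<in> borel_measurable (F r)"
    using j by (auto intro: measurable_F_mono[OF j(3)] measurable_F_mono[OF W_measurable])
qed

lemma stoch_sum_Suc: "stoch_sum (Suc n) u v g \<omega> = stoch_sum n u v g \<omega> + g n \<omega> \<bullet> (W (v n) \<omega> - W (u n) \<omega>)"
  by (simp add: stoch_sum_def)

lemma stoch_sum_mean:
  assumes adm: "admissible s t n u v g C"
    and Z: "Z \<in> borel_measurable (F s)" "integrable M Z"
  shows "integrable M (\<lambda>\<omega>. Z \<omega> * stoch_sum n u v g \<omega>)"
    and "expectation (\<lambda>\<omega>. Z \<omega> * stoch_sum n u v g \<omega>) = 0"
proof -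
  have tm: "integrable M (\<lambda>\<omega>. Z \<omega> * (g j \<omega> \<bullet> (W (v j) \<omega> - W (u j) \<omega>)))"
    "expectation (\<lambda>\<omega>. Z \<omega> * (g j \<omega> \<bullet> (W (v j) \<omega> - W (u j) \<omega>))) = 0" if "j < n" for j
  proof -
    have j: "0 \<le> u j" "u j \<le> v j" "g j \<in> borel_measurable (F (u j))" "s \<le> u j" "\<And>\<omega>. \<omega> \<in> space M \<Longrightarrow> norm (g j \<omega>) \<le> C"
      using adm that by (auto simp: admissible_def)
    have Zu: "Z \<in> borel_measurable (F (u j))" using Z(1) j(4) by (rule measurable_F_mono)
    show "integrable M (\<lambda>\<omega>. Z \<omega> * (g j \<omega> \<bullet> (W (v j) \<omega> - W (u j) \<omega>)))"
      "expectation (\<lambda>\<omega>. Z \<omega> * (g j \<omega> \<bullet> (W (v j) \<omega> - W (u j) \<omega>))) = 0"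
      using inner_inc_mean[OF j(1,2) Zu Z(2) j(3) j(5)] by auto
  qed
  have eq: "(\<lambda>\<omega>. Z \<omega> * stoch_sum n u v g \<omega>) = (\<lambda>\<omega>. \<Sum>j<n. Z \<omega> * (g j \<omega> \<bullet> (W (v j) \<omega> - W (u j) \<omega>)))"
    by (simp add: stoch_sum_def sum_distrib_left)
  show "integrable M (\<lambda>\<omega>. Z \<omega> * stoch_sum n u v g \<omega>)"
    unfolding eq by (rule Bochner_Integration.integrable_sum) (use tm in auto)
  show "expectation (\<lambda>\<omega>. Z \<omega> * stoch_sum n u v g \<omega>) = 0"
    unfolding eq using tm by (subst Bochner_Integration.integral_sum) auto
qed

text \<open>Ito isometry. At each new interval the preceding partial sum is known at its left end,
  so the cross term has mean 0.\<close>

lemma stoch_sum_square: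
  assumes "admissible s t n u v g C"
  shows "integrable M (\<lambda>\<omega>. (stoch_sum n u v g \<omega>)\<^sup>2)"
    and "expectation (\<lambda>\<omega>. (stoch_sum n u v g \<omega>)\<^sup>2) = (\<Sum>j<n. (v j - u j) * expectation (\<lambda>\<omega>. (norm (g j \<omega>))\<^sup>2))"
proof -
  have "integrable M (\<lambda>\<omega>. (stoch_sum n u v g \<omega>)\<^sup>2) \<and>
    expectation (\<lambda>\<omega>. (stoch_sum n u v g \<omega>)\<^sup>2) = (\<Sum>j<n. (v j - u j) * expectation (\<lambda>\<omega>. (norm (g j \<omega>))\<^sup>2))"
    using assms
  proof (induction n)
    case 0
    then show ?case by (simp add: stoch_sum_def)
  next
    case (Suc n)
    let ?S = "stoch_sum n u v g" and ?N = "\<lambda>\<omega>. g n \<omega> \<bullet> (W (v n) \<omega> - W (u n) \<omega>)"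
    have IH: "integrable M (\<lambda>\<omega>. (?S \<omega>)\<^sup>2)"
      "expectation (\<lambda>\<omega>. (?S \<omega>)\<^sup>2) = (\<Sum>j<n. (v j - u j) * expectation (\<lambda>\<omega>. (norm (g j \<omega>))\<^sup>2))"
      using Suc.IH[OF admissible_Suc[OF Suc.prems]] by auto
    have j: "0 \<le> u n" "u n \<le> v n" "g n \<in> borel_measurable (F (u n))" "\<And>\<omega>. \<omega> \<in> space M \<Longrightarrow> norm (g n \<omega>) \<le> C"
      using Suc.prems by (auto simp: admissible_def)
    have Sm: "?S \<in> borel_measurable (F (u n))"
      by (rule stoch_sum_measurable[OF admissible_Suc[OF Suc.prems]]) (use Suc.prems in \<open>auto simp: admissible_def\<close>)
    have SM [measurable]: "?S \<in> borel_measurable M" using Sm j(1) by (rule measurable_F_M)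
    have Si: "integrable M ?S" by (rule square_integrable_imp_integrable) (use IH in auto)
    note A = inner_inc_mean[OF j(1,2) Sm Si j(3,4)]
    have B: "integrable M (\<lambda>\<omega>. (?N \<omega>)\<^sup>2)" "expectation (\<lambda>\<omega>. (?N \<omega>)\<^sup>2) = (v n - u n) * expectation (\<lambda>\<omega>. (norm (g n \<omega>))\<^sup>2)"
    proof -
      have one: "(\<lambda>_. 1::real) \<in> borel_measurable (F (u n))" "integrable M (\<lambda>_. 1::real)" by auto
      show "integrable M (\<lambda>\<omega>. (?N \<omega>)\<^sup>2)" "expectation (\<lambda>\<omega>. (?N \<omega>)\<^sup>2) = (v n - u n) * expectation (\<lambda>\<omega>. (norm (g n \<omega>))\<^sup>2)"
        using inner_inc_square[OF j(1,2) one j(3,4)] by (simp_all only: mult_1)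
    qed
    have eq: "(\<lambda>\<omega>. (stoch_sum (Suc n) u v g \<omega>)\<^sup>2) = (\<lambda>\<omega>. (?S \<omega>)\<^sup>2 + (2 * (?S \<omega> * ?N \<omega>) + (?N \<omega>)\<^sup>2))"
      unfolding stoch_sum_Suc power2_sum by (intro ext) (simp only: mult_ac add_ac)
    show ?case
      unfolding eq using IH A B by simp
  qed
  then show "integrable M (\<lambda>\<omega>. (stoch_sum n u v g \<omega>)\<^sup>2)"
    and "expectation (\<lambda>\<omega>. (stoch_sum n u v g \<omega>)\<^sup>2) = (\<Sum>j<n. (v j - u j) * expectation (\<lambda>\<omega>. (norm (g j \<omega>))\<^sup>2))" by auto
qed

lemma stoch_sum_square_le:
  assumes "admissible s t n u v g C"
  shows "expectation (\<lambda>\<omega>. (stoch_sum n u v g \<omega>)\<^sup>2) \<le> C\<^sup>2 * (\<Sum>j<n. v j - u j)"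
  unfolding stoch_sum_square(2)[OF assms] sum_distrib_left
proof (rule sum_mono)
  fix j assume j: "j \<in> {..<n}"
  have m: "g j \<in> borel_measurable M"
    by (rule measurable_F_M[of _ "u j"]) (use assms j in \<open>auto simp: admissible_def\<close>)
  have le: "(norm (g j \<omega>))\<^sup>2 \<le> C\<^sup>2" if "\<omega> \<in> space M" for \<omega>
    using assms j that by (intro power_mono) (auto simp: admissible_def)
  have "expectation (\<lambda>\<omega>. (norm (g j \<omega>))\<^sup>2) \<le> expectation (\<lambda>\<omega>. C\<^sup>2)"
  proof (rule integral_mono)
    show "integrable M (\<lambda>\<omega>. (norm (g j \<omega>))\<^sup>2)"
      by (rule integrable_const_bound[of _ "C\<^sup>2"]) (use m le in auto)
  qed (use le in auto)
  then have "expectation (\<lambda>\<omega>. (norm (g j \<omega>))\<^sup>2) \<le> C\<^sup>2" by (simp add: prob_space)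
  then show "(v j - u j) * expectation (\<lambda>\<omega>. (norm (g j \<omega>))\<^sup>2) \<le> C\<^sup>2 * (v j - u j)"
    using assms j by (subst mult.commute) (auto simp: admissible_def intro!: mult_right_mono)
qed

text \<open>A moment inequality of Burkholder type for exponent 4, by induction over the intervals
  with \<open>power4_add_le\<close>. Write \<tau> for the length so far, d for the new length and m
  for the dimension. The step adds at most 8 C^4 d \<tau> + 9 m^2 C^4 d^2. The constant 9 m^2
  matches the last term exactly, and its cross term 18 m^2 d \<tau> covers the other one.\<close>

lemma stoch_sum_power4:
  assumes "admissible s t n u v g C"
  shows "integrable M (\<lambda>\<omega>. (stoch_sum n u v g \<omega>) ^ 4)"
    and "expectation (\<lambda>\<omega>. (stoch_sum n u v g \<omega>) ^ 4) \<le> 9 * (real CARD('m))\<^sup>2 * C ^ 4 * (t - s)\<^sup>2"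
proof -
  let ?K = "9 * (real CARD('m))\<^sup>2"
  have card1: "1 \<le> (real CARD('m))\<^sup>2"
  proof -
    have "1 \<le> CARD('m)" using zero_less_card_finite[where 'a='m] by linarith
    then show ?thesis by (simp add: one_le_power)
  qed
  \<comment> \<open>The induction runs with the accumulated length of the intervals; with the fixed
    length \<open>t - s\<close> there would be no room for the growth.\<close>
  have main: "integrable M (\<lambda>\<omega>. (stoch_sum n u v g \<omega>) ^ 4) \<and>
    expectation (\<lambda>\<omega>. (stoch_sum n u v g \<omega>) ^ 4) \<le> ?K * C ^ 4 * (\<Sum>j<n. v j - u j)\<^sup>2"
    using assms
  proof (induction n)
    case 0
    then show ?case by (simp add: stoch_sum_def)
  next
    case (Suc n)
    let ?S = "stoch_sum n u v g" and ?N = "\<lambda>\<omega>. g n \<omega> \<bullet> (W (v n) \<omega> - W (u n) \<omega>)"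
    let ?\<tau> = "\<Sum>j<n. v j - u j" and ?d = "v n - u n"
    note adm = admissible_Suc[OF Suc.prems]
    have IH: "integrable M (\<lambda>\<omega>. (?S \<omega>) ^ 4)" "expectation (\<lambda>\<omega>. (?S \<omega>) ^ 4) \<le> ?K * C ^ 4 * ?\<tau>\<^sup>2"
      using Suc.IH[OF adm] by auto
    have tau: "0 \<le> ?\<tau>" using adm by (intro sum_nonneg) (auto simp: admissible_def)
    have j: "0 \<le> u n" "u n \<le> v n" "g n \<in> borel_measurable (F (u n))" "\<And>\<omega>. \<omega> \<in> space M \<Longrightarrow> norm (g n \<omega>) \<le> C"
      using Suc.prems by (auto simp: admissible_def)
    have Sm [measurable]: "?S \<in> borel_measurable (F (u n))"
      by (rule stoch_sum_measurable[OF adm]) (use Suc.prems in \<open>auto simp: admissible_def\<close>)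
    have SM [measurable]: "?S \<in> borel_measurable M" using Sm j(1) by (rule measurable_F_M)
    have [measurable]: "g n \<in> borel_measurable M" using j(3,1) by (rule measurable_F_M)
    \<comment> \<open>The mean of the term with x^3 y is only available if the cube of the partial
      sum is integrable; the fourth power from the induction hypothesis dominates it.\<close>
    have S3: "integrable M (\<lambda>\<omega>. (?S \<omega>) ^ 3)"
    proof (rule Bochner_Integration.integrable_bound[of _ "\<lambda>\<omega>. 1 + (?S \<omega>) ^ 4"])
      have "\<bar>x ^ 3\<bar> \<le> 1 + x ^ 4" for x :: real
      proof (cases "\<bar>x\<bar> \<le> 1")
        case True
        then have "\<bar>x ^ 3\<bar> \<le> 1" by (simp add: power_abs power_le_one)
        moreover have "0 \<le> x ^ 4" by simp
        ultimately show ?thesis by linarith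
      next
        case False
        then have "\<bar>x\<bar> ^ 3 \<le> \<bar>x\<bar> ^ 4" by (intro power_increasing) auto
        then show ?thesis by (simp add: power_abs power_even_abs)
      qed
      then show "AE \<omega> in M. norm (?S \<omega> ^ 3) \<le> norm (1 + (?S \<omega>) ^ 4)" by (simp add: abs_of_nonneg)
    qed (use IH in auto)
    have S2: "integrable M (\<lambda>\<omega>. (?S \<omega>)\<^sup>2)" using stoch_sum_square(1)[OF adm] .
    have m3: "(\<lambda>\<omega>. (?S \<omega>) ^ 3) \<in> borel_measurable (F (u n))" and m2: "(\<lambda>\<omega>. (?S \<omega>)\<^sup>2) \<in> borel_measurable (F (u n))"
      by measurable
    note A = inner_inc_mean[OF j(1,2) m3 S3 j(3,4)]
    note B = inner_inc_square[OF j(1,2) m2 S2 j(3,4)]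
    note D = inner_inc_4[OF j(1,2) j(3,4)]
    have "expectation (\<lambda>\<omega>. (?S \<omega>)\<^sup>2 * (norm (g n \<omega>))\<^sup>2) \<le> expectation (\<lambda>\<omega>. C\<^sup>2 * (?S \<omega>)\<^sup>2)"
    proof (rule integral_mono)
      have le: "(?S \<omega>)\<^sup>2 * (norm (g n \<omega>))\<^sup>2 \<le> C\<^sup>2 * (?S \<omega>)\<^sup>2" if "\<omega> \<in> space M" for \<omega>
        using j(4)[OF that] by (subst mult.commute) (intro mult_right_mono power_mono, auto)
      then show "(?S \<omega>)\<^sup>2 * (norm (g n \<omega>))\<^sup>2 \<le> C\<^sup>2 * (?S \<omega>)\<^sup>2" if "\<omega> \<in> space M" for \<omega> using that .
      show "integrable M (\<lambda>\<omega>. (?S \<omega>)\<^sup>2 * (norm (g n \<omega>))\<^sup>2)"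
        by (rule Bochner_Integration.integrable_bound[of _ "\<lambda>\<omega>. C\<^sup>2 * (?S \<omega>)\<^sup>2"]) (use S2 le in auto)
    qed (use S2 in auto)
    also have "\<dots> \<le> C\<^sup>2 * (C\<^sup>2 * ?\<tau>)"
      using mult_left_mono[OF stoch_sum_square_le[OF adm], of "C\<^sup>2"] by simp
    finally have E1: "expectation (\<lambda>\<omega>. (?S \<omega>)\<^sup>2 * (norm (g n \<omega>))\<^sup>2) \<le> C ^ 4 * ?\<tau>"
      by (simp add: power2_eq_square power4_eq_xxxx mult_ac)
    have "expectation (\<lambda>\<omega>. (?S \<omega>)\<^sup>2 * (?N \<omega>)\<^sup>2) = ?d * expectation (\<lambda>\<omega>. (?S \<omega>)\<^sup>2 * (norm (g n \<omega>))\<^sup>2)"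
      by (rule B(2))
    also have "\<dots> \<le> ?d * (C ^ 4 * ?\<tau>)"
      using E1 j(2) by (intro mult_left_mono) auto
    finally have E2: "expectation (\<lambda>\<omega>. (?S \<omega>)\<^sup>2 * (?N \<omega>)\<^sup>2) \<le> ?d * (C ^ 4 * ?\<tau>)" .
    let ?b = "\<lambda>\<omega>. (?S \<omega>) ^ 4 + 4 * ((?S \<omega>) ^ 3 * ?N \<omega>) + 8 * ((?S \<omega>)\<^sup>2 * (?N \<omega>)\<^sup>2) + 3 * (?N \<omega>) ^ 4"
    have bi: "integrable M ?b" using IH A B D by (intro Bochner_Integration.integrable_add integrable_mult_right)
    have le: "(stoch_sum (Suc n) u v g \<omega>) ^ 4 \<le> ?b \<omega>" for \<omega>
      using power4_add_le[of "?S \<omega>" "?N \<omega>"] by (simp only: stoch_sum_Suc)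
    have [measurable]: "stoch_sum (Suc n) u v g \<in> borel_measurable M"
      by (rule measurable_F_M[OF stoch_sum_measurable[OF Suc.prems, of t]]) (use Suc.prems in \<open>auto simp: admissible_def\<close>)
    have int: "integrable M (\<lambda>\<omega>. (stoch_sum (Suc n) u v g \<omega>) ^ 4)"
      by (rule Bochner_Integration.integrable_bound[OF bi]) (auto intro: order_trans[OF le abs_ge_self])
    have "expectation (\<lambda>\<omega>. (stoch_sum (Suc n) u v g \<omega>) ^ 4) \<le> expectation ?b"
      by (rule integral_mono[OF int bi le])
    also have "\<dots> = expectation (\<lambda>\<omega>. (?S \<omega>) ^ 4) + 8 * expectation (\<lambda>\<omega>. (?S \<omega>)\<^sup>2 * (?N \<omega>)\<^sup>2) + 3 * expectation (\<lambda>\<omega>. (?N \<omega>) ^ 4)"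
      using IH A B(1) D by simp
    also have "\<dots> \<le> ?K * C ^ 4 * ?\<tau>\<^sup>2 + 8 * (?d * (C ^ 4 * ?\<tau>)) + 3 * (C ^ 4 * (3 * (real CARD('m))\<^sup>2 * ?d\<^sup>2))"
      using IH(2) E2 D(2) by linarith
    also have "\<dots> \<le> ?K * C ^ 4 * (?\<tau> + ?d)\<^sup>2"
    proof -
      have "0 \<le> (2 * ?K - 8) * (C ^ 4 * (?\<tau> * ?d))"
      proof (intro mult_nonneg_nonneg)
        show "0 \<le> 2 * ?K - 8" using card1 by linarith
      qed (use tau j(2) in auto)
      moreover have "9 * k * c * x\<^sup>2 + 8 * (d * (c * x)) + 3 * (c * (3 * k * d\<^sup>2)) \<le> 9 * k * c * (x + d)\<^sup>2"
        if "0 \<le> (2 * (9 * k) - 8) * (c * (x * d))" for k c x d :: real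
        using that by (simp add: power2_eq_square algebra_simps)
      ultimately show ?thesis by blast
    qed
    finally show ?case using int by simp
  qed
  then show "integrable M (\<lambda>\<omega>. (stoch_sum n u v g \<omega>) ^ 4)" by blast
  have "(\<Sum>j<n. v j - u j)\<^sup>2 \<le> (t - s)\<^sup>2"
    using admissible_length[OF assms] assms
    by (intro power_mono sum_nonneg) (auto simp: admissible_def)
  then have "?K * C ^ 4 * (\<Sum>j<n. v j - u j)\<^sup>2 \<le> ?K * C ^ 4 * (t - s)\<^sup>2"
    by (intro mult_left_mono) auto
  then show "expectation (\<lambda>\<omega>. (stoch_sum n u v g \<omega>) ^ 4) \<le> ?K * C ^ 4 * (t - s)\<^sup>2"
    using main by linarith
qed

end

section \<open>Vector-valued step integrals over a time window\<close>

lemma borel_measurable_transpose_mult: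
  fixes A :: "'a \<Rightarrow> real^'m^'d"
  assumes "A \<in> borel_measurable N" "p \<in> borel_measurable N"
  shows "(\<lambda>\<omega>. transpose (A \<omega>) *v p \<omega>) \<in> borel_measurable N"
  by (rule borel_measurable_continuous_Pair[OF assms])
     (auto simp: matrix_vector_mult_def transpose_def intro!: continuous_intros continuous_on_vec_lambda)

lemma borel_measurable_matrix_mult:
  fixes A :: "'a \<Rightarrow> real^'m^'d"
  assumes "A \<in> borel_measurable N" "p \<in> borel_measurable N"
  shows "(\<lambda>\<omega>. A \<omega> *v p \<omega>) \<in> borel_measurable N"
  by (rule borel_measurable_continuous_Pair[OF assms])
     (auto simp: matrix_vector_mult_def intro!: continuous_intros continuous_on_vec_lambda)

text \<open>Projection of a time onto the window \<open>{s..t}\<close>. Intervals of a partition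
  that lie outside the window collapse to a point, so one index set and one family of coefficients
  serve every window.\<close>

definition clamp_time :: "real \<Rightarrow> real \<Rightarrow> real \<Rightarrow> real" where
  "clamp_time s t u = max s (min u t)"

context brownian
begin

definition step_int :: "real \<Rightarrow> real \<Rightarrow> nat \<Rightarrow> (nat \<Rightarrow> real) \<Rightarrow> (nat \<Rightarrow> 'a \<Rightarrow> real^'m^'d) \<Rightarrow> 'a \<Rightarrow> real^'d" where
  "step_int s t n r \<eta> \<omega> = (\<Sum>j<n. \<eta> j \<omega> *v (W (clamp_time s t (r (Suc j))) \<omega> - W (clamp_time s t (r j)) \<omega>))"

text \<open>The same objects as in \<open>simple_integrand\<close>, but with one explicit bound for
  all coefficients, because this bound enters the moment estimates.\<close>

definition step_fun :: "nat \<Rightarrow> (nat \<Rightarrow> real) \<Rightarrow> (nat \<Rightarrow> 'a \<Rightarrow> real^'m^'d) \<Rightarrow> real \<Rightarrow> bool" where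
  "step_fun n r \<eta> B \<longleftrightarrow> 0 \<le> r 0 \<and> (\<forall>j<n. r j \<le> r (Suc j)) \<and>
     (\<forall>j<n. \<eta> j \<in> borel_measurable (F (r j)) \<and> (\<forall>\<omega>\<in>space M. norm (\<eta> j \<omega>) \<le> B))"

lemma step_fun_mono:
  assumes "step_fun n r \<eta> B" "i \<le> j" "j \<le> n"
  shows "r i \<le> r j"
  using assms(2,3)
proof (induction j rule: dec_induct)
  case (step k)
  then have "r i \<le> r k" "r k \<le> r (Suc k)" using assms(1) by (auto simp: step_fun_def)
  then show ?case by simp
qed simp

lemma step_int_diff:
  "step_int s t n r \<xi> \<omega> - step_int s t n r \<eta> \<omega> = step_int s t n r (\<lambda>j \<omega>. \<xi> j \<omega> - \<eta> j \<omega>) \<omega>"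
  by (simp add: step_int_def sum_subtractf[symmetric] matrix_vector_mult_diff_rdistrib)

lemma simple_integral_increment:
  assumes "0 \<le> s" "s \<le> t"
  shows "simple_integral W n r \<xi> t \<omega> - simple_integral W n r \<xi> s \<omega> = step_int s t n r \<xi> \<omega>"
proof -
  \<comment> \<open>The term with \<open>W s\<close> is the same for both ends of an interval and
    drops out of the difference.\<close>
  have cl: "W (min u t) \<omega> - W (min u s) \<omega> = W (clamp_time s t u) \<omega> - W s \<omega>" for u
    using assms by (auto simp: clamp_time_def min_def max_def)
  have "W (min (r (Suc j)) t) \<omega> - W (min (r j) t) \<omega> - (W (min (r (Suc j)) s) \<omega> - W (min (r j) s) \<omega>)
     = W (clamp_time s t (r (Suc j))) \<omega> - W (clamp_time s t (r j)) \<omega>" for j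
  proof -
    have *: "a - b - (c - d) = (a - c) - (b - d)" for a b c d :: "real^'m" by simp
    show ?thesis
      by (subst *) (simp only: cl, simp)
  qed
  then show ?thesis
    by (simp only: simple_integral_def step_int_def sum_subtractf[symmetric] matrix_vector_mult_diff_distrib[symmetric])
qed

lemma step_int_measurable:
  assumes sf: "step_fun n r \<eta> B" and st: "0 \<le> s" "s \<le> t"
  shows "step_int s t n r \<eta> \<in> borel_measurable (F t)"
  unfolding step_int_def
proof (intro borel_measurable_sum)
  fix j assume j: "j \<in> {..<n}"
  let ?c = "clamp_time s t"
  have m: "W (?c u) \<in> borel_measurable (F t)" for u
    by (rule measurable_F_mono[OF W_measurable]) (use st in \<open>auto simp: clamp_time_def\<close>)
  show "(\<lambda>\<omega>. \<eta> j \<omega> *v (W (?c (r (Suc j))) \<omega> - W (?c (r j)) \<omega>)) \<in> borel_measurable (F t)"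
  proof (cases "r j \<le> t")
    case True
    have "\<eta> j \<in> borel_measurable (F t)"
      by (rule measurable_F_mono[OF _ True]) (use sf j in \<open>auto simp: step_fun_def\<close>)
    then show ?thesis by (intro borel_measurable_matrix_mult borel_measurable_diff m)
  next
    case False
    then have "?c (r (Suc j)) = ?c (r j)" using sf j by (force simp: step_fun_def clamp_time_def)
    then show ?thesis by simp
  qed
qed

text \<open>Testing the vector integral with a vector \<open>p\<close> known at time
  \<open>s\<close> gives a scalar integral with coefficients transpose(\<eta>) p. For
  \<open>r j > t\<close> the clamped left end is \<open>t\<close>, where \<eta>_j need not be known
  yet; the coefficient is set to 0 there, which changes nothing because the clamped interval is
  degenerate.\<close>

lemma step_fun_admissible:
  fixes p :: "'a \<Rightarrow> real^'d"
  assumes sf: "step_fun n r \<eta> B" and st: "0 \<le> s" "s \<le> t"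
    and p: "p \<in> borel_measurable (F s)" "\<And>\<omega>. \<omega> \<in> space M \<Longrightarrow> norm (p \<omega>) \<le> P" and B: "0 \<le> B"
  defines "g \<equiv> \<lambda>j \<omega>. if r j \<le> t then transpose (\<eta> j \<omega>) *v p \<omega> else 0"
  shows "admissible s t n (\<lambda>j. clamp_time s t (r j)) (\<lambda>j. clamp_time s t (r (Suc j))) g (B * P)"
    and "p \<omega> \<bullet> step_int s t n r \<eta> \<omega> = stoch_sum n (\<lambda>j. clamp_time s t (r j)) (\<lambda>j. clamp_time s t (r (Suc j))) g \<omega>"
proof -
  let ?c = "clamp_time s t"
  have mono: "?c x \<le> ?c y" if "x \<le> y" for x y using that by (auto simp: clamp_time_def)
  have rj: "r j \<le> r (Suc j)" "\<eta> j \<in> borel_measurable (F (r j))" "\<And>\<omega>. \<omega> \<in> space M \<Longrightarrow> norm (\<eta> j \<omega>) \<le> B" if "j < n" for j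
    using sf that by (auto simp: step_fun_def)
  have gm: "g j \<in> borel_measurable (F (?c (r j)))" if "j < n" for j
  proof (cases "r j \<le> t")
    case True
    then have "g j = (\<lambda>\<omega>. transpose (\<eta> j \<omega>) *v p \<omega>)" by (simp add: g_def fun_eq_iff)
    moreover have "\<eta> j \<in> borel_measurable (F (?c (r j)))" "p \<in> borel_measurable (F (?c (r j)))"
      using True by (auto simp: clamp_time_def intro: measurable_F_mono[OF rj(2)[OF that]] measurable_F_mono[OF p(1)])
    ultimately show ?thesis by (simp only: borel_measurable_transpose_mult)
  next
    case False
    then show ?thesis by (simp add: g_def)
  qed
  have gb: "norm (g j \<omega>) \<le> B * P" if "j < n" "\<omega> \<in> space M" for j \<omega>
  proof -
    have "norm (transpose (\<eta> j \<omega>) *v p \<omega>) \<le> norm (\<eta> j \<omega>) * norm (p \<omega>)"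
      by (rule norm_transpose_mult_le)
    also have "\<dots> \<le> B * P" using rj(3)[OF that] p(2)[OF that(2)] B by (intro mult_mono) auto
    finally have *: "norm (transpose (\<eta> j \<omega>) *v p \<omega>) \<le> B * P" .
    have "0 \<le> P" using p(2)[OF that(2)] norm_ge_zero order_trans by blast
    then show ?thesis using * B by (simp add: g_def)
  qed
  have ord: "?c (r (Suc i)) \<le> ?c (r j)" if "i < j" "j < n" for i j
    using step_fun_mono[OF sf, of "Suc i" j] that by (intro mono) auto
  show "admissible s t n (\<lambda>j. ?c (r j)) (\<lambda>j. ?c (r (Suc j))) g (B * P)"
    unfolding admissible_def using st gm gb ord rj(1) mono by (auto simp: clamp_time_def)
  show "p \<omega> \<bullet> step_int s t n r \<eta> \<omega> = stoch_sum n (\<lambda>j. ?c (r j)) (\<lambda>j. ?c (r (Suc j))) g \<omega>"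
    unfolding step_int_def stoch_sum_def inner_sum_right
  proof (rule sum.cong[OF refl])
    fix j assume j: "j \<in> {..<n}"
    show "p \<omega> \<bullet> (\<eta> j \<omega> *v (W (?c (r (Suc j))) \<omega> - W (?c (r j)) \<omega>)) = g j \<omega> \<bullet> (W (?c (r (Suc j))) \<omega> - W (?c (r j)) \<omega>)"
    proof (cases "r j \<le> t")
      case True
      then show ?thesis by (simp add: g_def inner_matrix_vector)
    next
      case False
      then have "?c (r (Suc j)) = ?c (r j)" using rj(1)[of j] j st by (auto simp: clamp_time_def)
      then show ?thesis by simp
    qed
  qed
qed

lemma step_int_component_mean:
  assumes sf: "step_fun n r \<eta> B" and st: "0 \<le> s" "s \<le> t" and B: "0 \<le> B"
    and Z: "Z \<in> borel_measurable (F s)" "integrable M Z"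
  shows "integrable M (\<lambda>\<omega>. Z \<omega> * step_int s t n r \<eta> \<omega> $ a)"
    and "expectation (\<lambda>\<omega>. Z \<omega> * step_int s t n r \<eta> \<omega> $ a) = 0"
proof -
  have p: "(\<lambda>_. axis a (1::real)) \<in> borel_measurable (F s)" "norm (axis a (1::real)) \<le> 1"
    by (auto simp: norm_axis_1)
  note A = step_fun_admissible[where p = "\<lambda>_. axis a 1", OF sf st p B]
  have eq: "step_int s t n r \<eta> \<omega> $ a = axis a 1 \<bullet> step_int s t n r \<eta> \<omega>" for \<omega>
    by (simp add: inner_axis')
  show "integrable M (\<lambda>\<omega>. Z \<omega> * step_int s t n r \<eta> \<omega> $ a)"
    and "expectation (\<lambda>\<omega>. Z \<omega> * step_int s t n r \<eta> \<omega> $ a) = 0"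
    unfolding eq A(2) using stoch_sum_mean[OF A(1) Z] by auto
qed

text \<open>Isometry in a random direction \<open>p\<close>, which later is the gradient of \<Phi>
  frozen at the start of a grid step. The quantity \<open>q\<close> is the quadratic variation of
  the tested integral over the window; it is kept explicit because it is bounded above here and from
  below in \<open>ito_step_approx\<close>.\<close>

lemma step_int_square:
  fixes p :: "'a \<Rightarrow> real^'d"
  assumes sf: "step_fun n r \<eta> B" and st: "0 \<le> s" "s \<le> t" and B: "0 \<le> B"
    and p: "p \<in> borel_measurable (F s)" "\<And>\<omega>. \<omega> \<in> space M \<Longrightarrow> norm (p \<omega>) \<le> P"
  defines "q \<equiv> \<lambda>\<omega>. \<Sum>j<n. (clamp_time s t (r (Suc j)) - clamp_time s t (r j)) * (norm (transpose (\<eta> j \<omega>) *v p \<omega>))\<^sup>2"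
  shows "integrable M (\<lambda>\<omega>. (p \<omega> \<bullet> step_int s t n r \<eta> \<omega>)\<^sup>2)" and "integrable M q"
    and "expectation (\<lambda>\<omega>. (p \<omega> \<bullet> step_int s t n r \<eta> \<omega>)\<^sup>2) = expectation q"
    and "q \<omega> \<ge> 0" and "\<omega> \<in> space M \<Longrightarrow> q \<omega> \<le> B\<^sup>2 * (t - s) * (norm (p \<omega>))\<^sup>2"
proof -
  let ?c = "clamp_time s t"
  let ?g = "\<lambda>j \<omega>. if r j \<le> t then transpose (\<eta> j \<omega>) *v p \<omega> else 0"
  note A = step_fun_admissible[where p = p, OF sf st p B]
  have rj: "r j \<le> r (Suc j)" "\<And>\<omega>. \<omega> \<in> space M \<Longrightarrow> norm (\<eta> j \<omega>) \<le> B" if "j < n" for j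
    using sf that by (auto simp: step_fun_def)
  have mono: "?c x \<le> ?c y" if "x \<le> y" for x y using that by (auto simp: clamp_time_def)
  \<comment> \<open>The coefficients switched off after \<open>t\<close> belong to intervals of
    clamped length 0, so they may be put back into the sum.\<close>
  have qe: "q \<omega> = (\<Sum>j<n. (?c (r (Suc j)) - ?c (r j)) * (norm (?g j \<omega>))\<^sup>2)" for \<omega>
    unfolding q_def
  proof (rule sum.cong[OF refl])
    fix j assume j: "j \<in> {..<n}"
    show "(?c (r (Suc j)) - ?c (r j)) * (norm (transpose (\<eta> j \<omega>) *v p \<omega>))\<^sup>2 = (?c (r (Suc j)) - ?c (r j)) * (norm (?g j \<omega>))\<^sup>2"
      using rj(1)[of j] j st by (auto simp: clamp_time_def)
  qed
  have gi: "integrable M (\<lambda>\<omega>. (norm (?g j \<omega>))\<^sup>2)" if j: "j < n" for j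
  proof (rule integrable_const_bound[of _ "(B * P)\<^sup>2"])
    have "?g j \<in> borel_measurable (F (?c (r j)))" using A(1) j by (auto simp: admissible_def)
    then have "?g j \<in> borel_measurable M"
      by (rule measurable_F_M) (use st in \<open>auto simp: clamp_time_def\<close>)
    then show "(\<lambda>\<omega>. (norm (?g j \<omega>))\<^sup>2) \<in> borel_measurable M" by simp
    show "AE \<omega> in M. norm ((norm (?g j \<omega>))\<^sup>2) \<le> (B * P)\<^sup>2"
    proof (rule AE_I2)
      fix \<omega> assume "\<omega> \<in> space M"
      then have "norm (?g j \<omega>) \<le> B * P" using A(1) j unfolding admissible_def by blast
      then have "(norm (?g j \<omega>))\<^sup>2 \<le> (B * P)\<^sup>2" by (intro power_mono) auto
      then show "norm ((norm (?g j \<omega>))\<^sup>2) \<le> (B * P)\<^sup>2" by simp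
    qed
  qed
  show "integrable M (\<lambda>\<omega>. (p \<omega> \<bullet> step_int s t n r \<eta> \<omega>)\<^sup>2)"
    using stoch_sum_square(1)[OF A(1)] by (simp only: A(2))
  show "integrable M q" unfolding qe using gi by (intro Bochner_Integration.integrable_sum integrable_mult_right) auto
  show "expectation (\<lambda>\<omega>. (p \<omega> \<bullet> step_int s t n r \<eta> \<omega>)\<^sup>2) = expectation q"
  proof -
    have "expectation q = (\<Sum>j<n. (?c (r (Suc j)) - ?c (r j)) * expectation (\<lambda>\<omega>. (norm (?g j \<omega>))\<^sup>2))"
      unfolding qe by (subst Bochner_Integration.integral_sum) (use gi in auto)
    then show ?thesis using stoch_sum_square(2)[OF A(1)] by (simp only: A(2))
  qed
  show "q \<omega> \<ge> 0" unfolding q_def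
    using rj(1) mono by (intro sum_nonneg mult_nonneg_nonneg) auto
  show "q \<omega> \<le> B\<^sup>2 * (t - s) * (norm (p \<omega>))\<^sup>2" if w: "\<omega> \<in> space M"
  proof -
    have "q \<omega> \<le> (\<Sum>j<n. (?c (r (Suc j)) - ?c (r j)) * (B\<^sup>2 * (norm (p \<omega>))\<^sup>2))"
      unfolding q_def
    proof (rule sum_mono)
      fix j assume j: "j \<in> {..<n}"
      have "norm (transpose (\<eta> j \<omega>) *v p \<omega>) \<le> norm (\<eta> j \<omega>) * norm (p \<omega>)"
        by (rule norm_transpose_mult_le)
      also have "\<dots> \<le> B * norm (p \<omega>)" using rj(2)[of j] w j by (intro mult_right_mono) auto
      finally have "(norm (transpose (\<eta> j \<omega>) *v p \<omega>))\<^sup>2 \<le> (B * norm (p \<omega>))\<^sup>2" by (intro power_mono) auto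
      then show "(?c (r (Suc j)) - ?c (r j)) * (norm (transpose (\<eta> j \<omega>) *v p \<omega>))\<^sup>2 \<le> (?c (r (Suc j)) - ?c (r j)) * (B\<^sup>2 * (norm (p \<omega>))\<^sup>2)"
        using rj(1)[of j] mono j by (intro mult_left_mono) (auto simp: power_mult_distrib)
    qed
    also have "\<dots> = (\<Sum>j<n. ?c (r (Suc j)) - ?c (r j)) * (B\<^sup>2 * (norm (p \<omega>))\<^sup>2)"
      by (simp add: sum_distrib_right)
    also have "\<dots> \<le> (t - s) * (B\<^sup>2 * (norm (p \<omega>))\<^sup>2)"
      using admissible_length[OF A(1)] by (intro mult_right_mono) auto
    finally show ?thesis by (simp add: mult_ac)
  qed
qed

text \<open>The scalar bound is applied to each coordinate, that is with an axis vector as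
  \<open>p\<close>. One factor \<open>CARD('d)\<close> stems from \<open>norm_power4_le_sum\<close>,
  the other from the sum over coordinates.\<close>

lemma step_int_power4:
  fixes \<eta> :: "nat \<Rightarrow> 'a \<Rightarrow> real^'m^'d"
  assumes sf: "step_fun n r \<eta> B" and st: "0 \<le> s" "s \<le> t" and B: "0 \<le> B"
  shows "integrable M (\<lambda>\<omega>. norm (step_int s t n r \<eta> \<omega>) ^ 4)"
    and "expectation (\<lambda>\<omega>. norm (step_int s t n r \<eta> \<omega>) ^ 4) \<le> 9 * (real CARD('d))\<^sup>2 * (real CARD('m))\<^sup>2 * B ^ 4 * (t - s)\<^sup>2"
proof -
  let ?J = "step_int s t n r \<eta>"
  have J [measurable]: "?J \<in> borel_measurable M"
    using measurable_F_M[OF step_int_measurable[OF sf st]] st by auto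
  have c: "integrable M (\<lambda>\<omega>. (?J \<omega> $ a) ^ 4)"
    "expectation (\<lambda>\<omega>. (?J \<omega> $ a) ^ 4) \<le> 9 * (real CARD('m))\<^sup>2 * B ^ 4 * (t - s)\<^sup>2" for a
  proof -
    have p: "(\<lambda>_. axis a (1::real)) \<in> borel_measurable (F s)" "norm (axis a (1::real)) \<le> 1"
      by (auto simp: norm_axis_1)
    note A = step_fun_admissible[where p = "\<lambda>_. axis a 1", OF sf st p B]
    have eq: "?J \<omega> $ a = axis a 1 \<bullet> ?J \<omega>" for \<omega>
      by (simp add: inner_axis')
    show "integrable M (\<lambda>\<omega>. (?J \<omega> $ a) ^ 4)"
      "expectation (\<lambda>\<omega>. (?J \<omega> $ a) ^ 4) \<le> 9 * (real CARD('m))\<^sup>2 * B ^ 4 * (t - s)\<^sup>2"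
      unfolding eq A(2) using stoch_sum_power4[OF A(1)] by auto
  qed
  let ?b = "\<lambda>\<omega>. real CARD('d) * (\<Sum>a\<in>UNIV. (?J \<omega> $ a) ^ 4)"
  have bi: "integrable M ?b" using c by (intro integrable_mult_right Bochner_Integration.integrable_sum)
  show i: "integrable M (\<lambda>\<omega>. norm (?J \<omega>) ^ 4)"
    by (rule Bochner_Integration.integrable_bound[OF bi]) (auto intro: order_trans[OF norm_power4_le_sum abs_ge_self])
  have "expectation (\<lambda>\<omega>. norm (?J \<omega>) ^ 4) \<le> expectation ?b"
    by (rule integral_mono[OF i bi]) (rule norm_power4_le_sum)
  also have "\<dots> = real CARD('d) * (\<Sum>a\<in>UNIV. expectation (\<lambda>\<omega>. (?J \<omega> $ a) ^ 4))"
    using c by (simp add: Bochner_Integration.integral_sum)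
  also have "\<dots> \<le> real CARD('d) * (\<Sum>a\<in>(UNIV::'d set). 9 * (real CARD('m))\<^sup>2 * B ^ 4 * (t - s)\<^sup>2)"
    using c by (intro mult_left_mono sum_mono) auto
  also have "\<dots> = 9 * (real CARD('d))\<^sup>2 * (real CARD('m))\<^sup>2 * B ^ 4 * (t - s)\<^sup>2"
    by (simp add: power2_eq_square)
  finally show "expectation (\<lambda>\<omega>. norm (?J \<omega>) ^ 4) \<le> 9 * (real CARD('d))\<^sup>2 * (real CARD('m))\<^sup>2 * B ^ 4 * (t - s)\<^sup>2" .
qed

end

section \<open>Truncation and locality of the stochastic integral\<close>

lemma transpose_mult_diff:
  "transpose A *v p - transpose B *v p = transpose (A - B) *v (p :: real^'d)"
  for A B :: "real^'m^'d"
  by (simp add: vec_eq_iff matrix_vector_mult_def transpose_def sum_subtractf[symmetric] left_diff_distrib)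

lemma transpose_mult_axis: "transpose A *v axis a 1 = (A :: real^'m^'d) $ a"
  unfolding matrix_vector_mult_basis by (simp add: column_def transpose_def vec_eq_iff)

text \<open>Truncation by the nearest-point map onto the ball. It is 1-Lipschitz and fixes the ball,
  so where the integrand \<open>H\<close> has norm at most \<open>C\<close>, truncating an
  approximation of \<open>H\<close> never moves it further away.\<close>

definition ball_proj :: "real \<Rightarrow> real^'m^'d \<Rightarrow> real^'m^'d" where
  "ball_proj C A = closest_point (cball 0 C) A"

lemma ball_proj_props:
  fixes A B :: "real^'m^'d"
  assumes "0 < C"
  shows norm_ball_proj_le: "norm (ball_proj C A) \<le> C"
    and ball_proj_id: "norm A \<le> C \<Longrightarrow> ball_proj C A = A"
    and ball_proj_lipschitz: "norm (ball_proj C A - ball_proj C B) \<le> norm (A - B)"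
    and ball_proj_measurable: "(ball_proj C :: real^'m^'d \<Rightarrow> _) \<in> borel_measurable borel"
proof -
  have ne: "cball (0 :: real^'m^'d) C \<noteq> {}" "convex (cball (0 :: real^'m^'d) C)" "closed (cball (0 :: real^'m^'d) C)"
    using assms by auto
  show "norm (ball_proj C A) \<le> C"
    using closest_point_in_set[OF ne(3,1), of A] by (simp add: ball_proj_def)
  show "norm A \<le> C \<Longrightarrow> ball_proj C A = A"
    unfolding ball_proj_def by (rule closest_point_self) simp
  show "norm (ball_proj C A - ball_proj C B) \<le> norm (A - B)"
    using closest_point_lipschitz[OF ne(2,3,1), of A B] by (simp add: ball_proj_def dist_norm)
  show "(ball_proj C :: real^'m^'d \<Rightarrow> _) \<in> borel_measurable borel"
    unfolding ball_proj_def[abs_def] by (intro borel_measurable_continuous_onI continuous_on_closest_point ne)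
qed

lemma ball_proj_dist_le: "0 < C \<Longrightarrow> norm B \<le> C \<Longrightarrow> norm (ball_proj C A - B) \<le> norm (A - B)"
  using ball_proj_lipschitz[of C A B] ball_proj_id[of C B] by simp

context brownian
begin

lemma clamp_time_mono: "x \<le> y \<Longrightarrow> clamp_time s t x \<le> clamp_time s t y"
  by (auto simp: clamp_time_def)

text \<open>A bound for the quadratic variation that holds on every path passes to the second
  moment: the isometry is applied with each axis vector, and the squared norms of the rows add up to
  the Frobenius norm.\<close>

lemma step_int_norm_square_le:
  fixes \<eta> :: "nat \<Rightarrow> 'a \<Rightarrow> real^'m^'d"
  assumes sf: "step_fun n r \<eta> B" and st: "0 \<le> s" "s \<le> t" and B: "0 \<le> B"
    and le: "\<And>\<omega>. \<omega> \<in> space M \<Longrightarrow>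
      (\<Sum>j<n. (clamp_time s t (r (Suc j)) - clamp_time s t (r j)) * (norm (\<eta> j \<omega>))\<^sup>2) \<le> \<delta>"
  shows "integrable M (\<lambda>\<omega>. (norm (step_int s t n r \<eta> \<omega>))\<^sup>2)"
    and "expectation (\<lambda>\<omega>. (norm (step_int s t n r \<eta> \<omega>))\<^sup>2) \<le> \<delta>"
proof -
  let ?J = "step_int s t n r \<eta>" and ?c = "clamp_time s t"
  define q where "q a \<omega> = (\<Sum>j<n. (?c (r (Suc j)) - ?c (r j)) * (norm (\<eta> j \<omega> $ a))\<^sup>2)" for a \<omega>
  have p: "(\<lambda>_. axis a (1::real) :: real^'d) \<in> borel_measurable (F s)" "norm (axis a (1::real) :: real^'d) \<le> 1" for a
    by (auto simp: norm_axis_1)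
  have comp: "integrable M (\<lambda>\<omega>. (?J \<omega> $ a)\<^sup>2)" "integrable M (q a)" "expectation (\<lambda>\<omega>. (?J \<omega> $ a)\<^sup>2) = expectation (q a)" for a
    using step_int_square(1,2,3)[where p = "\<lambda>_. axis a 1", OF sf st B p(1) p(2)]
    by (simp_all only: transpose_mult_axis q_def[abs_def] inner_axis' inner_real_def mult_1)
  have eq: "(norm x)\<^sup>2 = (\<Sum>a\<in>UNIV. (x $ a)\<^sup>2)" for x :: "real^'d"
    by (simp add: norm_vec_def L2_set_def sum_nonneg)
  have eqm: "(norm A)\<^sup>2 = (\<Sum>a\<in>UNIV. (norm (A $ a))\<^sup>2)" for A :: "real^'m^'d"
    by (simp add: norm_vec_def[of A] L2_set_def sum_nonneg)
  show "integrable M (\<lambda>\<omega>. (norm (?J \<omega>))\<^sup>2)"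
    unfolding eq using comp by (intro Bochner_Integration.integrable_sum)
  have "expectation (\<lambda>\<omega>. (norm (?J \<omega>))\<^sup>2) = (\<Sum>a\<in>UNIV. expectation (q a))"
    unfolding eq using comp by (subst Bochner_Integration.integral_sum) auto
  also have "\<dots> = expectation (\<lambda>\<omega>. \<Sum>a\<in>UNIV. q a \<omega>)"
    using comp by (subst Bochner_Integration.integral_sum) auto
  also have "\<dots> \<le> expectation (\<lambda>_. \<delta>)"
  proof (rule integral_mono)
    show "(\<Sum>a\<in>UNIV. q a \<omega>) \<le> \<delta>" if w: "\<omega> \<in> space M" for \<omega>
    proof -
      have "(\<Sum>a\<in>UNIV. q a \<omega>) = (\<Sum>j<n. (?c (r (Suc j)) - ?c (r j)) * (norm (\<eta> j \<omega>))\<^sup>2)"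
        unfolding q_def by (subst sum.swap) (simp only: eqm sum_distrib_left)
      then show ?thesis using le[OF w] by simp
    qed
  qed (use comp in auto)
  finally show "expectation (\<lambda>\<omega>. (norm (?J \<omega>))\<^sup>2) \<le> \<delta>" by (simp add: prob_space)
qed

text \<open>The coefficients are switched off as soon as the accumulated quadratic variation exceeds
  \<open>\<delta>\<close>. As this quantity is known one step ahead, the result is again an integrand.\<close>

lemma step_int_tail:
  fixes \<eta> :: "nat \<Rightarrow> 'a \<Rightarrow> real^'m^'d"
  assumes sf: "step_fun n r \<eta> B" and st: "0 \<le> s" "s \<le> t" and B: "0 \<le> B" and pos: "0 < \<epsilon>" "0 \<le> \<delta>"
  defines "Q \<equiv> \<lambda>\<omega>. \<Sum>j<n. (clamp_time s t (r (Suc j)) - clamp_time s t (r j)) * (norm (\<eta> j \<omega>))\<^sup>2"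
  shows "{\<omega>\<in>space M. \<epsilon> < norm (step_int s t n r \<eta> \<omega>) \<and> Q \<omega> \<le> \<delta>} \<in> sets M"
    and "prob {\<omega>\<in>space M. \<epsilon> < norm (step_int s t n r \<eta> \<omega>) \<and> Q \<omega> \<le> \<delta>} \<le> \<delta> / \<epsilon>\<^sup>2"
proof -
  let ?d = "\<lambda>j. clamp_time s t (r (Suc j)) - clamp_time s t (r j)"
  define q where "q k \<omega> = (\<Sum>j<k. ?d j * (norm (\<eta> j \<omega>))\<^sup>2)" for k \<omega>
  define \<eta>' where "\<eta>' j \<omega> = (if q (Suc j) \<omega> \<le> \<delta> then \<eta> j \<omega> else 0)" for j \<omega>
  have r0: "0 \<le> r j" if "j \<le> n" for j
    using step_fun_mono[OF sf, of 0 j] that sf by (auto simp: step_fun_def)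
  have \<eta>m: "\<eta> j \<in> borel_measurable (F (r k))" if "j \<le> k" "k < n" for j k
    by (rule measurable_F_mono[of _ "r j"]) (use sf that step_fun_mono[OF sf, of j k] in \<open>auto simp: step_fun_def\<close>)
  have d0: "0 \<le> ?d j" if "j < n" for j
    using sf that clamp_time_mono by (auto simp: step_fun_def)
  have qm: "q (Suc k) \<in> borel_measurable (F (r k))" if "k < n" for k
    unfolding q_def[abs_def] using \<eta>m[OF _ that]
    by (intro borel_measurable_sum borel_measurable_times borel_measurable_const borel_measurable_power borel_measurable_norm) auto
  have sf': "step_fun n r \<eta>' B"
    unfolding step_fun_def
  proof (intro conjI allI impI ballI)
    fix j assume j: "j < n"
    have [measurable]: "q (Suc j) \<in> borel_measurable (F (r j))" "\<eta> j \<in> borel_measurable (F (r j))"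
      using qm \<eta>m j by auto
    show "\<eta>' j \<in> borel_measurable (F (r j))" unfolding \<eta>'_def[abs_def] by measurable
    show "norm (\<eta>' j \<omega>) \<le> B" if "\<omega> \<in> space M" for \<omega>
      using sf j that B by (auto simp: \<eta>'_def step_fun_def)
  qed (use sf in \<open>auto simp: step_fun_def\<close>)
  \<comment> \<open>The second inequality is what carries the first through the induction: while the
    coefficient is kept, the new sum is at most \<open>q (Suc k)\<close>, which is at most
    \<delta>.\<close>
  have "(\<Sum>j<k. ?d j * (norm (\<eta>' j \<omega>))\<^sup>2) \<le> \<delta> \<and> (\<Sum>j<k. ?d j * (norm (\<eta>' j \<omega>))\<^sup>2) \<le> q k \<omega>"
    if "k \<le> n" for k \<omega>
    using that
  proof (induction k)
    case (Suc k)
    have "0 \<le> ?d k * (norm (\<eta> k \<omega>))\<^sup>2" using d0[of k] Suc.prems by simp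
    then show ?case
      using Suc by (auto simp: \<eta>'_def q_def)
  qed (use pos in \<open>auto simp: q_def\<close>)
  then have small: "(\<Sum>j<n. ?d j * (norm (\<eta>' j \<omega>))\<^sup>2) \<le> \<delta>" for \<omega> by blast
  \<comment> \<open>\<open>q\<close> increases with its index, so if the total stays below \<delta>
    then no coefficient has been switched off.\<close>
  have same: "step_int s t n r \<eta>' \<omega> = step_int s t n r \<eta> \<omega>" if "Q \<omega> \<le> \<delta>" for \<omega>
    unfolding step_int_def
  proof (rule sum.cong[OF refl])
    fix j assume j: "j \<in> {..<n}"
    have "q (Suc j) \<omega> \<le> q n \<omega>"
      unfolding q_def by (rule sum_mono2) (use j d0 in auto)
    then have "q (Suc j) \<omega> \<le> \<delta>" using that by (simp add: Q_def q_def)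
    then show "\<eta>' j \<omega> *v (W (clamp_time s t (r (Suc j))) \<omega> - W (clamp_time s t (r j)) \<omega>) =
        \<eta> j \<omega> *v (W (clamp_time s t (r (Suc j))) \<omega> - W (clamp_time s t (r j)) \<omega>)"
      by (simp add: \<eta>'_def)
  qed
  have [measurable]: "step_int s t n r \<eta> \<in> borel_measurable M"
    "step_int s t n r \<eta>' \<in> borel_measurable M"
    using measurable_F_M[OF step_int_measurable[OF sf st]] measurable_F_M[OF step_int_measurable[OF sf' st]] st by auto
  have \<eta>M: "\<eta> j \<in> borel_measurable M" if "j < n" for j
    using sf r0[of j] that by (intro measurable_F_M[of _ "r j"]) (auto simp: step_fun_def)
  have [measurable]: "Q \<in> borel_measurable M"
    unfolding Q_def using \<eta>M
    by (intro borel_measurable_sum borel_measurable_times borel_measurable_const borel_measurable_power borel_measurable_norm) auto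
  show m: "{\<omega>\<in>space M. \<epsilon> < norm (step_int s t n r \<eta> \<omega>) \<and> Q \<omega> \<le> \<delta>} \<in> sets M" by measurable
  note sq = step_int_norm_square_le[OF sf' st B, of \<delta>, OF small]
  have "prob {\<omega>\<in>space M. \<epsilon> < norm (step_int s t n r \<eta> \<omega>) \<and> Q \<omega> \<le> \<delta>} \<le>
      prob {\<omega>\<in>space M. (norm (step_int s t n r \<eta>' \<omega>))\<^sup>2 \<ge> \<epsilon>\<^sup>2}"
  proof (rule finite_measure_mono)
    show "{\<omega>\<in>space M. \<epsilon> < norm (step_int s t n r \<eta> \<omega>) \<and> Q \<omega> \<le> \<delta>}
        \<subseteq> {\<omega>\<in>space M. (norm (step_int s t n r \<eta>' \<omega>))\<^sup>2 \<ge> \<epsilon>\<^sup>2}"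
      using pos same by (auto intro!: power_mono)
  qed measurable
  also have "\<dots> \<le> expectation (\<lambda>\<omega>. (norm (step_int s t n r \<eta>' \<omega>))\<^sup>2) / \<epsilon>\<^sup>2"
    by (rule integral_Markov_inequality_measure[OF sq(1) sets.top]) (use pos in auto)
  also have "\<dots> \<le> \<delta> / \<epsilon>\<^sup>2"
    using sq(2) by (intro divide_right_mono) auto
  finally show "prob {\<omega>\<in>space M. \<epsilon> < norm (step_int s t n r \<eta> \<omega>) \<and> Q \<omega> \<le> \<delta>} \<le> \<delta> / \<epsilon>\<^sup>2" .
qed

text \<open>The half-open intervals are disjoint, so at any time at most one summand is present and
  \<psi> may be applied to it alone; \<psi> 0 = 0 covers the times in no interval. The function
  \<psi> is left general because both the distance to the ball and the tested truncation are
  integrated in this way.\<close>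

lemma simple_process_integral:
  fixes \<xi> :: "nat \<Rightarrow> 'a \<Rightarrow> real^'m^'d" and \<psi> :: "real^'m^'d \<Rightarrow> real"
  assumes mono: "\<And>j. j < n \<Longrightarrow> r j \<le> r (Suc j)" and st: "s \<le> t"
    and \<psi>: "\<psi> 0 = 0" "\<And>A. 0 \<le> \<psi> A"
  shows "(\<lambda>x. ennreal (\<psi> (simple_process n r \<xi> x \<omega>)) * indicator {s<..t} x) \<in> borel_measurable lborel"
    and "(\<integral>\<^sup>+x. ennreal (\<psi> (simple_process n r \<xi> x \<omega>)) * indicator {s<..t} x \<partial>lborel) =
      ennreal (\<Sum>j<n. (clamp_time s t (r (Suc j)) - clamp_time s t (r j)) * \<psi> (\<xi> j \<omega>))"
proof -
  let ?c = "clamp_time s t"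
  have mono': "r i \<le> r j" if "i \<le> j" "j \<le> n" for i j
    using that
  proof (induction j rule: dec_induct)
    case (step k)
    then show ?case using mono[of k] by force
  qed simp
  have uniq: "i = j" if "i < n" "j < n" "x \<in> {r i<..r (Suc i)}" "x \<in> {r j<..r (Suc j)}" for i j x
  proof (rule ccontr)
    assume "i \<noteq> j"
    then consider "Suc i \<le> j" | "Suc j \<le> i" by linarith
    then show False
      using mono'[of "Suc i" j] mono'[of "Suc j" i] that by cases auto
  qed
  have cl: "x \<in> {?c (r j)<..?c (r (Suc j))} \<longleftrightarrow> x \<in> {r j<..r (Suc j)}" if "x \<in> {s<..t}" for x j
    using that by (auto simp: clamp_time_def min_def max_def)
  have cl': "x \<notin> {?c (r j)<..?c (r (Suc j))}" if "x \<notin> {s<..t}" for x j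
    using that st by (auto simp: clamp_time_def min_def max_def split: if_splits)
  have eq: "ennreal (\<psi> (simple_process n r \<xi> x \<omega>)) * indicator {s<..t} x =
      (\<Sum>j<n. ennreal (\<psi> (\<xi> j \<omega>)) * indicator {?c (r j)<..?c (r (Suc j))} x)" for x
  proof (cases "x \<in> {s<..t}")
    case False
    then have "indicator {?c (r j)<..?c (r (Suc j))} x = (0::ennreal)" for j
      using cl'[OF False, of j] by (intro indicator_simps(2))
    then show ?thesis by (simp only: indicator_simps(2)[OF False] mult_zero_right sum.neutral_const)
  next
    case True
    show ?thesis
    proof (cases "\<exists>j<n. x \<in> {r j<..r (Suc j)}")
      case False
      then have "simple_process n r \<xi> x \<omega> = 0"
        unfolding simple_process_def by (intro sum.neutral) (auto simp: indicator_def)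
      moreover have "(\<Sum>j<n. ennreal (\<psi> (\<xi> j \<omega>)) * indicator {?c (r j)<..?c (r (Suc j))} x) = 0"
        using False cl[OF True] by (intro sum.neutral) (auto simp: indicator_def)
      ultimately show ?thesis using \<psi> by simp
    next
      case ex: True
      then obtain j where j: "j < n" "x \<in> {r j<..r (Suc j)}" by blast
      have ind: "x \<in> {r i<..r (Suc i)} \<longleftrightarrow> i = j" if "i < n" for i
        using uniq[OF that j(1)] j by auto
      have "simple_process n r \<xi> x \<omega> = (\<Sum>i<n. if i = j then \<xi> i \<omega> else 0)"
        unfolding simple_process_def using ind by (intro sum.cong) (auto simp: indicator_def)
      then have 1: "simple_process n r \<xi> x \<omega> = \<xi> j \<omega>" using j by simp
      have "(\<Sum>i<n. ennreal (\<psi> (\<xi> i \<omega>)) * indicator {?c (r i)<..?c (r (Suc i))} x) =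
         (\<Sum>i<n. if i = j then ennreal (\<psi> (\<xi> i \<omega>)) else 0)"
        using ind cl[OF True] by (intro sum.cong) (auto simp: indicator_def)
      also have "\<dots> = ennreal (\<psi> (\<xi> j \<omega>))" using j by simp
      finally show ?thesis using 1 True by simp
    qed
  qed
  show "(\<lambda>x. ennreal (\<psi> (simple_process n r \<xi> x \<omega>)) * indicator {s<..t} x) \<in> borel_measurable lborel"
    unfolding eq by measurable
  have "(\<integral>\<^sup>+x. ennreal (\<psi> (simple_process n r \<xi> x \<omega>)) * indicator {s<..t} x \<partial>lborel) =
      (\<Sum>j<n. \<integral>\<^sup>+x. ennreal (\<psi> (\<xi> j \<omega>)) * indicator {?c (r j)<..?c (r (Suc j))} x \<partial>lborel)"
    unfolding eq by (rule nn_integral_sum) measurable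
  also have "\<dots> = (\<Sum>j<n. ennreal (\<psi> (\<xi> j \<omega>)) * ennreal (?c (r (Suc j)) - ?c (r j)))"
    using mono by (intro sum.cong refl) (subst nn_integral_cmult_indicator, auto simp: clamp_time_mono)
  also have "\<dots> = (\<Sum>j<n. ennreal ((?c (r (Suc j)) - ?c (r j)) * \<psi> (\<xi> j \<omega>)))"
    using mono \<psi> by (intro sum.cong refl) (auto simp: ennreal_mult[symmetric] clamp_time_mono mult.commute)
  also have "\<dots> = ennreal (\<Sum>j<n. (?c (r (Suc j)) - ?c (r j)) * \<psi> (\<xi> j \<omega>))"
    using mono \<psi> by (intro sum_ennreal) (auto simp: clamp_time_mono)
  finally show "(\<integral>\<^sup>+x. ennreal (\<psi> (simple_process n r \<xi> x \<omega>)) * indicator {s<..t} x \<partial>lborel) =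
      ennreal (\<Sum>j<n. (?c (r (Suc j)) - ?c (r j)) * \<psi> (\<xi> j \<omega>))" .
qed

text \<open>Progressive measurability speaks of the product with \<open>{0..t}\<close> only.
  Extending a path by 0 makes it a Borel function on the line, as the integrals over
  \<open>lborel\<close> require.\<close>

lemma prog_measurable_section:
  assumes "prog_measurable F H" "0 \<le> t" "\<omega> \<in> space M"
  shows "(\<lambda>x. if x \<in> {0..t} then H x \<omega> else 0) \<in> borel_measurable (borel :: real measure)"
proof -
  have "(\<lambda>(x, \<omega>). H x \<omega>) \<in> borel_measurable (restrict_space borel {0..t} \<Otimes>\<^sub>M F t)"
    using assms unfolding prog_measurable_def by blast
  moreover have "(\<lambda>x. (x, \<omega>)) \<in> measurable (restrict_space borel {0..t}) (restrict_space borel {0..t} \<Otimes>\<^sub>M F t)"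
    using assms(3) by (intro measurable_Pair2') simp
  ultimately have "(\<lambda>x. (\<lambda>(x, \<omega>). H x \<omega>) (x, \<omega>)) \<in> borel_measurable (restrict_space borel {0..t})"
    by (rule measurable_compose[rotated])
  then show ?thesis
    by (subst (asm) measurable_restrict_space_iff[of _ _ 0]) auto
qed

lemma simple_integrand_step_fun:
  assumes "simple_integrand M F n r \<xi>"
  obtains B where "0 \<le> B" "step_fun n r \<xi> B"
proof -
  have "\<forall>j. \<exists>b\<ge>0. j < n \<longrightarrow> (\<forall>\<omega>\<in>space M. norm (\<xi> j \<omega>) \<le> b)"
  proof
    fix j
    show "\<exists>b\<ge>0. j < n \<longrightarrow> (\<forall>\<omega>\<in>space M. norm (\<xi> j \<omega>) \<le> b)"
    proof (cases "j < n")
      case True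
      then have "bounded (\<xi> j ` space M)" using assms by (auto simp: simple_integrand_def)
      then obtain b where "0 < b" "\<forall>x\<in>\<xi> j ` space M. norm x \<le> b" unfolding bounded_pos by blast
      then show ?thesis by (intro exI[of _ b]) auto
    qed auto
  qed
  then obtain b where b: "\<And>j. 0 \<le> b j" "\<And>j \<omega>. j < n \<Longrightarrow> \<omega> \<in> space M \<Longrightarrow> norm (\<xi> j \<omega>) \<le> b j" by metis
  have "norm (\<xi> j \<omega>) \<le> (\<Sum>j<n. b j)" if "j < n" "\<omega> \<in> space M" for j \<omega>
    using b(2)[OF that] member_le_sum[of j "{..<n}" b] b(1) that by auto
  then show ?thesis
    using assms b(1) by (intro that[of "\<Sum>j<n. b j"] sum_nonneg) (auto simp: simple_integrand_def step_fun_def)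
qed

lemma tends_to_0_in_probD:
  assumes "tends_to_0_in_prob M Z" "0 < \<epsilon>" "0 < e"
  shows "\<forall>\<^sub>F k in sequentially. prob {\<omega>\<in>space M. ennreal \<epsilon> < Z k \<omega>} < e"
  using assms unfolding tends_to_0_in_prob_def by (auto dest!: order_tendstoD(2))

text \<open>\<open>J\<close> approximates the increment over \<open>[s,t]\<close> of the integral \<open>I\<close> of \<open>H\<close>, on the event that \<open>H\<close> is
  bounded by \<open>C\<close> there and off the exceptional event \<open>R\<close>; \<open>P\<close> bounds the test vectors \<open>p\<close>.\<close>

definition step_approx ::
  "real \<Rightarrow> real \<Rightarrow> real \<Rightarrow> real \<Rightarrow> real \<Rightarrow> real \<Rightarrow> (real \<Rightarrow> 'a \<Rightarrow> real^'m^'d) \<Rightarrow> (real \<Rightarrow> 'a \<Rightarrow> real^'d) \<Rightarrow>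
    ('a \<Rightarrow> real^'d) \<Rightarrow> 'a set \<Rightarrow> bool" where
  "step_approx s t C P c \<zeta> H I J R \<longleftrightarrow>
     J \<in> borel_measurable (F t) \<and> R \<in> sets M \<and> prob R \<le> \<zeta> \<and>
     (\<forall>Z k. Z \<in> borel_measurable (F s) \<longrightarrow> integrable M Z \<longrightarrow>
       integrable M (\<lambda>\<omega>. Z \<omega> * J \<omega> $ k) \<and> expectation (\<lambda>\<omega>. Z \<omega> * J \<omega> $ k) = 0) \<and>
     (\<forall>p. p \<in> borel_measurable (F s) \<longrightarrow> (\<forall>\<omega>\<in>space M. norm (p \<omega>) \<le> P) \<longrightarrow>
       integrable M (\<lambda>\<omega>. (p \<omega> \<bullet> J \<omega>)\<^sup>2) \<and>
       expectation (\<lambda>\<omega>. (p \<omega> \<bullet> J \<omega>)\<^sup>2) \<le> C\<^sup>2 * (t - s) * expectation (\<lambda>\<omega>. (norm (p \<omega>))\<^sup>2)) \<and>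
     (\<forall>p E. p \<in> borel_measurable (F s) \<longrightarrow> (\<forall>\<omega>\<in>space M. norm (p \<omega>) \<le> P) \<longrightarrow> E \<in> sets M \<longrightarrow>
       (\<forall>\<omega>\<in>E. \<forall>x\<in>{s<..t}. norm (H x \<omega>) \<le> C \<and> c \<le> norm (transpose (H x \<omega>) *v p \<omega>)) \<longrightarrow>
       c\<^sup>2 / 4 * (t - s) * prob (E - R) \<le> expectation (\<lambda>\<omega>. (p \<omega> \<bullet> J \<omega>)\<^sup>2)) \<and>
     integrable M (\<lambda>\<omega>. norm (J \<omega>) ^ 4) \<and>
     expectation (\<lambda>\<omega>. norm (J \<omega>) ^ 4) \<le> 9 * (real CARD('d))\<^sup>2 * (real CARD('m))\<^sup>2 * C ^ 4 * (t - s)\<^sup>2 \<and>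
     (\<forall>\<omega>\<in>space M - R. (\<forall>x\<in>{s<..t}. norm (H x \<omega>) \<le> C) \<longrightarrow> norm (J \<omega> - (I t \<omega> - I s \<omega>)) \<le> \<zeta>)"

text \<open>One member \<open>k\<close> of the approximating sequence is fixed; \<open>J\<close> is
  the increment of its truncated integral. \<open>R\<close> is the union of four events of
  probability at most \<zeta>/4 each: the integrands differ by more than \<delta>, the approximation
  of \<open>I\<close> fails at \<open>t\<close> or at \<open>s\<close>, or the part removed by the
  truncation has a large integral in spite of small quadratic variation.\<close>

lemma ito_step_approx:
  fixes H :: "real \<Rightarrow> 'a \<Rightarrow> real^'m^'d"
  assumes ito: "ito_integral M F W H I" and st: "0 \<le> s" "s < t"
    and pos: "0 < C" "0 < P" "0 < c" "0 < \<zeta>"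
  shows "\<exists>J R. step_approx s t C P c \<zeta> H I J R"
proof -
  have st': "s \<le> t" "0 \<le> t" using st by auto
  have prog: "prog_measurable F H" using ito by (simp add: ito_integral_def)
  obtain n r \<xi> where "(\<forall>k::nat. simple_integrand M F (n k) (r k) (\<xi> k)) \<and>
     (\<forall>T\<ge>0. tends_to_0_in_prob M (\<lambda>k \<omega>.
           \<integral>\<^sup>+ x\<in>{0..T}. ennreal ((norm (simple_process (n k) (r k) (\<xi> k) x \<omega> - H x \<omega>))\<^sup>2) \<partial>lborel)) \<and>
     (\<forall>t\<ge>0. tends_to_0_in_prob M (\<lambda>k \<omega>.
           ennreal (norm (simple_integral W (n k) (r k) (\<xi> k) t \<omega> - I t \<omega>))))"
    using ito[unfolded ito_integral_def, THEN conjunct2, THEN conjunct2, THEN conjunct2, THEN conjunct2]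
    by (elim exE) (rule that)
  note seq = this
  have si: "\<And>k. simple_integrand M F (n k) (r k) (\<xi> k)" using seq by (rule conjunct1[THEN spec])
  note tH = seq[THEN conjunct2, THEN conjunct1, rule_format] and tI = seq[THEN conjunct2, THEN conjunct2, rule_format]
  \<comment> \<open>The first bound makes the error 2 P^2 \<delta> in the lower estimate at most
    half of c^2 (t - s). The second brings the tail probability \<delta> / (\<zeta>/3)^2 down to
    \<zeta>/4.\<close>
  define \<delta> where "\<delta> = min (c\<^sup>2 * (t - s) / (4 * P\<^sup>2)) ((\<zeta> / 3)\<^sup>2 * (\<zeta> / 4))"
  have \<delta>: "0 < \<delta>" "\<delta> \<le> c\<^sup>2 * (t - s) / (4 * P\<^sup>2)" "\<delta> / (\<zeta> / 3)\<^sup>2 \<le> \<zeta> / 4"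
    using pos st by (auto simp: \<delta>_def field_simps)
  define Z where "Z k \<omega> = (\<integral>\<^sup>+ x\<in>{0..t}. ennreal ((norm (simple_process (n k) (r k) (\<xi> k) x \<omega> - H x \<omega>))\<^sup>2) \<partial>lborel)" for k \<omega>
  define Et where "Et k \<omega> = ennreal (norm (simple_integral W (n k) (r k) (\<xi> k) t \<omega> - I t \<omega>))" for k \<omega>
  define Es where "Es k \<omega> = ennreal (norm (simple_integral W (n k) (r k) (\<xi> k) s \<omega> - I s \<omega>))" for k \<omega>
  have tZ: "tends_to_0_in_prob M Z" and tt: "tends_to_0_in_prob M Et" and ts: "tends_to_0_in_prob M Es"
    using tH[of t] tI[of t] tI[of s] st by (simp_all add: Z_def[abs_def] Et_def[abs_def] Es_def[abs_def])
  have "\<forall>\<^sub>F k in sequentially. prob {\<omega>\<in>space M. ennreal \<delta> < Z k \<omega>} < \<zeta> / 4 \<and>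
      prob {\<omega>\<in>space M. ennreal (\<zeta> / 3) < Et k \<omega>} < \<zeta> / 4 \<and> prob {\<omega>\<in>space M. ennreal (\<zeta> / 3) < Es k \<omega>} < \<zeta> / 4"
    using tends_to_0_in_probD[OF tZ \<delta>(1), of "\<zeta> / 4"] tends_to_0_in_probD[OF tt, of "\<zeta> / 3" "\<zeta> / 4"]
      tends_to_0_in_probD[OF ts, of "\<zeta> / 3" "\<zeta> / 4"] pos
    by (simp add: eventually_conj_iff)
  then obtain k where k: "prob {\<omega>\<in>space M. ennreal \<delta> < Z k \<omega>} < \<zeta> / 4"
    "prob {\<omega>\<in>space M. ennreal (\<zeta> / 3) < Et k \<omega>} < \<zeta> / 4" "prob {\<omega>\<in>space M. ennreal (\<zeta> / 3) < Es k \<omega>} < \<zeta> / 4"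
    unfolding eventually_sequentially by blast
  have [measurable]: "Z k \<in> borel_measurable M" "Et k \<in> borel_measurable M" "Es k \<in> borel_measurable M"
    using tZ tt ts by (auto simp: tends_to_0_in_prob_def)
  let ?n = "n k" and ?r = "r k" and ?\<xi> = "\<xi> k"
  let ?S = "\<lambda>x \<omega>. simple_process ?n ?r ?\<xi> x \<omega>"
  let ?d = "\<lambda>j. clamp_time s t (?r (Suc j)) - clamp_time s t (?r j)"
  obtain B where B: "0 \<le> B" "step_fun ?n ?r ?\<xi> B"
    using simple_integrand_step_fun[OF si] by metis
  have rmono: "?r j \<le> ?r (Suc j)" if "j < ?n" for j using B(2) that by (auto simp: step_fun_def)
  have cutm: "(\<lambda>\<omega>. ball_proj C (?\<xi> j \<omega>)) \<in> borel_measurable (F (?r j))" if "j < ?n" for j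
    using B(2) that by (intro measurable_compose[OF _ ball_proj_measurable[OF pos(1)]]) (auto simp: step_fun_def)
  have sfc: "step_fun ?n ?r (\<lambda>j \<omega>. ball_proj C (?\<xi> j \<omega>)) C"
    using B(2) cutm norm_ball_proj_le[OF pos(1)] by (auto simp: step_fun_def)
  have sfe: "step_fun ?n ?r (\<lambda>j \<omega>. ?\<xi> j \<omega> - ball_proj C (?\<xi> j \<omega>)) (B + C)"
    unfolding step_fun_def
  proof (intro conjI allI impI ballI)
    fix j assume j: "j < ?n"
    show "(\<lambda>\<omega>. ?\<xi> j \<omega> - ball_proj C (?\<xi> j \<omega>)) \<in> borel_measurable (F (?r j))"
      using B(2) j cutm by (auto simp: step_fun_def intro!: borel_measurable_diff)
    show "norm (?\<xi> j \<omega> - ball_proj C (?\<xi> j \<omega>)) \<le> B + C" if "\<omega> \<in> space M" for \<omega>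
    proof -
      have "norm (?\<xi> j \<omega>) \<le> B" using B(2) j that by (auto simp: step_fun_def)
      then show ?thesis
        using norm_ball_proj_le[OF pos(1), of "?\<xi> j \<omega>"] norm_triangle_ineq4[of "?\<xi> j \<omega>" "ball_proj C (?\<xi> j \<omega>)"] by linarith
    qed
  qed (use B(2) in \<open>auto simp: step_fun_def\<close>)
  define J where "J = step_int s t ?n ?r (\<lambda>j \<omega>. ball_proj C (?\<xi> j \<omega>))"
  \<comment> \<open>\<open>N\<close> is the integral of what the truncation removes, and
    \<open>Q\<close> its quadratic variation.\<close>
  define N where "N = step_int s t ?n ?r (\<lambda>j \<omega>. ?\<xi> j \<omega> - ball_proj C (?\<xi> j \<omega>))"
  define Q where "Q \<omega> = (\<Sum>j<?n. ?d j * (norm (?\<xi> j \<omega> - ball_proj C (?\<xi> j \<omega>)))\<^sup>2)" for \<omega>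
  have BC: "0 \<le> B + C" using B pos by simp
  have z3: "0 < \<zeta> / 3" using pos by simp
  note tail = step_int_tail[OF sfe st(1) st'(1) BC z3, of \<delta>, folded N_def Q_def]
  define R where "R = {\<omega>\<in>space M. ennreal \<delta> < Z k \<omega>} \<union> {\<omega>\<in>space M. ennreal (\<zeta> / 3) < Et k \<omega>} \<union>
    {\<omega>\<in>space M. ennreal (\<zeta> / 3) < Es k \<omega>} \<union> {\<omega>\<in>space M. \<zeta> / 3 < norm (N \<omega>) \<and> Q \<omega> \<le> \<delta>}"
  have tm: "{\<omega>\<in>space M. \<zeta> / 3 < norm (N \<omega>) \<and> Q \<omega> \<le> \<delta>} \<in> sets M" using tail(1) \<delta> by simp
  have tp: "prob {\<omega>\<in>space M. \<zeta> / 3 < norm (N \<omega>) \<and> Q \<omega> \<le> \<delta>} \<le> \<zeta> / 4"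
    using tail(2)[OF less_imp_le[OF \<delta>(1)]] \<delta>(3) by (rule order_trans)
  have RM: "R \<in> sets M" unfolding R_def using tm by measurable
  have Rp: "prob R \<le> \<zeta>"
  proof -
    let ?A = "{\<omega>\<in>space M. ennreal \<delta> < Z k \<omega>}" and ?B = "{\<omega>\<in>space M. ennreal (\<zeta> / 3) < Et k \<omega>}"
      and ?C = "{\<omega>\<in>space M. ennreal (\<zeta> / 3) < Es k \<omega>}" and ?D = "{\<omega>\<in>space M. \<zeta> / 3 < norm (N \<omega>) \<and> Q \<omega> \<le> \<delta>}"
    have m: "?A \<in> sets M" "?B \<in> sets M" "?C \<in> sets M" by measurable
    have "prob R \<le> prob (?A \<union> ?B \<union> ?C) + prob ?D"
      unfolding R_def using m tm by (intro measure_Un_le) auto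
    also have "prob (?A \<union> ?B \<union> ?C) \<le> prob (?A \<union> ?B) + prob ?C"
      using m by (intro measure_Un_le) auto
    also have "prob (?A \<union> ?B) \<le> prob ?A + prob ?B"
      using m by (intro measure_Un_le) auto
    finally show ?thesis using k tp by linarith
  qed
  have Zsub: "(\<integral>\<^sup>+x. ennreal ((norm (?S x \<omega> - H x \<omega>))\<^sup>2) * indicator {s<..t} x \<partial>lborel) \<le> Z k \<omega>" for \<omega>
    unfolding Z_def using st by (intro nn_integral_mono mult_left_mono) (auto simp: indicator_def)
  have close: "norm (J \<omega> - (I t \<omega> - I s \<omega>)) \<le> \<zeta>"
    if w: "\<omega> \<in> space M - R" and HC: "\<And>x. x \<in> {s<..t} \<Longrightarrow> norm (H x \<omega>) \<le> C" for \<omega>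
  proof -
    \<comment> \<open>As \<open>H\<close> lies in the ball, the distance from the approximation to
      its nearest point in the ball is at most its distance to \<open>H\<close>. So \<open>Q\<close>
      is bounded by the approximation error \<open>Z k\<close>, and \<open>N\<close> is small off
      \<open>R\<close>.\<close>
    have "ennreal (Q \<omega>) = (\<integral>\<^sup>+x. ennreal ((norm (?S x \<omega> - ball_proj C (?S x \<omega>)))\<^sup>2) * indicator {s<..t} x \<partial>lborel)"
      unfolding Q_def
      by (rule simple_process_integral(2)[where \<psi> = "\<lambda>A. (norm (A - ball_proj C A))\<^sup>2", symmetric])
         (use rmono st' pos in \<open>auto simp: ball_proj_id\<close>)
    also have "\<dots> \<le> (\<integral>\<^sup>+x. ennreal ((norm (?S x \<omega> - H x \<omega>))\<^sup>2) * indicator {s<..t} x \<partial>lborel)"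
    proof (rule nn_integral_mono)
      fix x
      show "ennreal ((norm (?S x \<omega> - ball_proj C (?S x \<omega>)))\<^sup>2) * indicator {s<..t} x \<le> ennreal ((norm (?S x \<omega> - H x \<omega>))\<^sup>2) * indicator {s<..t} x"
      proof (cases "x \<in> {s<..t}")
        case True
        have "norm (?S x \<omega> - ball_proj C (?S x \<omega>)) \<le> norm (?S x \<omega> - H x \<omega>)"
          using closest_point_le[of "cball 0 C" "H x \<omega>" "?S x \<omega>"] HC[OF True] by (simp add: ball_proj_def dist_norm)
        then show ?thesis by (intro mult_right_mono ennreal_leI power_mono) auto
      qed simp
    qed
    also have "\<dots> \<le> Z k \<omega>" by (rule Zsub)
    also have "\<dots> \<le> ennreal \<delta>" using w by (auto simp: R_def not_less)
    finally have "Q \<omega> \<le> \<delta>" using \<delta>(1) by (simp add: ennreal_le_iff)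
    then have N: "norm (N \<omega>) \<le> \<zeta> / 3" using w by (auto simp: R_def not_less)
    have Et: "norm (simple_integral W ?n ?r ?\<xi> t \<omega> - I t \<omega>) \<le> \<zeta> / 3"
      and Es: "norm (simple_integral W ?n ?r ?\<xi> s \<omega> - I s \<omega>) \<le> \<zeta> / 3"
      using w z3 by (auto simp: R_def not_less Et_def Es_def ennreal_le_iff)
    have "J \<omega> - (I t \<omega> - I s \<omega>) = (simple_integral W ?n ?r ?\<xi> t \<omega> - I t \<omega>) - (simple_integral W ?n ?r ?\<xi> s \<omega> - I s \<omega>) - N \<omega>"
      using simple_integral_increment[OF st(1) st'(1), of ?n ?r ?\<xi> \<omega>]
        step_int_diff[of s t ?n ?r ?\<xi> \<omega> "\<lambda>j \<omega>. ball_proj C (?\<xi> j \<omega>)"]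
      by (simp add: J_def N_def algebra_simps)
    also have "norm \<dots> \<le> norm (simple_integral W ?n ?r ?\<xi> t \<omega> - I t \<omega>) + norm (simple_integral W ?n ?r ?\<xi> s \<omega> - I s \<omega>) + norm (N \<omega>)"
      by (intro norm_triangle_le_diff add_mono norm_triangle_ineq4 order_refl)
    finally show ?thesis using N Et Es by linarith
  qed
  have lower: "c\<^sup>2 / 4 * (t - s) * prob (E - R) \<le> expectation (\<lambda>\<omega>. (p \<omega> \<bullet> J \<omega>)\<^sup>2)"
    if p: "p \<in> borel_measurable (F s)" "\<And>\<omega>. \<omega> \<in> space M \<Longrightarrow> norm (p \<omega>) \<le> P" and E: "E \<in> sets M"
      and HE: "\<And>\<omega> x. \<omega> \<in> E \<Longrightarrow> x \<in> {s<..t} \<Longrightarrow> norm (H x \<omega>) \<le> C \<and> c \<le> norm (transpose (H x \<omega>) *v p \<omega>)" for p E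
  proof -
    define q where "q \<omega> = (\<Sum>j<?n. ?d j * (norm (transpose (ball_proj C (?\<xi> j \<omega>)) *v p \<omega>))\<^sup>2)" for \<omega>
    note sq = step_int_square[where p = p, OF sfc st(1) st'(1) less_imp_le[OF pos(1)] p, folded q_def[abs_def] J_def]
    have q0: "0 \<le> q \<omega>" for \<omega> using sq(4)[of \<omega>] unfolding q_def .
    have qlow: "c\<^sup>2 / 4 * (t - s) \<le> q \<omega>" if w: "\<omega> \<in> E - R" for \<omega>
    proof -
      have wM: "\<omega> \<in> space M" using w E sets.sets_into_space by blast
      have ZR: "Z k \<omega> \<le> ennreal \<delta>" using w wM by (auto simp: R_def not_less)
      \<comment> \<open>A Borel function that agrees with the path of \<open>H\<close> on the
        window.\<close>
      define G where "G = (\<lambda>x. if x \<in> {0..t} then H x \<omega> else 0)"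
      have Gm [measurable]: "G \<in> borel_measurable borel"
        unfolding G_def by (rule prog_measurable_section[OF prog st'(2) wM])
      have GH: "G x = H x \<omega>" if "x \<in> {s<..t}" for x using that st by (auto simp: G_def)
      let ?\<psi> = "\<lambda>A :: real^'m^'d. (norm (transpose (ball_proj C A) *v p \<omega>))\<^sup>2"
      have Sm [measurable]: "(\<lambda>x. ?S x \<omega>) \<in> borel_measurable borel"
        unfolding simple_process_def by measurable
      have \<psi>m: "(\<lambda>x. ennreal (?\<psi> (?S x \<omega>)) * indicator {s<..t} x) \<in> borel_measurable lborel"
        and \<psi>i: "(\<integral>\<^sup>+x. ennreal (?\<psi> (?S x \<omega>)) * indicator {s<..t} x \<partial>lborel) = ennreal (q \<omega>)"
        unfolding q_def
        by (rule simple_process_integral[where \<psi> = ?\<psi>]; use rmono st' pos in \<open>simp add: ball_proj_id\<close>)+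
      \<comment> \<open>From c \<le> a + b and (a + b)^2 \<le> 2 a^2 + 2 b^2. Integrated over the
        window this gives c^2 (t - s) \<le> 2 q + 2 P^2 \<delta>, and by the choice of \<delta> the
        factor c^2/4 in the claim.\<close>
      have pt: "c\<^sup>2 \<le> 2 * ?\<psi> (?S x \<omega>) + 2 * P\<^sup>2 * (norm (?S x \<omega> - H x \<omega>))\<^sup>2" if x: "x \<in> {s<..t}" for x
      proof -
        have HC: "norm (H x \<omega>) \<le> C" "c \<le> norm (transpose (H x \<omega>) *v p \<omega>)" using HE[of \<omega> x] w x by auto
        let ?a = "norm (transpose (ball_proj C (?S x \<omega>)) *v p \<omega>)" and ?b = "P * norm (?S x \<omega> - H x \<omega>)"
        have "norm (transpose (H x \<omega>) *v p \<omega>) \<le> ?a + norm (transpose (ball_proj C (?S x \<omega>)) *v p \<omega> - transpose (H x \<omega>) *v p \<omega>)"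
          by (metis add.commute norm_minus_commute norm_triangle_sub)
        also have "norm (transpose (ball_proj C (?S x \<omega>)) *v p \<omega> - transpose (H x \<omega>) *v p \<omega>) \<le> norm (ball_proj C (?S x \<omega>) - H x \<omega>) * norm (p \<omega>)"
          unfolding transpose_mult_diff by (rule norm_transpose_mult_le)
        also have "\<dots> \<le> norm (?S x \<omega> - H x \<omega>) * P"
          using ball_proj_dist_le[OF pos(1) HC(1)] p(2)[OF wM] by (intro mult_mono) auto
        finally have "c \<le> ?a + ?b" using HC(2) by (simp add: mult.commute)
        then have "c\<^sup>2 \<le> (?a + ?b)\<^sup>2" using pos by (intro power_mono) auto
        also have "\<dots> \<le> 2 * ?a\<^sup>2 + 2 * ?b\<^sup>2"
          using sum_squares_bound[of ?a ?b] by (simp add: power2_sum)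
        finally show ?thesis by (simp add: power_mult_distrib)
      qed
      have "ennreal (c\<^sup>2 * (t - s)) = (\<integral>\<^sup>+x. ennreal (c\<^sup>2) * indicator {s<..t} x \<partial>lborel)"
        using st by (subst nn_integral_cmult_indicator) (auto simp: ennreal_mult)
      also have "\<dots> \<le> (\<integral>\<^sup>+x. 2 * (ennreal (?\<psi> (?S x \<omega>)) * indicator {s<..t} x) +
          ennreal (2 * P\<^sup>2) * (ennreal ((norm (?S x \<omega> - G x))\<^sup>2) * indicator {s<..t} x) \<partial>lborel)"
      proof (rule nn_integral_mono)
        fix x
        show "ennreal (c\<^sup>2) * indicator {s<..t} x \<le> 2 * (ennreal (?\<psi> (?S x \<omega>)) * indicator {s<..t} x) +
          ennreal (2 * P\<^sup>2) * (ennreal ((norm (?S x \<omega> - G x))\<^sup>2) * indicator {s<..t} x)"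
        proof (cases "x \<in> {s<..t}")
          case True
          have "ennreal (c\<^sup>2) \<le> ennreal (2 * ?\<psi> (?S x \<omega>) + 2 * P\<^sup>2 * (norm (?S x \<omega> - G x))\<^sup>2)"
            using pt[OF True] GH[OF True] by (intro ennreal_leI) simp
          also have "\<dots> = 2 * ennreal (?\<psi> (?S x \<omega>)) + ennreal (2 * P\<^sup>2) * ennreal ((norm (?S x \<omega> - G x))\<^sup>2)"
            by (simp add: ennreal_plus ennreal_mult)
          finally show ?thesis using True by simp
        qed simp
      qed
      also have "\<dots> = 2 * ennreal (q \<omega>) + ennreal (2 * P\<^sup>2) * (\<integral>\<^sup>+x. ennreal ((norm (?S x \<omega> - G x))\<^sup>2) * indicator {s<..t} x \<partial>lborel)"
      proof -
        have Bm: "(\<lambda>x. ennreal ((norm (?S x \<omega> - G x))\<^sup>2) * indicator {s<..t} x) \<in> borel_measurable lborel"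
          by measurable
        show ?thesis
          unfolding nn_integral_add[OF borel_measurable_times_ennreal[OF borel_measurable_const \<psi>m] borel_measurable_times_ennreal[OF borel_measurable_const Bm]]
            nn_integral_cmult[OF \<psi>m] nn_integral_cmult[OF Bm] \<psi>i ..
      qed
      also have "(\<integral>\<^sup>+x. ennreal ((norm (?S x \<omega> - G x))\<^sup>2) * indicator {s<..t} x \<partial>lborel) =
          (\<integral>\<^sup>+x. ennreal ((norm (?S x \<omega> - H x \<omega>))\<^sup>2) * indicator {s<..t} x \<partial>lborel)"
        using GH by (intro nn_integral_cong) (auto simp: indicator_def)
      also have "\<dots> \<le> ennreal \<delta>" using Zsub[of \<omega>] ZR by (rule order_trans)
      finally have "ennreal (c\<^sup>2 * (t - s)) \<le> 2 * ennreal (q \<omega>) + ennreal (2 * P\<^sup>2) * ennreal \<delta>"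
        by (meson add_left_mono dual_order.trans mult_left_mono zero_le)
      also have "\<dots> = ennreal (2 * q \<omega> + 2 * P\<^sup>2 * \<delta>)"
        using q0[of \<omega>] \<delta>(1) by (simp add: ennreal_plus ennreal_mult)
      finally have "c\<^sup>2 * (t - s) \<le> 2 * q \<omega> + 2 * P\<^sup>2 * \<delta>"
        using q0[of \<omega>] \<delta>(1) by (subst (asm) ennreal_le_iff) auto
      moreover have "2 * P\<^sup>2 * \<delta> \<le> c\<^sup>2 * (t - s) / 2"
        using \<delta>(2) pos by (simp add: field_simps)
      ultimately show ?thesis by simp
    qed
    have "c\<^sup>2 / 4 * (t - s) * prob (E - R) = expectation (\<lambda>\<omega>. c\<^sup>2 / 4 * (t - s) * indicator (E - R) \<omega>)"
      using E RM by simp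
    also have "\<dots> \<le> expectation q"
    proof (rule integral_mono)
      show "integrable M (\<lambda>\<omega>. c\<^sup>2 / 4 * (t - s) * indicator (E - R) \<omega>)"
        by (intro integrable_mult_right integrable_real_indicator) (use E RM in \<open>auto simp: less_top[symmetric]\<close>)
      show "integrable M q" by (rule sq(2))
      show "c\<^sup>2 / 4 * (t - s) * indicator (E - R) \<omega> \<le> q \<omega>" for \<omega>
        using qlow[of \<omega>] q0[of \<omega>] by (auto simp: indicator_def)
    qed
    also have "\<dots> = expectation (\<lambda>\<omega>. (p \<omega> \<bullet> J \<omega>)\<^sup>2)" using sq(3) by simp
    finally show ?thesis .
  qed
  have upper: "integrable M (\<lambda>\<omega>. (p \<omega> \<bullet> J \<omega>)\<^sup>2) \<and>
       expectation (\<lambda>\<omega>. (p \<omega> \<bullet> J \<omega>)\<^sup>2) \<le> C\<^sup>2 * (t - s) * expectation (\<lambda>\<omega>. (norm (p \<omega>))\<^sup>2)"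
    if p: "p \<in> borel_measurable (F s)" "\<And>\<omega>. \<omega> \<in> space M \<Longrightarrow> norm (p \<omega>) \<le> P" for p
  proof -
    define q where "q \<omega> = (\<Sum>j<?n. ?d j * (norm (transpose (ball_proj C (?\<xi> j \<omega>)) *v p \<omega>))\<^sup>2)" for \<omega>
    note sq = step_int_square[where p = p, OF sfc st(1) st'(1) less_imp_le[OF pos(1)] p, folded q_def[abs_def] J_def]
    have [measurable]: "p \<in> borel_measurable M" using p(1) st(1) by (rule measurable_F_M)
    have pi: "integrable M (\<lambda>\<omega>. (norm (p \<omega>))\<^sup>2)"
      by (rule integrable_const_bound[of _ "P\<^sup>2"]) (use p(2) in \<open>auto intro!: power_mono\<close>)
    have "expectation q \<le> expectation (\<lambda>\<omega>. C\<^sup>2 * (t - s) * (norm (p \<omega>))\<^sup>2)"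
    proof (rule integral_mono)
      show "q \<omega> \<le> C\<^sup>2 * (t - s) * (norm (p \<omega>))\<^sup>2" if "\<omega> \<in> space M" for \<omega>
        unfolding q_def by (rule sq(5)) (use that in auto)
    qed (use sq(2) pi in auto)
    then show ?thesis using sq(1,3) by simp
  qed
  have Jm: "J \<in> borel_measurable (F t)" unfolding J_def by (rule step_int_measurable[OF sfc st(1) st'(1)])
  have mean: "integrable M (\<lambda>\<omega>. Z \<omega> * J \<omega> $ k) \<and> expectation (\<lambda>\<omega>. Z \<omega> * J \<omega> $ k) = 0"
    if "Z \<in> borel_measurable (F s)" "integrable M Z" for Z k
    unfolding J_def using step_int_component_mean[OF sfc st(1) st'(1) less_imp_le[OF pos(1)] that] by blast
  note J4 = step_int_power4[OF sfc st(1) st'(1) less_imp_le[OF pos(1)], folded J_def]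
  have "step_approx s t C P c \<zeta> H I J R"
    unfolding step_approx_def using Jm RM Rp mean J4 close lower upper by blast
  then show ?thesis by blast
qed

end

section \<open>The quadratic test function on a time grid\<close>

text \<open>The test function \<open>v \<mapsto> v + \<lambda>/2 v\<^sup>2\<close>, increasing on \<open>[-1/\<lambda>, \<infinity>)\<close> and negative on
  \<open>(-2/\<lambda>, 0)\<close>. Here \<open>A m\<close> says that the grid point \<open>m\<close> is active and \<open>S m\<close> that activity has
  already started at or before \<open>m\<close>; activity stops for good at the first inactive point after the start.\<close>

lemma quadratic_telescope:
  fixes y :: "nat \<Rightarrow> real" and lam \<mu> :: real
  defines "f \<equiv> \<lambda>v. v + lam / 2 * v\<^sup>2"
  assumes lam: "0 < lam" and \<mu>: "0 \<le> \<mu>" "\<mu> \<le> 1 / lam"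
    and AS: "\<And>m. m \<le> n \<Longrightarrow> A m \<Longrightarrow> S m" "\<And>m. m < n \<Longrightarrow> S m \<Longrightarrow> S (Suc m)"
      "\<And>m. m < n \<Longrightarrow> S m \<Longrightarrow> A (Suc m) \<Longrightarrow> A m"
    and A: "\<And>m. m \<le> n \<Longrightarrow> A m \<Longrightarrow> - 1 / lam \<le> y m \<and> y m \<le> 0" "A 0 \<Longrightarrow> y 0 = 0"
    and start: "\<And>m. m < n \<Longrightarrow> \<not> S m \<Longrightarrow> A (Suc m) \<Longrightarrow> - \<mu> \<le> y (Suc m)"
    and step: "\<And>m. m < n \<Longrightarrow> A m \<Longrightarrow> \<bar>y (Suc m) - y m\<bar> \<le> \<mu>"
  shows "(\<Sum>i<n. if A i then f (y (Suc i)) - f (y i) else 0) \<le> 3 * \<mu>"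
proof -
  have flow: "v \<le> f v" for v using lam by (simp add: f_def)
  have fneg: "f v \<le> 0" if "- 2 / lam \<le> v" "v \<le> 0" for v
  proof -
    have "0 \<le> 1 + lam / 2 * v" using that(1) lam by (simp add: field_simps)
    then have "v * (1 + lam / 2 * v) \<le> 0" using that(2) by (simp add: mult_nonpos_nonneg)
    then show ?thesis by (simp add: f_def power2_eq_square algebra_simps)
  qed
  \<comment> \<open>For positive \<open>v\<close> the quadratic term is at most \<mu>/2, because
    both factors \<open>v\<close> are at most \<mu> and \<mu> is at most 1/lam.\<close>
  have fup: "f v \<le> 2 * \<mu>" if "- 2 / lam \<le> v" "v \<le> \<mu>" for v
  proof (cases "v \<le> 0")
    case True
    then show ?thesis using fneg[OF that(1)] \<mu> by linarith
  next
    case False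
    have "lam / 2 * v\<^sup>2 \<le> lam / 2 * (\<mu> * (1 / lam))"
      using False that \<mu> lam unfolding power2_eq_square by (intro mult_left_mono mult_mono) auto
    also have "\<dots> = \<mu> / 2" using lam by simp
    finally show ?thesis using that \<mu> by (simp add: f_def)
  qed
  \<comment> \<open>At the first active point \<open>y\<close> is at least -\<mu>, so the empty sum
    is at most \<open>f (y m) + \<mu>\<close>. This bound telescopes as long as activity lasts. The
    last active step can move \<open>y\<close> by at most \<mu>, so it ends in [-2/lam, \<mu>],
    where \<open>f\<close> is at most 2 \<mu>; from then on the sum is frozen below 3 \<mu>.\<close>
  have inv: "(\<not> S m \<longrightarrow> (\<Sum>i<m. if A i then f (y (Suc i)) - f (y i) else 0) = 0) \<and>
     (A m \<longrightarrow> (\<Sum>i<m. if A i then f (y (Suc i)) - f (y i) else 0) \<le> f (y m) + \<mu>) \<and>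
     (S m \<and> \<not> A m \<longrightarrow> (\<Sum>i<m. if A i then f (y (Suc i)) - f (y i) else 0) \<le> 3 * \<mu>)" if "m \<le> n" for m
    using that
  proof (induction m)
    case 0
    then show ?case using A(2) \<mu> by (auto simp: f_def)
  next
    case (Suc m)
    then have m: "m < n" "m \<le> n" "Suc m \<le> n" by auto
    let ?T = "\<lambda>m. \<Sum>i<m. if A i then f (y (Suc i)) - f (y i) else 0"
    note IH = Suc.IH[OF m(2)]
    show ?case
    proof (cases "S m")
      case False
      then have nA: "\<not> A m" using AS(1)[OF m(2)] by blast
      then have T0: "?T (Suc m) = 0" using IH False by simp
      have "0 \<le> f (y (Suc m)) + \<mu>" if "A (Suc m)"
        using start[OF m(1) False that] flow[of "y (Suc m)"] by linarith
      then show ?thesis using T0 \<mu> by simp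
    next
      case S: True
      then have S': "S (Suc m)" using AS(2)[OF m(1)] by blast
      show ?thesis
      proof (cases "A m")
        case True
        have le: "?T (Suc m) \<le> f (y (Suc m)) + \<mu>" using IH True by simp
        have "- 1 / lam \<le> y m" "y m \<le> 0" using A(1)[OF m(2) True] by auto
        moreover have "\<bar>y (Suc m) - y m\<bar> \<le> \<mu>" using step[OF m(1) True] .
        moreover have "- 2 / lam = - 1 / lam - 1 / lam" by simp
        ultimately have "- 2 / lam \<le> y (Suc m)" "y (Suc m) \<le> \<mu>" using \<mu> by linarith+
        then have "f (y (Suc m)) \<le> 2 * \<mu>" by (rule fup)
        then show ?thesis using le S' by auto
      next
        case False
        then have "\<not> A (Suc m)" using AS(3)[OF m(1) S] by blast
        then show ?thesis using IH False S S' by simp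
      qed
    qed
  qed
  consider "\<not> S n" | "A n" | "S n" "\<not> A n" by blast
  then show ?thesis
  proof cases
    case 2
    then have a: "- 1 / lam \<le> y n" "y n \<le> 0" using A(1)[of n] by auto
    have "- 2 / lam \<le> - 1 / lam" using lam by (simp add: field_simps)
    then have "f (y n) \<le> 0" using a by (intro fneg) linarith+
    then show ?thesis using inv[of n] 2 \<mu> by auto
  qed (use inv[of n] \<mu> in auto)
qed

text \<open>For a quadratic \<open>f\<close> the increment is exactly (1 + lam y) \<Delta> + lam/2
  \<Delta>^2 with \<Delta> = y' - y. The factor 1 + lam y lies in [0, 1], so drift and Taylor
  remainder cost a multiple of h + |J|^2 free of \<open>lam\<close>. The errors inside the square do
  carry \<open>lam\<close>, and the smallness conditions, met on a fine grid, absorb them.\<close>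

lemma quadratic_step:
  fixes p U J e :: "'v::real_inner" and lam K C P h \<delta> y y' :: real
  defines "f \<equiv> \<lambda>v. v + lam / 2 * v\<^sup>2"
  assumes pos: "0 < lam" "0 < K" "0 < C" "0 < P" "0 < h"
    and taylor: "\<bar>y' - y - p \<bullet> U\<bar> \<le> K * (h + (norm U)\<^sup>2)"
    and U: "U = J + e" "norm U \<le> \<delta>" "norm e \<le> 2 * C * h" and p: "norm p \<le> P"
    and y: "- 1 / lam \<le> y" "y \<le> 0"
    and small: "K * (h + \<delta>\<^sup>2) \<le> 2 / lam" "16 * C\<^sup>2 * h \<le> 1" "lam * P\<^sup>2 * C\<^sup>2 * h \<le> K"
  shows "(1 + lam * y) * (p \<bullet> J) - (2 * P * C + 4 * K) * h - 4 * K * (norm J)\<^sup>2 + lam / 8 * (p \<bullet> J)\<^sup>2 \<le> f y' - f y"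
proof -
  define \<rho> where "\<rho> = y' - y - p \<bullet> U"
  define q where "q = h + (norm U)\<^sup>2"
  have y1: "0 \<le> 1 + lam * y" "1 + lam * y \<le> 1"
    using y pos by (auto simp: field_simps mult_nonneg_nonpos)
  have q0: "0 \<le> q" using pos by (simp add: q_def)
  have \<rho>: "\<bar>\<rho>\<bar> \<le> K * q" using taylor by (simp add: \<rho>_def q_def)
  have "(norm U)\<^sup>2 \<le> \<delta>\<^sup>2" using U(2) by (intro power_mono) auto
  then have "K * q \<le> K * (h + \<delta>\<^sup>2)" using pos by (simp add: q_def)
  then have \<rho>2: "\<bar>\<rho>\<bar> \<le> 2 / lam" using \<rho> small(1) by linarith
  \<comment> \<open>One factor |\<rho>| is estimated by 2/lam, which cancels \<open>lam\<close>; the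
    other keeps the order of the remainder.\<close>
  have sq: "lam / 2 * \<rho>\<^sup>2 \<le> K * q"
  proof -
    have "\<rho>\<^sup>2 = \<bar>\<rho>\<bar> * \<bar>\<rho>\<bar>" by (simp add: power2_eq_square)
    also have "\<dots> \<le> (2 / lam) * (K * q)" using \<rho> \<rho>2 pos by (intro mult_mono) auto
    finally show ?thesis using pos by (simp add: field_simps)
  qed
  \<comment> \<open>Equivalent to (u + 2 w)^2 \<ge> 0. It is used twice, to split off the Taylor
    remainder and then the drift, which takes the coefficient lam/2 to lam/4 and to lam/8.\<close>
  have half: "u\<^sup>2 / 2 - w\<^sup>2 \<le> (u + w)\<^sup>2" for u w :: real
  proof -
    have "0 \<le> (u + 2 * w)\<^sup>2 / 2" by simp
    then show ?thesis by (simp add: power2_eq_square algebra_simps)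
  qed
  have v: "y' - y = p \<bullet> U + \<rho>" by (simp add: \<rho>_def)
  have "f y' - f y = (1 + lam * y) * (y' - y) + lam / 2 * (y' - y)\<^sup>2"
    by (simp add: f_def power2_eq_square algebra_simps)
  also have "\<dots> = (1 + lam * y) * (p \<bullet> U) + (1 + lam * y) * \<rho> + lam / 2 * (p \<bullet> U + \<rho>)\<^sup>2"
    unfolding v by (simp add: algebra_simps)
  finally have w: "f y' - f y = \<dots>" .
  have a1: "- (K * q) \<le> (1 + lam * y) * \<rho>"
  proof -
    have "\<bar>(1 + lam * y) * \<rho>\<bar> \<le> 1 * (K * q)"
      unfolding abs_mult using y1 \<rho> by (intro mult_mono) auto
    then show ?thesis by linarith
  qed
  have a2: "lam / 4 * (p \<bullet> U)\<^sup>2 - K * q \<le> lam / 2 * (p \<bullet> U + \<rho>)\<^sup>2"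
  proof -
    have "lam / 2 * ((p \<bullet> U)\<^sup>2 / 2 - \<rho>\<^sup>2) \<le> lam / 2 * (p \<bullet> U + \<rho>)\<^sup>2"
      using half pos by (intro mult_left_mono) auto
    then show ?thesis using sq by (simp add: algebra_simps)
  qed
  have pe: "\<bar>p \<bullet> e\<bar> \<le> 2 * P * C * h"
  proof -
    have "\<bar>p \<bullet> e\<bar> \<le> norm p * norm e" by (rule Cauchy_Schwarz_ineq2)
    also have "\<dots> \<le> P * (2 * C * h)" using p U(3) pos by (intro mult_mono) auto
    finally show ?thesis by (simp add: mult_ac)
  qed
  have a3: "(1 + lam * y) * (p \<bullet> J) - 2 * P * C * h \<le> (1 + lam * y) * (p \<bullet> U)"
  proof -
    have "\<bar>(1 + lam * y) * (p \<bullet> e)\<bar> \<le> 1 * (2 * P * C * h)"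
      unfolding abs_mult using y1 pe by (intro mult_mono) auto
    then show ?thesis unfolding U(1) inner_add_right distrib_left by linarith
  qed
  have a4: "lam / 8 * (p \<bullet> J)\<^sup>2 - K * h \<le> lam / 4 * (p \<bullet> U)\<^sup>2"
  proof -
    have "(p \<bullet> e)\<^sup>2 \<le> (2 * P * C * h)\<^sup>2"
      using pe by (metis abs_ge_zero power2_abs power_mono)
    then have "lam / 4 * (p \<bullet> e)\<^sup>2 \<le> lam / 4 * (2 * P * C * h)\<^sup>2" using pos by (intro mult_left_mono) auto
    also have "\<dots> = (lam * P\<^sup>2 * C\<^sup>2 * h) * h" by (simp add: power2_eq_square)
    also have "\<dots> \<le> K * h" using small(3) pos by (intro mult_right_mono) auto
    finally have 1: "lam / 4 * (p \<bullet> e)\<^sup>2 \<le> K * h" .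
    have "lam / 4 * ((p \<bullet> J)\<^sup>2 / 2 - (p \<bullet> e)\<^sup>2) \<le> lam / 4 * (p \<bullet> J + p \<bullet> e)\<^sup>2"
      using half pos by (intro mult_left_mono) auto
    then show ?thesis using 1 by (simp add: U(1) inner_add_right algebra_simps)
  qed
  \<comment> \<open>The two copies of \<open>K * q\<close> come from \<open>a1\<close> and
    \<open>a2\<close>. Together with \<open>K * h\<close> from \<open>a4\<close> and the drift term
    of \<open>a3\<close> they make up the constants 2 P C + 4 K and 4 K of the claim.\<close>
  have a5: "2 * (K * q) \<le> 3 * K * h + 4 * K * (norm J)\<^sup>2"
  proof -
    have "(norm U)\<^sup>2 \<le> (norm J + norm e)\<^sup>2"
      unfolding U(1) by (intro power_mono norm_triangle_ineq) auto
    also have "\<dots> \<le> 2 * (norm J)\<^sup>2 + 2 * (norm e)\<^sup>2"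
      using sum_squares_bound[of "norm J" "norm e"] by (simp add: power2_sum)
    finally have "(norm U)\<^sup>2 \<le> 2 * (norm J)\<^sup>2 + 2 * (2 * C * h)\<^sup>2"
      using power_mono[OF U(3) norm_ge_zero, of 2] by linarith
    also have "2 * (2 * C * h)\<^sup>2 = (16 * C\<^sup>2 * h) * (h / 2)" by (simp add: power2_eq_square)
    also have "\<dots> \<le> 1 * (h / 2)" using small(2) pos by (intro mult_right_mono) auto
    finally have "q \<le> 3 / 2 * h + 2 * (norm J)\<^sup>2" by (simp add: q_def)
    then have "2 * K * q \<le> 2 * K * (3 / 2 * h + 2 * (norm J)\<^sup>2)" using pos by (intro mult_left_mono) auto
    then show ?thesis by (simp add: algebra_simps)
  qed
  show ?thesis
  proof -
    have "(2 * P * C + 4 * K) * h = 2 * P * C * h + 4 * K * h" by (simp add: algebra_simps)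
    moreover have "4 * K * (norm J)\<^sup>2 = 4 * (K * (norm J)\<^sup>2)" by simp
    ultimately show ?thesis unfolding w using a1 a2 a3 a4 a5 by linarith
  qed
qed

context brownian
begin

text \<open>Expectations are taken in the pathwise inequality. The martingale part vanishes, and the
  remaining drift is at least \<open>h * prob (A i)\<close> up to a multiple of
  \<open>prob Bad\<close>. On \<open>Bad\<close> the sum has no pathwise bound. There x \<le>
  1/(2\<alpha>) + \<alpha>/2 x^2 is used: the first part is multiplied by \<open>prob Bad\<close>,
  the second is controlled by moments, and \<alpha> remains free to balance them.\<close>

lemma grid_bound:
  fixes J :: "nat \<Rightarrow> 'a \<Rightarrow> real^'d" and p :: "nat \<Rightarrow> 'a \<Rightarrow> real^'d" and a :: "nat \<Rightarrow> 'a \<Rightarrow> real" and C :: real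
  defines "K4 \<equiv> 9 * (real CARD('d))\<^sup>2 * (real CARD('m))\<^sup>2 * C ^ 4"
  assumes pos: "0 < h" "0 < C" "1 \<le> P" "0 < K" "0 < lam" "0 < \<alpha>" "0 \<le> \<mu>" "0 \<le> k1"
    and sa: "\<And>i. i < n \<Longrightarrow> step_approx (real i * h) (real (Suc i) * h) C P c0 \<zeta> H I (J i) (R i)"
    and A: "\<And>i. i < n \<Longrightarrow> A i \<in> sets (F (real i * h))"
    and p: "\<And>i. i < n \<Longrightarrow> p i \<in> borel_measurable (F (real i * h))"
      "\<And>i \<omega>. i < n \<Longrightarrow> \<omega> \<in> A i \<Longrightarrow> norm (p i \<omega>) \<le> P"
    and a: "\<And>i. i < n \<Longrightarrow> a i \<in> borel_measurable (F (real i * h))"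
      "\<And>i \<omega>. i < n \<Longrightarrow> \<omega> \<in> A i \<Longrightarrow> 0 \<le> a i \<omega> \<and> a i \<omega> \<le> 1"
    and Bad: "Bad \<in> sets M"
    and low: "\<And>i. i < n \<Longrightarrow> c * h * (prob (A i) - prob Bad) \<le> expectation (\<lambda>\<omega>. ((indicator (A i) \<omega> *\<^sub>R p i \<omega>) \<bullet> J i \<omega>)\<^sup>2)"
    and c: "0 \<le> c" "1 + k1 + 4 * K * real CARD('d) * C\<^sup>2 \<le> lam / 8 * c"
    and path: "\<And>\<omega>. \<omega> \<in> space M - Bad \<Longrightarrow>
       (\<Sum>i<n. indicator (A i) \<omega> * (a i \<omega> * (p i \<omega> \<bullet> J i \<omega>) - k1 * h - 4 * K * (norm (J i \<omega>))\<^sup>2 + lam / 8 * (p i \<omega> \<bullet> J i \<omega>)\<^sup>2)) \<le> 3 * \<mu>"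
  shows "h * (\<Sum>i<n. prob (A i)) \<le> 3 * \<mu> + \<alpha> * (P\<^sup>2 * C\<^sup>2 * (n * h) + (lam / 8 * P\<^sup>2)\<^sup>2 * K4 * (n * h)\<^sup>2) +
     prob Bad * (1 / (2 * \<alpha>) + lam / 8 * c * (n * h))"
proof -
  let ?F = "\<lambda>i. F (real i * h)"
  have K4: "0 \<le> K4" using pos by (simp add: K4_def)
  have dt: "real (Suc i) * h - real i * h = h" for i by (simp add: algebra_simps)
  note sau = sa[unfolded step_approx_def dt, folded K4_def]
  have Jm: "J i \<in> borel_measurable (F (real (Suc i) * h))"
    and J0: "\<And>Z k. Z \<in> borel_measurable (F (real i * h)) \<Longrightarrow> integrable M Z \<Longrightarrow>
       integrable M (\<lambda>\<omega>. Z \<omega> * J i \<omega> $ k) \<and> expectation (\<lambda>\<omega>. Z \<omega> * J i \<omega> $ k) = 0"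
    and J2: "\<And>q. q \<in> borel_measurable (F (real i * h)) \<Longrightarrow> (\<And>\<omega>. \<omega> \<in> space M \<Longrightarrow> norm (q \<omega>) \<le> P) \<Longrightarrow>
       integrable M (\<lambda>\<omega>. (q \<omega> \<bullet> J i \<omega>)\<^sup>2) \<and>
       expectation (\<lambda>\<omega>. (q \<omega> \<bullet> J i \<omega>)\<^sup>2) \<le> C\<^sup>2 * h * expectation (\<lambda>\<omega>. (norm (q \<omega>))\<^sup>2)"
    and J4: "integrable M (\<lambda>\<omega>. norm (J i \<omega>) ^ 4)" "expectation (\<lambda>\<omega>. norm (J i \<omega>) ^ 4) \<le> K4 * h\<^sup>2"
    if "i < n" for i
    using sau[OF that] by blast+
  have t0: "0 \<le> real i * h" for i using pos by simp
  have AM: "A i \<in> sets M" if "i < n" for i using A[OF that] sets_F_M[OF t0] by blast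
  \<comment> \<open>The bounds for \<open>p\<close> and \<open>a\<close> hold on \<open>A i\<close>
    only; multiplying by its indicator gives test vectors that are bounded everywhere and still
    known at the left end of the step.\<close>
  define pp where "pp i \<omega> = indicator (A i) \<omega> *\<^sub>R p i \<omega>" for i \<omega>
  define pa where "pa i \<omega> = (indicator (A i) \<omega> * a i \<omega>) *\<^sub>R p i \<omega>" for i \<omega>
  have indm: "(\<lambda>\<omega>. indicator (A i) \<omega> :: real) \<in> borel_measurable (?F i)" if "i < n" for i
    using A[OF that] by simp
  have ppm: "pp i \<in> borel_measurable (?F i)" and pam: "pa i \<in> borel_measurable (?F i)" if "i < n" for i
    unfolding pp_def[abs_def] pa_def[abs_def]
    using indm[OF that] p(1)[OF that] a(1)[OF that] by (auto intro!: borel_measurable_scaleR borel_measurable_times)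
  have ppb: "norm (pp i \<omega>) \<le> P" and pab: "norm (pa i \<omega>) \<le> P" if "i < n" for i \<omega>
  proof -
    show "norm (pp i \<omega>) \<le> P"
      using p(2)[OF that] pos by (auto simp: pp_def indicator_def)
    show "norm (pa i \<omega>) \<le> P"
    proof (cases "\<omega> \<in> A i")
      case True
      have "\<bar>a i \<omega>\<bar> * norm (p i \<omega>) \<le> 1 * P"
        using p(2)[OF that True] a(2)[OF that True] by (intro mult_mono) auto
      then show ?thesis using True by (simp add: pa_def)
    qed (use pos in \<open>simp add: pa_def\<close>)
  qed
  have JM [measurable]: "J i \<in> borel_measurable M" if "i < n" for i
    using Jm[OF that] t0 by (rule measurable_F_M)
  have inner0: "integrable M (\<lambda>\<omega>. Z \<omega> * (pa i \<omega> \<bullet> J i \<omega>)) \<and> expectation (\<lambda>\<omega>. Z \<omega> * (pa i \<omega> \<bullet> J i \<omega>)) = 0"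
    if i: "i < n" and Z: "Z \<in> borel_measurable (?F i)" "integrable M Z" for i Z
  proof -
    have eq: "Z \<omega> * (pa i \<omega> \<bullet> J i \<omega>) = (\<Sum>k\<in>UNIV. (Z \<omega> * pa i \<omega> $ k) * J i \<omega> $ k)" for \<omega>
      by (simp add: inner_vec_def sum_distrib_left mult.assoc)
    have Zp: "(\<lambda>\<omega>. Z \<omega> * pa i \<omega> $ k) \<in> borel_measurable (?F i)" "integrable M (\<lambda>\<omega>. Z \<omega> * pa i \<omega> $ k)" for k
    proof -
      show m: "(\<lambda>\<omega>. Z \<omega> * pa i \<omega> $ k) \<in> borel_measurable (?F i)"
        using Z(1) measurable_compose[OF pam[OF i] borel_measurable_vec_component] by (rule borel_measurable_times)
      show "integrable M (\<lambda>\<omega>. Z \<omega> * pa i \<omega> $ k)"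
      proof (rule Bochner_Integration.integrable_bound[of _ "\<lambda>\<omega>. P * Z \<omega>"])
        show "(\<lambda>\<omega>. Z \<omega> * pa i \<omega> $ k) \<in> borel_measurable M" using m t0 by (rule measurable_F_M)
        have "\<bar>Z \<omega>\<bar> * \<bar>pa i \<omega> $ k\<bar> \<le> P * \<bar>Z \<omega>\<bar>" for \<omega>
          using component_le_norm_cart[of "pa i \<omega>" k] pab[OF i, of \<omega>]
          by (subst mult.commute) (intro mult_right_mono, auto)
        then show "AE \<omega> in M. norm (Z \<omega> * pa i \<omega> $ k) \<le> norm (P * Z \<omega>)"
          using pos by (simp add: abs_mult)
      qed (use Z in auto)
    qed
    show ?thesis
      unfolding eq using J0[OF i Zp] by (simp add: Bochner_Integration.integral_sum Bochner_Integration.integrable_sum)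
  qed
  \<comment> \<open>The martingale part of the sum. Its increments are orthogonal, so its second
    moment grows at most linearly in time.\<close>
  define Mk where "Mk k \<omega> = (\<Sum>i<k. pa i \<omega> \<bullet> J i \<omega>)" for k \<omega>
  have pa2: "integrable M (\<lambda>\<omega>. (pa i \<omega> \<bullet> J i \<omega>)\<^sup>2)" "expectation (\<lambda>\<omega>. (pa i \<omega> \<bullet> J i \<omega>)\<^sup>2) \<le> P\<^sup>2 * C\<^sup>2 * h"
    if i: "i < n" for i
  proof -
    note B = J2[of i "pa i", OF i pam[OF i] pab[OF i]]
    show "integrable M (\<lambda>\<omega>. (pa i \<omega> \<bullet> J i \<omega>)\<^sup>2)" using B by blast
    have m [measurable]: "pa i \<in> borel_measurable M" using pam[OF i] t0 by (rule measurable_F_M)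
    have le: "(norm (pa i \<omega>))\<^sup>2 \<le> P\<^sup>2" for \<omega> using pab[OF i] by (intro power_mono) auto
    have "expectation (\<lambda>\<omega>. (norm (pa i \<omega>))\<^sup>2) \<le> expectation (\<lambda>_. P\<^sup>2)"
      by (intro integral_mono integrable_const_bound[of _ "P\<^sup>2"]) (use le in auto)
    then have "C\<^sup>2 * h * expectation (\<lambda>\<omega>. (norm (pa i \<omega>))\<^sup>2) \<le> C\<^sup>2 * h * P\<^sup>2"
      using pos by (intro mult_left_mono) (auto simp: prob_space)
    then show "expectation (\<lambda>\<omega>. (pa i \<omega> \<bullet> J i \<omega>)\<^sup>2) \<le> P\<^sup>2 * C\<^sup>2 * h"
      using B by (simp add: mult_ac)
  qed
  have Mkm: "Mk k \<in> borel_measurable (?F k)" if "k \<le> n" for k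
    unfolding Mk_def[abs_def]
  proof (intro borel_measurable_sum borel_measurable_inner)
    fix i assume "i \<in> {..<k}"
    then have i: "i < n" "i \<le> k" "Suc i \<le> k" using that by auto
    show "pa i \<in> borel_measurable (?F k)"
      using pos i by (intro measurable_F_mono[OF pam]) (auto intro!: mult_right_mono)
    have "real (Suc i) * h \<le> real k * h" using pos i(3) by (intro mult_right_mono) (auto simp del: of_nat_Suc)
    then show "J i \<in> borel_measurable (?F k)" by (rule measurable_F_mono[OF Jm[OF i(1)]])
  qed
  have Mk2: "integrable M (\<lambda>\<omega>. (Mk k \<omega>)\<^sup>2) \<and> expectation (\<lambda>\<omega>. (Mk k \<omega>)\<^sup>2) \<le> P\<^sup>2 * C\<^sup>2 * (k * h)" if "k \<le> n" for k
    using that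
  proof (induction k)
    case (Suc k)
    then have k: "k < n" "k \<le> n" by auto
    have IH: "integrable M (\<lambda>\<omega>. (Mk k \<omega>)\<^sup>2)" "expectation (\<lambda>\<omega>. (Mk k \<omega>)\<^sup>2) \<le> P\<^sup>2 * C\<^sup>2 * (k * h)"
      using Suc.IH[OF k(2)] by auto
    have [measurable]: "Mk k \<in> borel_measurable M" using Mkm[OF k(2)] t0 by (rule measurable_F_M)
    have Mi: "integrable M (Mk k)" by (rule square_integrable_imp_integrable) (use IH in auto)
    have Z0: "integrable M (\<lambda>\<omega>. Mk k \<omega> * (pa k \<omega> \<bullet> J k \<omega>))" "expectation (\<lambda>\<omega>. Mk k \<omega> * (pa k \<omega> \<bullet> J k \<omega>)) = 0"
      using inner0[OF k(1) Mkm[OF k(2)] Mi] by auto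
    have eq: "(Mk (Suc k) \<omega>)\<^sup>2 = (Mk k \<omega>)\<^sup>2 + (2 * (Mk k \<omega> * (pa k \<omega> \<bullet> J k \<omega>)) + (pa k \<omega> \<bullet> J k \<omega>)\<^sup>2)" for \<omega>
      by (simp add: Mk_def power2_sum)
    have "integrable M (\<lambda>\<omega>. (Mk (Suc k) \<omega>)\<^sup>2)"
      unfolding eq using IH Z0 pa2[OF k(1)] by (intro Bochner_Integration.integrable_add integrable_mult_right)
    moreover have "expectation (\<lambda>\<omega>. (Mk (Suc k) \<omega>)\<^sup>2) = expectation (\<lambda>\<omega>. (Mk k \<omega>)\<^sup>2) + expectation (\<lambda>\<omega>. (pa k \<omega> \<bullet> J k \<omega>)\<^sup>2)"
      unfolding eq using IH(1) Z0 pa2(1)[OF k(1)] by simp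
    ultimately show ?case using IH(2) pa2(2)[OF k(1)] by (simp add: algebra_simps)
  qed (simp add: Mk_def)
  have nJ: "integrable M (\<lambda>\<omega>. indicator (A i) \<omega> * (norm (J i \<omega>))\<^sup>2)"
    "expectation (\<lambda>\<omega>. indicator (A i) \<omega> * (norm (J i \<omega>))\<^sup>2) \<le> real CARD('d) * C\<^sup>2 * h * prob (A i)" if i: "i < n" for i
  proof -
    \<comment> \<open>The axis vectors, switched on by \<open>A i\<close>, are themselves test
      vectors; this is where \<open>1 \<le> P\<close> is used. They bound the second moment of
      \<open>J i\<close> on \<open>A i\<close>.\<close>
    define q where "q k \<omega> = indicator (A i) \<omega> *\<^sub>R (axis k 1 :: real^'d)" for k \<omega>
    have qm: "q k \<in> borel_measurable (?F i)" for k
      unfolding q_def[abs_def] by (intro borel_measurable_scaleR indm[OF i] borel_measurable_const)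
    have qb: "norm (q k \<omega>) \<le> P" for k \<omega> using pos by (auto simp: q_def indicator_def norm_axis_1)
    have qn: "(norm (q k \<omega>))\<^sup>2 = indicator (A i) \<omega>" for k \<omega> by (auto simp: q_def indicator_def norm_axis_1)
    have B: "integrable M (\<lambda>\<omega>. (q k \<omega> \<bullet> J i \<omega>)\<^sup>2)" "expectation (\<lambda>\<omega>. (q k \<omega> \<bullet> J i \<omega>)\<^sup>2) \<le> C\<^sup>2 * h * prob (A i)" for k
      using J2[of i "q k", OF i qm qb] AM[OF i] by (auto simp: qn)
    have eq: "indicator (A i) \<omega> * (norm (J i \<omega>))\<^sup>2 = (\<Sum>k\<in>UNIV. (q k \<omega> \<bullet> J i \<omega>)\<^sup>2)" for \<omega>
      by (auto simp: q_def indicator_def norm_vec_def L2_set_def sum_nonneg inner_axis')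
    show "integrable M (\<lambda>\<omega>. indicator (A i) \<omega> * (norm (J i \<omega>))\<^sup>2)"
      unfolding eq using B by (intro Bochner_Integration.integrable_sum)
    have "expectation (\<lambda>\<omega>. indicator (A i) \<omega> * (norm (J i \<omega>))\<^sup>2) = (\<Sum>k\<in>UNIV. expectation (\<lambda>\<omega>. (q k \<omega> \<bullet> J i \<omega>)\<^sup>2))"
      unfolding eq using B by (subst Bochner_Integration.integral_sum) auto
    also have "\<dots> \<le> (\<Sum>k\<in>(UNIV :: 'd set). C\<^sup>2 * h * prob (A i))" using B by (intro sum_mono)
    finally show "expectation (\<lambda>\<omega>. indicator (A i) \<omega> * (norm (J i \<omega>))\<^sup>2) \<le> real CARD('d) * C\<^sup>2 * h * prob (A i)"
      by (simp add: mult_ac)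
  qed
  have pp2: "integrable M (\<lambda>\<omega>. (pp i \<omega> \<bullet> J i \<omega>)\<^sup>2)" if "i < n" for i
    using J2[of i "pp i", OF that ppm[OF that] ppb[OF that]] by blast
  have pa1: "integrable M (\<lambda>\<omega>. pa i \<omega> \<bullet> J i \<omega>)" "expectation (\<lambda>\<omega>. pa i \<omega> \<bullet> J i \<omega>) = 0" if "i < n" for i
    using inner0[of i "\<lambda>_. 1", OF that borel_measurable_const integrable_const] unfolding mult_1 by blast+
  let ?t = "\<lambda>i \<omega>. (pa i \<omega> \<bullet> J i \<omega>) - k1 * h * indicator (A i) \<omega> - 4 * K * (indicator (A i) \<omega> * (norm (J i \<omega>))\<^sup>2) + lam / 8 * (pp i \<omega> \<bullet> J i \<omega>)\<^sup>2"
  have indi: "integrable M (\<lambda>\<omega>. indicator (A i) \<omega> :: real)" if "i < n" for i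
    using AM[OF that] by (intro integrable_real_indicator) (auto simp: less_top[symmetric])
  have ti: "integrable M (?t i)" if "i < n" for i
    using pa1[OF that] indi[OF that] nJ(1)[OF that] pp2[OF that]
    by (intro Bochner_Integration.integrable_add Bochner_Integration.integrable_diff integrable_mult_right)
  \<comment> \<open>Here the size of \<open>lam\<close> enters: by \<open>c(2)\<close> the quadratic
    variation outweighs the drift and remainder terms and leaves a surplus \<open>h\<close> on
    \<open>A i\<close>. The deficit of the lower bound \<open>low\<close> is the multiple of
    \<open>prob Bad\<close>.\<close>
  have tE: "h * prob (A i) - lam / 8 * c * h * prob Bad \<le> expectation (?t i)" if i: "i < n" for i
  proof -
    have "expectation (?t i) = - k1 * h * prob (A i) - 4 * K * expectation (\<lambda>\<omega>. indicator (A i) \<omega> * (norm (J i \<omega>))\<^sup>2) + lam / 8 * expectation (\<lambda>\<omega>. (pp i \<omega> \<bullet> J i \<omega>)\<^sup>2)"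
      using pa1[OF i] indi[OF i] nJ(1)[OF i] pp2[OF i] AM[OF i] by simp
    moreover have "4 * K * expectation (\<lambda>\<omega>. indicator (A i) \<omega> * (norm (J i \<omega>))\<^sup>2) \<le> 4 * K * (real CARD('d) * C\<^sup>2 * h * prob (A i))"
      using nJ(2)[OF i] pos by (intro mult_left_mono) auto
    moreover have "lam / 8 * (c * h * (prob (A i) - prob Bad)) \<le> lam / 8 * expectation (\<lambda>\<omega>. (pp i \<omega> \<bullet> J i \<omega>)\<^sup>2)"
      using low[OF i] pos unfolding pp_def by (intro mult_left_mono) auto
    moreover have "(1 + k1 + 4 * K * real CARD('d) * C\<^sup>2) * (h * prob (A i)) \<le> lam / 8 * c * (h * prob (A i))"
      using c(2) pos by (intro mult_right_mono) auto
    ultimately show ?thesis by (simp add: algebra_simps)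
  qed
  \<comment> \<open>A majorant for all paths: 3 \<mu> is the bound off \<open>Bad\<close>, the
    indicator carries the constant on \<open>Bad\<close>, and the last two terms are the squares of
    the martingale part and of the sum of the squared norms, the latter after
    Cauchy-Schwarz.\<close>
  let ?V = "\<lambda>\<omega>. 3 * \<mu> + 1 / (2 * \<alpha>) * indicator Bad \<omega> + \<alpha> * (Mk n \<omega>)\<^sup>2 + \<alpha> * (lam / 8 * P\<^sup>2)\<^sup>2 * (real n * (\<Sum>i<n. norm (J i \<omega>) ^ 4))"
  have Vi: "integrable M ?V"
    using Mk2[of n] J4(1) Bad
    by (intro Bochner_Integration.integrable_add integrable_mult_right Bochner_Integration.integrable_sum
        integrable_real_indicator integrable_const) (auto simp: less_top[symmetric])
  have V: "(\<Sum>i<n. ?t i \<omega>) \<le> ?V \<omega>" if w: "\<omega> \<in> space M" for \<omega>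
  proof (cases "\<omega> \<in> Bad")
    case False
    have "(\<Sum>i<n. ?t i \<omega>) = (\<Sum>i<n. indicator (A i) \<omega> * (a i \<omega> * (p i \<omega> \<bullet> J i \<omega>) - k1 * h - 4 * K * (norm (J i \<omega>))\<^sup>2 + lam / 8 * (p i \<omega> \<bullet> J i \<omega>)\<^sup>2))"
      by (intro sum.cong) (auto simp: pa_def pp_def indicator_def)
    also have "\<dots> \<le> 3 * \<mu>" using path[of \<omega>] w False by blast
    also have "\<dots> \<le> ?V \<omega>"
      using pos False by (auto intro!: add_nonneg_nonneg mult_nonneg_nonneg sum_nonneg)
    finally show ?thesis .
  next
    case True
    let ?s = "lam / 8 * P\<^sup>2 * (\<Sum>i<n. (norm (J i \<omega>))\<^sup>2)"
    have "(\<Sum>i<n. ?t i \<omega>) \<le> (\<Sum>i<n. (pa i \<omega> \<bullet> J i \<omega>) + lam / 8 * P\<^sup>2 * (norm (J i \<omega>))\<^sup>2)"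
    proof (rule sum_mono)
      fix i assume "i \<in> {..<n}"
      then have i: "i < n" by simp
      have "\<bar>pp i \<omega> \<bullet> J i \<omega>\<bar> \<le> norm (pp i \<omega>) * norm (J i \<omega>)" by (rule Cauchy_Schwarz_ineq2)
      also have "\<dots> \<le> P * norm (J i \<omega>)" using ppb[OF i] by (intro mult_right_mono) auto
      finally have "(pp i \<omega> \<bullet> J i \<omega>)\<^sup>2 \<le> (P * norm (J i \<omega>))\<^sup>2"
        by (metis abs_ge_zero power2_abs power_mono)
      then have "lam / 8 * (pp i \<omega> \<bullet> J i \<omega>)\<^sup>2 \<le> lam / 8 * (P\<^sup>2 * (norm (J i \<omega>))\<^sup>2)"
        using pos by (intro mult_left_mono) (auto simp: power_mult_distrib)
      moreover have "0 \<le> k1 * h * indicator (A i) \<omega>" "0 \<le> 4 * K * (indicator (A i) \<omega> * (norm (J i \<omega>))\<^sup>2)"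
        using pos by auto
      ultimately show "?t i \<omega> \<le> (pa i \<omega> \<bullet> J i \<omega>) + lam / 8 * P\<^sup>2 * (norm (J i \<omega>))\<^sup>2" by linarith
    qed
    also have "\<dots> = Mk n \<omega> + ?s" by (simp add: Mk_def sum.distrib sum_distrib_left)
    \<comment> \<open>Young's inequality separates the indicator of \<open>Bad\<close> from the
      unbounded sum, so that no moment restricted to \<open>Bad\<close> has to be estimated.\<close>
    also have "\<dots> \<le> 1 / (2 * \<alpha>) + \<alpha> / 2 * (Mk n \<omega> + ?s)\<^sup>2"
    proof -
      have "0 \<le> (\<alpha> * (Mk n \<omega> + ?s) - 1)\<^sup>2" by simp
      then have "2 * \<alpha> * (Mk n \<omega> + ?s) \<le> \<alpha>\<^sup>2 * (Mk n \<omega> + ?s)\<^sup>2 + 1"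
        by (simp only: power2_diff power_mult_distrib) simp
      then show ?thesis using pos by (simp add: field_simps power2_eq_square)
    qed
    also have "(Mk n \<omega> + ?s)\<^sup>2 \<le> 2 * (Mk n \<omega>)\<^sup>2 + 2 * ?s\<^sup>2"
      using sum_squares_bound[of "Mk n \<omega>" ?s] by (simp only: power2_sum)
    also have "?s\<^sup>2 \<le> (lam / 8 * P\<^sup>2)\<^sup>2 * (real n * (\<Sum>i<n. norm (J i \<omega>) ^ 4))"
    proof -
      have "(\<Sum>i<n. 1 * (norm (J i \<omega>))\<^sup>2)\<^sup>2 \<le> (\<Sum>i<n. 1\<^sup>2) * (\<Sum>i<n. ((norm (J i \<omega>))\<^sup>2)\<^sup>2)"
        by (rule Cauchy_Schwarz_ineq_sum)
      then show ?thesis unfolding power_mult_distrib[of "lam / 8 * P\<^sup>2"] by (intro mult_left_mono) auto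
    qed
    finally have "(\<Sum>i<n. ?t i \<omega>) \<le> 1 / (2 * \<alpha>) + \<alpha> / 2 * (2 * (Mk n \<omega>)\<^sup>2 + 2 * ((lam / 8 * P\<^sup>2)\<^sup>2 * (real n * (\<Sum>i<n. norm (J i \<omega>) ^ 4))))"
      using pos by simp
    also have "\<dots> = 1 / (2 * \<alpha>) + \<alpha> * (Mk n \<omega>)\<^sup>2 + \<alpha> * (lam / 8 * P\<^sup>2)\<^sup>2 * (real n * (\<Sum>i<n. norm (J i \<omega>) ^ 4))"
      by (simp add: algebra_simps)
    finally show ?thesis using True pos by simp
  qed
  have "(\<Sum>i<n. h * prob (A i) - lam / 8 * c * h * prob Bad) \<le> (\<Sum>i<n. expectation (?t i))"
    using tE by (intro sum_mono) auto
  also have "\<dots> = expectation (\<lambda>\<omega>. \<Sum>i<n. ?t i \<omega>)"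
    using ti by (intro Bochner_Integration.integral_sum[symmetric]) auto
  also have "\<dots> \<le> expectation ?V"
    using ti by (intro integral_mono Bochner_Integration.integrable_sum Vi V) auto
  also have "\<dots> = 3 * \<mu> + 1 / (2 * \<alpha>) * prob Bad + \<alpha> * expectation (\<lambda>\<omega>. (Mk n \<omega>)\<^sup>2) +
      \<alpha> * (lam / 8 * P\<^sup>2)\<^sup>2 * (real n * (\<Sum>i<n. expectation (\<lambda>\<omega>. norm (J i \<omega>) ^ 4)))"
  proof -
    have S4: "integrable M (\<lambda>\<omega>. \<Sum>i<n. norm (J i \<omega>) ^ 4)"
      "expectation (\<lambda>\<omega>. \<Sum>i<n. norm (J i \<omega>) ^ 4) = (\<Sum>i<n. expectation (\<lambda>\<omega>. norm (J i \<omega>) ^ 4))"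
      using J4(1) by (auto intro!: Bochner_Integration.integrable_sum Bochner_Integration.integral_sum)
    have iB: "integrable M (\<lambda>\<omega>. indicator Bad \<omega> :: real)"
      using Bad by (intro integrable_real_indicator) (auto simp: less_top[symmetric])
    have M2: "integrable M (\<lambda>\<omega>. (Mk n \<omega>)\<^sup>2)" using Mk2[of n] by simp
    have c1: "integrable M (\<lambda>_. 3 * \<mu>)" by simp
    have i1: "integrable M (\<lambda>\<omega>. 1 / (2 * \<alpha>) * indicator Bad \<omega>)" using iB by (rule integrable_mult_right)
    have i2: "integrable M (\<lambda>\<omega>. \<alpha> * (Mk n \<omega>)\<^sup>2)" using M2 by (rule integrable_mult_right)
    have i3: "integrable M (\<lambda>\<omega>. \<alpha> * (lam / 8 * P\<^sup>2)\<^sup>2 * (real n * (\<Sum>i<n. norm (J i \<omega>) ^ 4)))"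
      using S4(1) by (intro integrable_mult_right)
    have e1: "expectation (\<lambda>\<omega>. 1 / (2 * \<alpha>) * indicator Bad \<omega>) = 1 / (2 * \<alpha>) * prob Bad" using Bad by simp
    have e3: "expectation (\<lambda>\<omega>. \<alpha> * (lam / 8 * P\<^sup>2)\<^sup>2 * (real n * (\<Sum>i<n. norm (J i \<omega>) ^ 4))) =
       \<alpha> * (lam / 8 * P\<^sup>2)\<^sup>2 * (real n * (\<Sum>i<n. expectation (\<lambda>\<omega>. norm (J i \<omega>) ^ 4)))"
      by (simp only: integral_mult_right_zero S4(2))
    show ?thesis
      by (simp only: Bochner_Integration.integral_add[OF Bochner_Integration.integrable_add[OF Bochner_Integration.integrable_add[OF c1 i1] i2] i3]
          Bochner_Integration.integral_add[OF Bochner_Integration.integrable_add[OF c1 i1] i2]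
          Bochner_Integration.integral_add[OF c1 i1] e1 e3 integral_mult_right_zero) (simp add: prob_space S4(2) sets.Int_space_eq2[OF Bad])
  qed
  also have "\<dots> \<le> 3 * \<mu> + 1 / (2 * \<alpha>) * prob Bad + \<alpha> * (P\<^sup>2 * C\<^sup>2 * (n * h)) +
      \<alpha> * (lam / 8 * P\<^sup>2)\<^sup>2 * (real n * (\<Sum>i<n. K4 * h\<^sup>2))"
    using Mk2[of n] J4(2) pos K4 by (intro add_mono mult_left_mono sum_mono order_refl) auto
  finally show ?thesis
    by (simp add: sum_subtractf sum_distrib_left[symmetric] power2_eq_square algebra_simps)
qed

end

section \<open>Application to the process: oscillation on a grid and expected active time\<close>

lemma norm_set_integral_le:
  fixes f :: "real \<Rightarrow> real^'d"
  assumes int: "set_integrable lborel {0..t} f" and st: "0 \<le> s" "s \<le> t"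
    and C: "\<And>r. r \<in> {s<..t} \<Longrightarrow> norm (f r) \<le> C"
  shows "norm ((LINT r:{0..t}|lborel. f r) - (LINT r:{0..s}|lborel. f r)) \<le> C * (t - s)"
proof -
  have i1: "set_integrable lborel {0..s} f" and i2: "set_integrable lborel {s<..t} f"
    using st by (auto intro: set_integrable_subset[OF int])
  have un: "{0..t} = {0..s} \<union> {s<..t}" using st by auto
  have "(LINT r:{0..t}|lborel. f r) = (LINT r:{0..s}|lborel. f r) + (LINT r:{s<..t}|lborel. f r)"
    unfolding un by (rule set_integral_Un[OF _ i1 i2]) auto
  then have "norm ((LINT r:{0..t}|lborel. f r) - (LINT r:{0..s}|lborel. f r)) = norm (LINT r:{s<..t}|lborel. f r)"
    by simp
  also have "\<dots> \<le> (LINT r|lborel. indicator {s<..t} r * C)"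
    unfolding set_lebesgue_integral_def
  proof (rule order_trans[OF integral_norm_bound integral_mono])
    show "integrable lborel (\<lambda>r. norm (indicat_real {s<..t} r *\<^sub>R f r))"
      using i2 unfolding set_integrable_def by (rule integrable_norm)
    show "integrable lborel (\<lambda>r. indicat_real {s<..t} r * C)"
      using st by (intro integrable_mult_left integrable_real_indicator) auto
    show "norm (indicat_real {s<..t} r *\<^sub>R f r) \<le> indicat_real {s<..t} r * C" for r
      using C by (auto simp: indicator_def)
  qed
  also have "\<dots> = C * (t - s)" using st by simp
  finally show ?thesis .
qed

context brownian
begin

text \<open>Every path is uniformly continuous on \<open>{0..T}\<close>, so for each path the bad
  event fails to occur on all fine grids; dominated convergence applied to the indicators does the
  rest.\<close>

lemma oscillation_prob:
  fixes X :: "real \<Rightarrow> 'a \<Rightarrow> real^'d"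
  assumes ad: "adapted F X" and cont: "\<And>\<omega>. \<omega> \<in> space M \<Longrightarrow> continuous_on {0..} (\<lambda>t. X t \<omega>)"
    and pos: "0 < T" "0 < \<delta>" "0 < e"
  defines "D \<equiv> \<lambda>n i. {\<omega>\<in>space M. \<forall>r\<in>{real i * (T / real n)..real (Suc i) * (T / real n)}.
      norm (X r \<omega> - X (real i * (T / real n)) \<omega>) \<le> \<delta>}"
  shows "D n i \<in> sets M" and "\<forall>\<^sub>F n in sequentially. prob (\<Union>i<n. space M - D n i) < e"
proof -
  have Xm: "X t \<in> borel_measurable M" if "0 \<le> t" for t
    by (rule measurable_F_M[of _ t]) (use ad that in \<open>auto simp: adapted_def\<close>)
  show DM: "D n i \<in> sets M" for n i
    unfolding D_def
  proof (rule sets_Collect_ball_interval)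
    have le: "real i * (T / real n) \<le> real (Suc i) * (T / real n)"
      using pos by (intro mult_right_mono) auto
    have t0: "0 \<le> real i * (T / real n)" using pos by auto
    show "real i * (T / real n) \<le> real (Suc i) * (T / real n)" by (rule le)
    show "(\<lambda>\<omega>. norm (X r \<omega> - X (real i * (T / real n)) \<omega>)) \<in> borel_measurable M"
      if "r \<in> {real i * (T / real n)..real (Suc i) * (T / real n)}" for r
    proof -
      have [measurable]: "X r \<in> borel_measurable M" "X (real i * (T / real n)) \<in> borel_measurable M"
        using that t0 by (auto intro: Xm)
      show ?thesis by measurable
    qed
    show "continuous_on {real i * (T / real n)..real (Suc i) * (T / real n)} (\<lambda>r. norm (X r \<omega> - X (real i * (T / real n)) \<omega>))"
      if "\<omega> \<in> space M" for \<omega>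
      by (intro continuous_intros continuous_on_subset[OF cont[OF that]]) (use t0 in auto)
  qed
  let ?B = "\<lambda>n. \<Union>i<n. space M - D n i"
  have BM: "?B n \<in> sets M" for n by (intro sets.finite_UN sets.compl_sets DM) simp
  have "(\<lambda>n. expectation (indicat_real (?B n))) \<longlonglongrightarrow> expectation (\<lambda>_. 0)"
  proof (rule integral_dominated_convergence[where w = "\<lambda>_. 1"])
    show "AE \<omega> in M. (\<lambda>n. indicat_real (?B n) \<omega>) \<longlonglongrightarrow> 0"
    proof (rule AE_I2)
      fix \<omega> assume w: "\<omega> \<in> space M"
      have "uniformly_continuous_on {0..T} (\<lambda>t. X t \<omega>)"
        by (rule compact_uniformly_continuous[OF continuous_on_subset[OF cont[OF w]]]) auto
      then obtain d where d: "0 < d" "\<And>s t. s \<in> {0..T} \<Longrightarrow> t \<in> {0..T} \<Longrightarrow> dist t s < d \<Longrightarrow> dist (X t \<omega>) (X s \<omega>) < \<delta>"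
        unfolding uniformly_continuous_on_def using pos(2) by metis
      have "\<forall>\<^sub>F n in sequentially. T / d < real n"
        using filterlim_real_sequentially by (simp add: filterlim_at_top_dense)
      then have "\<forall>\<^sub>F n in sequentially. indicat_real (?B n) \<omega> = 0"
      proof eventually_elim
        case (elim n)
        have n0: "0 < real n" using elim pos d(1) by (meson divide_pos_pos order.strict_trans)
        have h: "T / real n < d" using elim n0 d(1) by (simp add: field_simps)
        have "\<omega> \<in> D n i" if i: "i < n" for i
          unfolding D_def
        proof (safe intro!: w)
          fix r assume r: "r \<in> {real i * (T / real n)..real (Suc i) * (T / real n)}"
          have "real (Suc i) * (T / real n) \<le> real n * (T / real n)"
            using i pos by (intro mult_right_mono) auto
          then have top: "real (Suc i) * (T / real n) \<le> T" using n0 by simp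
          have bot: "0 \<le> real i * (T / real n)" using pos by auto
          have "r - real i * (T / real n) \<le> T / real n"
            using r by (simp add: algebra_simps add_divide_distrib)
          then have "dist r (real i * (T / real n)) < d" using r h by (simp add: dist_real_def)
          then have "dist (X r \<omega>) (X (real i * (T / real n)) \<omega>) < \<delta>"
            using r top bot by (intro d(2)) auto
          then show "norm (X r \<omega> - X (real i * (T / real n)) \<omega>) \<le> \<delta>" by (simp add: dist_norm)
        qed
        then show ?case by (simp add: indicator_def)
      qed
      then show "(\<lambda>n. indicat_real (?B n) \<omega>) \<longlonglongrightarrow> 0" by (rule tendsto_eventually)
    qed
  qed (use BM in \<open>auto simp: indicator_def\<close>)
  then have "(\<lambda>n. prob (?B n)) \<longlonglongrightarrow> 0"
    using BM by (simp add: sets.Int_space_eq2)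
  then show "\<forall>\<^sub>F n in sequentially. prob (?B n) < e" using pos(3) by (rule order_tendstoD(2))
qed

lemma continuous_process:
  fixes \<Phi> :: "real \<Rightarrow> real^'d \<Rightarrow> 'z::real_normed_vector" and X :: "real \<Rightarrow> 'a \<Rightarrow> real^'d"
  assumes ad: "adapted F X" and cont: "\<And>\<omega>. \<omega> \<in> space M \<Longrightarrow> continuous_on {0..} (\<lambda>t. X t \<omega>)"
    and \<Phi>: "continuous_on ({0..} \<times> UNIV) (\<lambda>(t, x). \<Phi> t x)"
  shows "\<omega> \<in> space M \<Longrightarrow> continuous_on {0..} (\<lambda>t. \<Phi> t (X t \<omega>))"
    and "0 \<le> t \<Longrightarrow> (\<lambda>\<omega>. \<Phi> t (X t \<omega>)) \<in> borel_measurable (F t)"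
proof -
  show "continuous_on {0..} (\<lambda>t. \<Phi> t (X t \<omega>))" if "\<omega> \<in> space M"
  proof -
    have "continuous_on {0..} (\<lambda>t. (t, X t \<omega>))" by (intro continuous_on_Pair continuous_on_id cont[OF that])
    then show ?thesis using continuous_on_compose2[OF \<Phi>, of "{0..}" "\<lambda>t. (t, X t \<omega>)"] by auto
  qed
  show "(\<lambda>\<omega>. \<Phi> t (X t \<omega>)) \<in> borel_measurable (F t)" if t: "0 \<le> t"
  proof -
    have "continuous_on UNIV (\<lambda>x :: real^'d. (t, x))" by (intro continuous_on_Pair continuous_on_id continuous_on_const)
    then have c: "continuous_on UNIV (\<Phi> t)"
      using continuous_on_compose2[OF \<Phi>, of UNIV "\<lambda>x. (t, x)"] t by auto
    have "X t \<in> borel_measurable (F t)" using ad t by (simp add: adapted_def)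
    then show ?thesis by (rule measurable_compose[OF _ borel_measurable_continuous_onI[OF c]])
  qed
qed

text \<open>\<open>G\<close> is the event that the time spent in active grid steps is at least
  \<epsilon>/2. A path with a stretch as described belongs to it, and by the bound on the expected
  active time it is improbable. An enclosing event is used, so the set of such paths itself need not
  be shown to be measurable.\<close>

lemma grid_estimate:
  fixes X :: "real \<Rightarrow> 'a \<Rightarrow> real^'d" and b :: "real^'d \<Rightarrow> real \<Rightarrow> real^'d"
    and \<sigma> :: "real^'d \<Rightarrow> real \<Rightarrow> real^'m^'d" and \<Phi> :: "real \<Rightarrow> real^'d \<Rightarrow> real"
  assumes ad: "adapted F X" and cont: "\<And>\<omega>. \<omega> \<in> space M \<Longrightarrow> continuous_on {0..} (\<lambda>t. X t \<omega>)"
    and ito: "ito_integral M F W (\<lambda>t \<omega>. \<sigma> (X t \<omega>) t) I"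
    and bint: "AE \<omega> in M. \<forall>T\<ge>0. set_integrable lborel {0..T} (\<lambda>r. b (X r \<omega>) r)"
    and Xeq: "AE \<omega> in M. \<forall>t\<ge>0. X t \<omega> = X 0 \<omega> + (LINT r:{0..t}|lborel. b (X r \<omega>) r) + I t \<omega>"
    and C12: "C12 \<Phi>"
    and pos: "0 < T" "0 < N" "0 < C" "1 \<le> P" "0 < K" "0 < c" "0 < lam"
    and coeff: "\<And>t x. t \<in> {0..T} \<Longrightarrow> norm x \<le> N + 1 \<Longrightarrow> norm (b x t) \<le> C \<and> norm (\<sigma> x t) \<le> C"
    and gP: "\<And>t x. t \<in> {0..T} \<Longrightarrow> norm x \<le> N \<Longrightarrow> norm (grad (\<Phi> t) x) \<le> P"
    and taylor: "\<And>t s x u. 0 \<le> t \<Longrightarrow> t \<le> s \<Longrightarrow> s \<le> T \<Longrightarrow> norm x \<le> N \<Longrightarrow> norm u \<le> 1 \<Longrightarrow>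
       \<bar>\<Phi> s (x + u) - \<Phi> t x - grad (\<Phi> t) x \<bullet> u\<bar> \<le> K * ((s - t) + (norm u)\<^sup>2)"
    and nd: "\<And>t x. t \<in> {0..T} \<Longrightarrow> \<bar>\<Phi> t x\<bar> \<le> 2 / lam \<Longrightarrow> c \<le> norm (transpose (\<sigma> x t) *v grad (\<Phi> t) x)"
    and lam: "1 + (2 * P * C + 4 * K) + 4 * K * real CARD('d) * C\<^sup>2 \<le> lam / 8 * (c\<^sup>2 / 16)"
    and eps: "0 < \<epsilon>" "0 < e"
  shows "\<exists>G\<in>sets M. prob G \<le> e \<and> (\<forall>\<omega>\<in>space M. \<forall>\<tau>\<ge>0. \<tau> + \<epsilon> \<le> T \<and> (\<forall>r\<in>{0..<\<tau>}. \<Phi> r (X r \<omega>) < 0) \<and>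
     0 \<le> \<Phi> \<tau> (X \<tau> \<omega>) \<and> (\<forall>r\<in>{\<tau>..\<tau> + \<epsilon>}. - 1 / lam \<le> \<Phi> r (X r \<omega>) \<and> \<Phi> r (X r \<omega>) \<le> 0 \<and> norm (X r \<omega>) \<le> N)
     \<longrightarrow> \<omega> \<in> G)"
proof -
  define Y where "Y r \<omega> = \<Phi> r (X r \<omega>)" for r \<omega>
  define g where "g r \<omega> = grad (\<Phi> r) (X r \<omega>)" for r \<omega>
  have Yc: "continuous_on {0..} (\<lambda>r. Y r \<omega>)" if "\<omega> \<in> space M" for \<omega>
    unfolding Y_def by (rule continuous_process(1)[OF ad cont C12_continuous(1)[OF C12] that])
  have Ym: "Y r \<in> borel_measurable (F r)" if "0 \<le> r" for r
    unfolding Y_def[abs_def] by (rule continuous_process(2)[OF ad cont C12_continuous(1)[OF C12] that])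
  have gm: "g r \<in> borel_measurable (F r)" if "0 \<le> r" for r
    unfolding g_def[abs_def] by (rule continuous_process(2)[OF ad cont C12_continuous(2)[OF C12] that])
  \<comment> \<open>Freezing the gradient at the left end of a step reduces \<open>c\<close> to c/2,
    and the lower bound in \<open>step_approx\<close> has the factor 1/4: (c/2)^2 / 4 =
    c^2/16.\<close>
  define c' where "c' = c\<^sup>2 / 16"
  define K4 where "K4 = 9 * (real CARD('d))\<^sup>2 * (real CARD('m))\<^sup>2 * C ^ 4"
  define K5 where "K5 = P\<^sup>2 * C\<^sup>2 * T + (lam / 8 * P\<^sup>2)\<^sup>2 * K4 * T\<^sup>2"
  \<comment> \<open>Three errors of size at most \<theta> will bound the expected active time.
    Markov's inequality at level \<epsilon>/2 then gives 6 \<theta>/\<epsilon>, which is at most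
    \<open>e\<close>.\<close>
  define \<theta> where "\<theta> = e * \<epsilon> / 8"
  define \<mu> where "\<mu> = min (1 / lam) (\<theta> / 3)"
  define \<alpha> where "\<alpha> = \<theta> / (K5 + 1)"
  \<comment> \<open>The factor of \<open>prob Bad\<close> in \<open>grid_bound\<close>, with the
    product of step number and mesh equal to \<open>T\<close>. It is independent of the grid, so the
    grid can be chosen afterwards with \<open>prob Bad\<close> at most \<theta>/Q.\<close>
  define Q where "Q = 1 / (2 * \<alpha>) + lam / 8 * c' * T"
  have K4: "0 \<le> K4" using pos by (simp add: K4_def)
  have K5: "0 \<le> K5" using pos K4 by (simp add: K5_def)
  have \<theta>: "0 < \<theta>" using eps by (simp add: \<theta>_def)
  have \<mu>: "0 < \<mu>" "\<mu> \<le> 1 / lam" "3 * \<mu> \<le> \<theta>" using \<theta> pos by (auto simp: \<mu>_def)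
  have \<alpha>: "0 < \<alpha>" "\<alpha> * K5 \<le> \<theta>" using \<theta> K5 by (auto simp: \<alpha>_def field_simps)
  have c': "0 < c'" using pos by (simp add: c'_def)
  have Q: "0 < Q" unfolding Q_def using \<alpha>(1) pos c' by (intro add_pos_pos) auto
  obtain d1 where d1: "0 < d1" "\<And>s r x y. s \<in> {0..T} \<Longrightarrow> r \<in> {0..T} \<Longrightarrow> norm x \<le> N + 1 \<Longrightarrow> norm y \<le> N + 1 \<Longrightarrow>
      \<bar>s - r\<bar> \<le> d1 \<Longrightarrow> norm (x - y) \<le> d1 \<Longrightarrow> dist (\<Phi> s x) (\<Phi> r y) < \<mu>"
    using uniformly_close_on_cball[OF C12_continuous(1)[OF C12] \<mu>(1), of T "N + 1"] by blast
  have c2: "0 < c / (2 * C)" using pos by simp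
  obtain d2 where d2: "0 < d2" "\<And>s r x y. s \<in> {0..T} \<Longrightarrow> r \<in> {0..T} \<Longrightarrow> norm x \<le> N + 1 \<Longrightarrow> norm y \<le> N + 1 \<Longrightarrow>
      \<bar>s - r\<bar> \<le> d2 \<Longrightarrow> norm (x - y) \<le> d2 \<Longrightarrow> dist (grad (\<Phi> s) x) (grad (\<Phi> r) y) < c / (2 * C)"
    using uniformly_close_on_cball[OF C12_continuous(2)[OF C12] c2, of T "N + 1"] by blast
  \<comment> \<open>Oscillation allowed on one step. The halves are there because two times of one
    step are compared through its left end, which costs 2 \<delta>; the bound 1/2 keeps such points
    in the ball of radius \<open>N + 1\<close>. The last entry is for the first smallness condition
    of \<open>quadratic_step\<close>.\<close>
  define \<delta> where "\<delta> = min (1 / 2) (min (d1 / 2) (min (d2 / 2) (1 / (lam * K))))"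
  have \<delta>: "0 < \<delta>" "\<delta> \<le> 1 / 2" "2 * \<delta> \<le> d1" "2 * \<delta> \<le> d2" "\<delta> \<le> 1 / (lam * K)"
    using pos d1(1) d2(1) by (auto simp: \<delta>_def)
  \<comment> \<open>The last two entries are the remaining smallness conditions of
    \<open>quadratic_step\<close>. The entry \<epsilon>/4 pays for the two steps that may be lost at
    the ends of a stretch of length \<epsilon>.\<close>
  define h0 where "h0 = min \<delta> (min (\<epsilon> / 4) (min (1 / (16 * C\<^sup>2)) (K / (lam * P\<^sup>2 * C\<^sup>2))))"
  have h0: "0 < h0" using pos \<delta> eps by (simp add: h0_def)
  have "\<forall>\<^sub>F n in sequentially. T / h0 < real n"
    using filterlim_real_sequentially by (simp add: filterlim_at_top_dense)
  moreover have "0 < \<theta> / (2 * Q)" using \<theta> Q by simp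
  note oscillation_prob(2)[OF ad cont pos(1) \<delta>(1) this]
  ultimately have "\<forall>\<^sub>F n in sequentially. T / h0 < real n \<and>
    prob (\<Union>i<n. space M - {\<omega>\<in>space M. \<forall>r\<in>{real i * (T / real n)..real (Suc i) * (T / real n)}.
      norm (X r \<omega> - X (real i * (T / real n)) \<omega>) \<le> \<delta>}) < \<theta> / (2 * Q)"
    by (rule eventually_conj)
  then obtain n where n: "T / h0 < real n" and nosc: "prob (\<Union>i<n. space M - {\<omega>\<in>space M. \<forall>r\<in>{real i * (T / real n)..real (Suc i) * (T / real n)}.
      norm (X r \<omega> - X (real i * (T / real n)) \<omega>) \<le> \<delta>}) < \<theta> / (2 * Q)"
    unfolding eventually_sequentially by blast
  have n0: "0 < real n" using n pos h0 by (meson divide_pos_pos order.strict_trans)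
  define h where "h = T / real n"
  define tt where "tt i = real i * h" for i
  have h: "0 < h" "h \<le> h0" "real n * h = T"
    using n n0 pos h0 by (auto simp: h_def field_simps)
  have hs: "h \<le> \<delta>" "h \<le> \<epsilon> / 4" "h \<le> 1 / (16 * C\<^sup>2)" "h \<le> K / (lam * P\<^sup>2 * C\<^sup>2)"
    using h(2) by (auto simp: h0_def)
  have small: "K * (h + \<delta>\<^sup>2) \<le> 2 / lam" "16 * C\<^sup>2 * h \<le> 1" "lam * P\<^sup>2 * C\<^sup>2 * h \<le> K"
  proof -
    have "\<delta>\<^sup>2 \<le> \<delta>" using \<delta>(1,2) by (simp add: power2_eq_square mult_le_cancel_right1)
    then have "\<delta>\<^sup>2 \<le> 1 / (lam * K)" using \<delta>(5) by (rule order_trans)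
    with order_trans[OF hs(1) \<delta>(5)] have "h + \<delta>\<^sup>2 \<le> 1 / (lam * K) + 1 / (lam * K)" by (rule add_mono)
    then have "K * (h + \<delta>\<^sup>2) \<le> K * (1 / (lam * K) + 1 / (lam * K))"
      using pos by (intro mult_left_mono) auto
    also have "\<dots> = 2 / lam" using pos by (simp add: field_simps)
    finally show "K * (h + \<delta>\<^sup>2) \<le> 2 / lam" .
    show "16 * C\<^sup>2 * h \<le> 1" using hs(3) pos by (simp add: field_simps)
    show "lam * P\<^sup>2 * C\<^sup>2 * h \<le> K" using hs(4) pos by (simp add: field_simps)
  qed
  have tt: "0 \<le> tt i" "tt i \<le> tt (Suc i)" "tt i < tt (Suc i)" "tt (Suc i) - tt i = h" for i
    using h(1) by (auto simp: tt_def algebra_simps)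
  have ttT: "tt i \<le> T" if "i \<le> n" for i
  proof -
    have "tt i \<le> real n * h" unfolding tt_def using that h(1) by (intro mult_right_mono) auto
    then show ?thesis using h(3) by simp
  qed
  have ttmono: "tt i \<le> tt j" if "i \<le> j" for i j
    unfolding tt_def using that h(1) by (intro mult_right_mono) auto
  define D where "D i = {\<omega>\<in>space M. \<forall>r\<in>{tt i..tt (Suc i)}. norm (X r \<omega> - X (tt i) \<omega>) \<le> \<delta>}" for i
  have Deq: "D i = {\<omega>\<in>space M. \<forall>r\<in>{real i * (T / real n)..real (Suc i) * (T / real n)}.
      norm (X r \<omega> - X (real i * (T / real n)) \<omega>) \<le> \<delta>}" for i
    by (simp only: D_def tt_def h_def)
  have DM: "D i \<in> sets M" for i
    unfolding Deq by (rule oscillation_prob(1)[OF ad cont pos(1) \<delta>(1) zero_less_one])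
  have Dp: "prob (\<Union>i<n. space M - D i) \<le> \<theta> / (2 * Q)"
    using nosc unfolding Deq by simp
  \<comment> \<open>The first bound lets drift and approximation error together stay below 2 C h;
    the second keeps the \<open>n\<close> exceptional events \<open>R i\<close> together below half
    of the allowed probability.\<close>
  define z where "z = min (C * h) (\<theta> / (2 * Q) / real n)"
  have z: "0 < z" "z \<le> C * h" "real n * z \<le> \<theta> / (2 * Q)"
  proof -
    show "0 < z" using pos h(1) \<theta> Q n0 by (simp add: z_def)
    show "z \<le> C * h" by (simp add: z_def)
    have "real n * z \<le> real n * (\<theta> / (2 * Q) / real n)" using n0 by (intro mult_left_mono) (auto simp: z_def)
    then show "real n * z \<le> \<theta> / (2 * Q)" using n0 by simp
  qed
  define good where "good i = step_approx (tt i) (tt (Suc i)) C P (c / 2) z (\<lambda>t \<omega>. \<sigma> (X t \<omega>) t) I" for i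
  have "\<exists>J R. good i J R" for i
  proof -
    have "0 < c / 2" "0 < P" using pos by auto
    then show ?thesis unfolding good_def by (intro ito_step_approx[OF ito tt(1) tt(3) pos(3) _ _ z(1)])
  qed
  then obtain J R where "\<And>i. good i (J i) (R i)" by metis
  note JR = this[unfolded good_def]
  note JRu = JR[unfolded step_approx_def tt(4)]
  have "AE \<omega> in M. (\<forall>T\<ge>0. set_integrable lborel {0..T} (\<lambda>r. b (X r \<omega>) r)) \<and>
      (\<forall>t\<ge>0. X t \<omega> = X 0 \<omega> + (LINT r:{0..t}|lborel. b (X r \<omega>) r) + I t \<omega>)"
    using bint Xeq by (rule AE_conjI)
  then obtain N0 where N0: "{\<omega>\<in>space M. \<not> ((\<forall>T\<ge>0. set_integrable lborel {0..T} (\<lambda>r. b (X r \<omega>) r)) \<and>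
      (\<forall>t\<ge>0. X t \<omega> = X 0 \<omega> + (LINT r:{0..t}|lborel. b (X r \<omega>) r) + I t \<omega>))} \<subseteq> N0"
      "emeasure M N0 = 0" "N0 \<in> sets M" by (rule AE_E)
  define Bad where "Bad = N0 \<union> (\<Union>i<n. R i) \<union> (\<Union>i<n. space M - D i)"
  have RM: "R i \<in> sets M" for i using JRu by blast
  have RUM: "(\<Union>i<n. R i) \<in> sets M" by (intro sets.finite_UN RM) simp
  have DUM: "(\<Union>i<n. space M - D i) \<in> sets M" by (intro sets.finite_UN sets.compl_sets DM) simp
  have BadM: "Bad \<in> sets M" unfolding Bad_def by (intro sets.Un N0 RUM DUM)
  have Badp: "prob Bad \<le> \<theta> / Q"
  proof -
    have "prob Bad \<le> prob (N0 \<union> (\<Union>i<n. R i)) + prob (\<Union>i<n. space M - D i)"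
      unfolding Bad_def by (intro measure_Un_le sets.Un N0 RUM DUM)
    also have "prob (N0 \<union> (\<Union>i<n. R i)) \<le> prob N0 + prob (\<Union>i<n. R i)"
      by (intro measure_Un_le N0 RUM)
    also have "prob N0 = 0" using N0(2) by (simp add: measure_def)
    also have "prob (\<Union>i<n. R i) \<le> (\<Sum>i<n. prob (R i))"
      by (rule measure_UNION_le) (auto simp: RM)
    also have "\<dots> \<le> (\<Sum>i<n. z)" using JRu by (intro sum_mono) blast
    finally have "prob Bad \<le> real n * z + prob (\<Union>i<n. space M - D i)" by simp
    also have "\<dots> \<le> \<theta> / (2 * Q) + \<theta> / (2 * Q)" using z(3) Dp by (intro add_mono)
    finally show ?thesis by (simp add: field_simps)
  qed
  \<comment> \<open>All times up to the grid point are inspected, because Y may reach 0 between two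
    grid points and be negative at both. In contrast, \<open>ok\<close> looks at grid values
    only.\<close>
  define S where "S j \<omega> \<longleftrightarrow> (\<exists>r\<in>{0..tt j}. 0 \<le> Y r \<omega>)" for j \<omega>
  define ok where "ok j \<omega> \<longleftrightarrow> - 1 / lam \<le> Y (tt j) \<omega> \<and> Y (tt j) \<omega> \<le> 0 \<and> norm (X (tt j) \<omega>) \<le> N" for j \<omega>
  \<comment> \<open>Only grid points from the hit on are tested, so nothing is demanded of the path
    before. The event is known at time \<open>tt i\<close>; oscillation within the step ahead is
    not, which is why it is treated through \<open>Bad\<close>.\<close>
  define A where "A i = {\<omega>\<in>space M. S i \<omega> \<and> (\<forall>j\<in>{..i}. S j \<omega> \<longrightarrow> ok j \<omega>)}" for i
  have AF: "A i \<in> sets (F (tt i))" for i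
  proof -
    have Sm: "{\<omega>\<in>space (F (tt i)). S j \<omega>} \<in> sets (F (tt i))" if "j \<le> i" for j
      unfolding S_def
    proof (rule sets_Collect_hit_interval)
      show "Y r \<in> borel_measurable (F (tt i))" if "r \<in> {0..tt j}" for r
        using that ttmono[OF \<open>j \<le> i\<close>] by (intro measurable_F_mono[OF Ym]) auto
      show "continuous_on {0..tt j} (\<lambda>r. Y r \<omega>)" if "\<omega> \<in> space (F (tt i))" for \<omega>
        using that by (intro continuous_on_subset[OF Yc]) auto
    qed (rule tt)
    have okm: "{\<omega>\<in>space (F (tt i)). ok j \<omega>} \<in> sets (F (tt i))" if "j \<le> i" for j
    proof -
      have [measurable]: "Y (tt j) \<in> borel_measurable (F (tt i))"
        by (rule measurable_F_mono[OF Ym[OF tt(1)] ttmono[OF that]])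
      have [measurable]: "X (tt j) \<in> borel_measurable (F (tt i))"
        by (rule measurable_F_mono[OF _ ttmono[OF that]]) (use ad tt(1) in \<open>simp add: adapted_def\<close>)
      show ?thesis unfolding ok_def by measurable
    qed
    have "{\<omega>\<in>space (F (tt i)). S i \<omega> \<and> (\<forall>j\<in>{..i}. S j \<omega> \<longrightarrow> ok j \<omega>)} \<in> sets (F (tt i))"
      by (intro sets.sets_Collect_conj sets.sets_Collect_finite_All sets.sets_Collect_imp Sm okm) auto
    then show ?thesis by (simp add: A_def)
  qed
  have AM: "A i \<in> sets M" for i using AF sets_F_M[OF tt(1)] by blast
  have Aok: "S i \<omega>" "ok i \<omega>" if "\<omega> \<in> A i" for i \<omega> using that by (auto simp: A_def)
  have Dst: "norm (X r \<omega> - X (tt i) \<omega>) \<le> \<delta>" if "\<omega> \<in> D i" "r \<in> {tt i..tt (Suc i)}" for i r \<omega>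
    using that by (auto simp: D_def)
  have Xin: "norm (X r \<omega>) \<le> N + 1" "r \<in> {0..T}" if "i < n" "\<omega> \<in> A i" "\<omega> \<in> D i" "r \<in> {tt i..tt (Suc i)}" for i r \<omega>
  proof -
    have "norm (X r \<omega>) \<le> norm (X (tt i) \<omega>) + norm (X r \<omega> - X (tt i) \<omega>)" by (rule norm_triangle_sub)
    then show "norm (X r \<omega>) \<le> N + 1" using Dst[OF that(3,4)] Aok(2)[OF that(2)] \<delta>(2) by (simp add: ok_def)
    show "r \<in> {0..T}" using that(4) ttT[of "Suc i"] that(1) tt(1)[of i] by auto
  qed
  have Yosc: "\<bar>Y r \<omega> - Y (tt i) \<omega>\<bar> < \<mu>" if "i < n" "\<omega> \<in> A i" "\<omega> \<in> D i" "r \<in> {tt i..tt (Suc i)}" for i r \<omega>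
  proof -
    have "dist (\<Phi> r (X r \<omega>)) (\<Phi> (tt i) (X (tt i) \<omega>)) < \<mu>"
    proof (rule d1(2))
      show "\<bar>r - tt i\<bar> \<le> d1" using that(4) tt(4)[of i] hs(1) \<delta>(1,3) by auto
      show "norm (X r \<omega> - X (tt i) \<omega>) \<le> d1" using Dst[OF that(3,4)] \<delta>(1,3) by linarith
    qed (use Xin[OF that] Xin[OF that(1-3), of "tt i"] tt(2)[of i] in auto)
    then show ?thesis by (simp add: Y_def dist_real_def)
  qed
  \<comment> \<open>Within a step Y stays in [-2/lam, 2/lam], so nondegeneracy holds at every time
    of the step. Replacing the gradient by its value at the left end costs at most C * (c / (2 * C))
    = c/2.\<close>
  have sig: "norm (\<sigma> (X x \<omega>) x) \<le> C \<and> c / 2 \<le> norm (transpose (\<sigma> (X x \<omega>) x) *v g (tt i) \<omega>)"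
    if i: "i < n" and w: "\<omega> \<in> A i" "\<omega> \<in> D i" and x: "x \<in> {tt i<..tt (Suc i)}" for i \<omega> x
  proof -
    have x': "x \<in> {tt i..tt (Suc i)}" using x by auto
    note X1 = Xin[OF i w x']
    have s: "norm (\<sigma> (X x \<omega>) x) \<le> C" using coeff[OF X1(2,1)] by blast
    have "\<bar>Y x \<omega>\<bar> \<le> \<bar>Y (tt i) \<omega>\<bar> + \<mu>" using Yosc[OF i w x'] by linarith
    moreover have "\<bar>Y (tt i) \<omega>\<bar> \<le> 1 / lam" using Aok(2)[OF w(1)] by (auto simp: ok_def)
    moreover have "2 / lam = 1 / lam + 1 / lam" by simp
    ultimately have "\<bar>\<Phi> x (X x \<omega>)\<bar> \<le> 2 / lam" using \<mu>(2) by (simp add: Y_def)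
    then have c1: "c \<le> norm (transpose (\<sigma> (X x \<omega>) x) *v g x \<omega>)" using nd[OF X1(2)] by (simp add: g_def)
    have "dist (grad (\<Phi> x) (X x \<omega>)) (grad (\<Phi> (tt i)) (X (tt i) \<omega>)) < c / (2 * C)"
    proof (rule d2(2))
      show "\<bar>x - tt i\<bar> \<le> d2" using x tt(4)[of i] hs(1) \<delta>(1,4) by auto
      show "norm (X x \<omega> - X (tt i) \<omega>) \<le> d2" using Dst[OF w(2) x'] \<delta>(1,4) by linarith
    qed (use X1 Xin[OF i w, of "tt i"] tt(2)[of i] in auto)
    then have gd: "norm (g x \<omega> - g (tt i) \<omega>) \<le> c / (2 * C)" by (simp add: g_def dist_norm)
    have "norm (transpose (\<sigma> (X x \<omega>) x) *v (g x \<omega> - g (tt i) \<omega>)) \<le> norm (\<sigma> (X x \<omega>) x) * norm (g x \<omega> - g (tt i) \<omega>)"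
      by (rule norm_transpose_mult_le)
    also have "\<dots> \<le> C * (c / (2 * C))" using s gd pos by (intro mult_mono) auto
    also have "\<dots> = c / 2" using pos by simp
    finally have "norm (transpose (\<sigma> (X x \<omega>) x) *v g x \<omega> - transpose (\<sigma> (X x \<omega>) x) *v g (tt i) \<omega>) \<le> c / 2"
      by (simp only: matrix_vector_mult_diff_distrib)
    then have "c / 2 \<le> norm (transpose (\<sigma> (X x \<omega>) x) *v g (tt i) \<omega>)"
      using c1 norm_triangle_ineq2[of "transpose (\<sigma> (X x \<omega>) x) *v g x \<omega>" "transpose (\<sigma> (X x \<omega>) x) *v g (tt i) \<omega>"] by linarith
    then show ?thesis using s by blast
  qed
  have path: "(\<Sum>i<n. indicator (A i) \<omega> * ((1 + lam * Y (tt i) \<omega>) * (g (tt i) \<omega> \<bullet> J i \<omega>) - (2 * P * C + 4 * K) * h - 4 * K * (norm (J i \<omega>))\<^sup>2 + lam / 8 * (g (tt i) \<omega> \<bullet> J i \<omega>)\<^sup>2)) \<le> 3 * \<mu>"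
    if w: "\<omega> \<in> space M - Bad" for \<omega>
  proof -
    have wD: "\<omega> \<in> D i" if "i < n" for i
      using w that by (auto simp: Bad_def)
    have wM: "\<omega> \<in> space M" using w by blast
    have wR: "\<omega> \<notin> R i" if "i < n" for i using w that by (auto simp: Bad_def)
    have wN: "\<omega> \<notin> N0" using w by (auto simp: Bad_def)
    have eqs: "set_integrable lborel {0..t} (\<lambda>r. b (X r \<omega>) r)"
        "X t \<omega> = X 0 \<omega> + (LINT r:{0..t}|lborel. b (X r \<omega>) r) + I t \<omega>" if "0 \<le> t" for t
      using N0(1) wM wN that by blast+
    let ?f = "\<lambda>v. v + lam / 2 * v\<^sup>2" and ?y = "\<lambda>i. Y (tt i) \<omega>"
    have "(\<Sum>i<n. indicator (A i) \<omega> * ((1 + lam * Y (tt i) \<omega>) * (g (tt i) \<omega> \<bullet> J i \<omega>) - (2 * P * C + 4 * K) * h - 4 * K * (norm (J i \<omega>))\<^sup>2 + lam / 8 * (g (tt i) \<omega> \<bullet> J i \<omega>)\<^sup>2))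
      \<le> (\<Sum>i<n. if \<omega> \<in> A i then ?f (?y (Suc i)) - ?f (?y i) else 0)"
    proof (rule sum_mono)
      fix i assume "i \<in> {..<n}"
      then have i: "i < n" by simp
      show "indicator (A i) \<omega> * ((1 + lam * Y (tt i) \<omega>) * (g (tt i) \<omega> \<bullet> J i \<omega>) - (2 * P * C + 4 * K) * h - 4 * K * (norm (J i \<omega>))\<^sup>2 + lam / 8 * (g (tt i) \<omega> \<bullet> J i \<omega>)\<^sup>2)
        \<le> (if \<omega> \<in> A i then ?f (?y (Suc i)) - ?f (?y i) else 0)"
      proof (cases "\<omega> \<in> A i")
        case True
        note Di = wD[OF i]
        have sC: "norm (\<sigma> (X x \<omega>) x) \<le> C" if "x \<in> {tt i<..tt (Suc i)}" for x
          using sig[OF i True Di that] by blast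
        have JI: "norm (J i \<omega> - (I (tt (Suc i)) \<omega> - I (tt i) \<omega>)) \<le> z"
          using JRu[of i] wM wR[OF i] sC by blast
        define U where "U = X (tt (Suc i)) \<omega> - X (tt i) \<omega>"
        have bC: "norm (b (X x \<omega>) x) \<le> C" if "x \<in> {tt i<..tt (Suc i)}" for x
          using coeff Xin[OF i True Di, of x] that by auto
        let ?B = "(LINT r:{0..tt (Suc i)}|lborel. b (X r \<omega>) r) - (LINT r:{0..tt i}|lborel. b (X r \<omega>) r)"
        have "norm ?B \<le> C * h"
          using norm_set_integral_le[OF eqs(1)[OF tt(1)] tt(1) tt(2)[of i] bC] by (simp only: tt(4))
        moreover have "U = ?B + (I (tt (Suc i)) \<omega> - I (tt i) \<omega>)"
          using eqs(2)[OF tt(1), of "Suc i"] eqs(2)[OF tt(1), of i] by (simp add: U_def)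
        then have "U - J i \<omega> = ?B - (J i \<omega> - (I (tt (Suc i)) \<omega> - I (tt i) \<omega>))" by simp
        then have "norm (U - J i \<omega>) \<le> norm ?B + norm (J i \<omega> - (I (tt (Suc i)) \<omega> - I (tt i) \<omega>))"
          by (simp only: norm_triangle_ineq4)
        ultimately have Ue: "norm (U - J i \<omega>) \<le> 2 * C * h" using JI z(2) by linarith
        have Ud: "norm U \<le> \<delta>" using Dst[OF Di, of "tt (Suc i)"] tt(2)[of i] by (simp add: U_def)
        have oki: "- 1 / lam \<le> ?y i" "?y i \<le> 0" "norm (X (tt i) \<omega>) \<le> N" using Aok(2)[OF True] by (auto simp: ok_def)
        have ty: "\<bar>?y (Suc i) - ?y i - g (tt i) \<omega> \<bullet> U\<bar> \<le> K * (h + (norm U)\<^sup>2)"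
          using taylor[OF tt(1) tt(2), of i "X (tt i) \<omega>" U] ttT[of "Suc i"] i oki(3) Ud \<delta>(2)
          by (simp add: Y_def g_def U_def tt(4))
        have gb: "norm (g (tt i) \<omega>) \<le> P"
          unfolding g_def using tt(1) ttT[of i] i oki(3) by (intro gP) auto
        have "(1 + lam * ?y i) * (g (tt i) \<omega> \<bullet> J i \<omega>) - (2 * P * C + 4 * K) * h - 4 * K * (norm (J i \<omega>))\<^sup>2 + lam / 8 * (g (tt i) \<omega> \<bullet> J i \<omega>)\<^sup>2 \<le> ?f (?y (Suc i)) - ?f (?y i)"
          by (rule quadratic_step[where U = U and e = "U - J i \<omega>" and \<delta> = \<delta>])
             (use pos h(1) ty Ud Ue gb oki small in auto)
        then show ?thesis using True by simp
      qed simp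
    qed
    also have "\<dots> \<le> 3 * \<mu>"
    proof (rule quadratic_telescope[where S = "\<lambda>i. S i \<omega>"])
      show "S (Suc m) \<omega>" if "S m \<omega>" for m
        using that tt(2)[of m] by (auto simp: S_def)
      show "\<omega> \<in> A m" if "S m \<omega>" "\<omega> \<in> A (Suc m)" for m
        using that by (auto simp: A_def)
      \<comment> \<open>At grid point 0 the hit forces Y \<ge> 0 and activity forces Y \<le>
        0.\<close>
      show "?y 0 = 0" if "\<omega> \<in> A 0"
        using Aok[OF that] by (auto simp: S_def ok_def tt_def)
      show "- \<mu> \<le> ?y (Suc m)" if m: "m < n" and nS: "\<not> S m \<omega>" and Am: "\<omega> \<in> A (Suc m)" for m
      proof -
        obtain r where r: "r \<in> {0..tt (Suc m)}" "0 \<le> Y r \<omega>" using Aok(1)[OF Am] by (auto simp: S_def)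
        then have rm: "r \<in> {tt m..tt (Suc m)}" using nS by (force simp: S_def)
        have "norm (X r \<omega> - X (tt (Suc m)) \<omega>) \<le> norm (X r \<omega> - X (tt m) \<omega>) + norm (X (tt (Suc m)) \<omega> - X (tt m) \<omega>)"
          using norm_triangle_ineq4[of "X r \<omega> - X (tt m) \<omega>" "X (tt (Suc m)) \<omega> - X (tt m) \<omega>"] by simp
        then have Xd: "norm (X r \<omega> - X (tt (Suc m)) \<omega>) \<le> 2 * \<delta>"
          using Dst[OF wD[OF m] rm] Dst[OF wD[OF m], of "tt (Suc m)"] tt(2)[of m] by simp
        have XN: "norm (X (tt (Suc m)) \<omega>) \<le> N" using Aok(2)[OF Am] by (simp add: ok_def)
        have "norm (X r \<omega>) \<le> norm (X (tt (Suc m)) \<omega>) + norm (X r \<omega> - X (tt (Suc m)) \<omega>)" by (rule norm_triangle_sub)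
        then have Xr: "norm (X r \<omega>) \<le> N + 1" using Xd XN \<delta>(2) by linarith
        have "dist (\<Phi> r (X r \<omega>)) (\<Phi> (tt (Suc m)) (X (tt (Suc m)) \<omega>)) < \<mu>"
        proof (rule d1(2))
          show "\<bar>r - tt (Suc m)\<bar> \<le> d1" using rm tt(4)[of m] hs(1) \<delta>(1,3) by auto
          show "norm (X r \<omega> - X (tt (Suc m)) \<omega>) \<le> d1" using Xd \<delta>(3) by linarith
          show "r \<in> {0..T}" "tt (Suc m) \<in> {0..T}" using r(1) ttT[of "Suc m"] m tt(1)[of "Suc m"] by auto
        qed (use Xr XN in auto)
        then show ?thesis using r(2) by (simp add: Y_def dist_real_def)
      qed
      show "\<bar>?y (Suc m) - ?y m\<bar> \<le> \<mu>" if "m < n" "\<omega> \<in> A m" for m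
        using Yosc[OF that wD[OF that(1)], of "tt (Suc m)"] tt(2)[of m] by simp
    qed (use pos \<mu> Aok in \<open>auto simp: ok_def\<close>)
    finally show ?thesis .
  qed
  have low: "c' * h * (prob (A i) - prob Bad) \<le> expectation (\<lambda>\<omega>. ((indicator (A i) \<omega> *\<^sub>R g (tt i) \<omega>) \<bullet> J i \<omega>)\<^sup>2)"
    if i: "i < n" for i
  proof -
    let ?p = "\<lambda>\<omega>. indicator (A i) \<omega> *\<^sub>R g (tt i) \<omega>"
    have pm: "?p \<in> borel_measurable (F (tt i))"
      by (intro borel_measurable_scaleR borel_measurable_indicator AF gm tt)
    have pb: "\<forall>\<omega>\<in>space M. norm (?p \<omega>) \<le> P"
    proof
      fix \<omega>
      show "norm (?p \<omega>) \<le> P"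
      proof (cases "\<omega> \<in> A i")
        case True
        have "norm (g (tt i) \<omega>) \<le> P"
          unfolding g_def using tt(1) ttT[of i] i Aok(2)[OF True] by (intro gP) (auto simp: ok_def)
        then show ?thesis using True by simp
      qed (use pos in simp)
    qed
    have EM: "A i \<inter> D i \<in> sets M" using AM DM by blast
    have "(c / 2)\<^sup>2 / 4 * h * prob (A i \<inter> D i - R i) \<le> expectation (\<lambda>\<omega>. (?p \<omega> \<bullet> J i \<omega>)\<^sup>2)"
    proof -
      have "\<forall>\<omega>\<in>A i \<inter> D i. \<forall>x\<in>{tt i<..tt (Suc i)}. norm (\<sigma> (X x \<omega>) x) \<le> C \<and> c / 2 \<le> norm (transpose (\<sigma> (X x \<omega>) x) *v ?p \<omega>)"
        using sig[OF i] by simp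
      moreover have "\<forall>p E. p \<in> borel_measurable (F (tt i)) \<longrightarrow> (\<forall>\<omega>\<in>space M. norm (p \<omega>) \<le> P) \<longrightarrow>
         E \<in> sets M \<longrightarrow> (\<forall>\<omega>\<in>E. \<forall>x\<in>{tt i<..tt (Suc i)}. norm (\<sigma> (X x \<omega>) x) \<le> C \<and> c / 2 \<le> norm (transpose (\<sigma> (X x \<omega>) x) *v p \<omega>)) \<longrightarrow>
         (c / 2)\<^sup>2 / 4 * h * prob (E - R i) \<le> expectation (\<lambda>\<omega>. (p \<omega> \<bullet> J i \<omega>)\<^sup>2)"
        using JRu[of i] by (elim conjE) assumption
      ultimately show ?thesis using pm pb EM by blast
    qed
    \<comment> \<open>The lower bound of \<open>step_approx\<close> concerns an event on which the
      whole step is under control; the part of \<open>A i\<close> that is lost lies in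
      \<open>Bad\<close>.\<close>
    moreover have "prob (A i) - prob Bad \<le> prob (A i \<inter> D i - R i)"
    proof -
      have "A i \<subseteq> (A i \<inter> D i - R i) \<union> Bad"
        using i sets.sets_into_space[OF AM[of i]] by (auto simp: Bad_def)
      then have "prob (A i) \<le> prob ((A i \<inter> D i - R i) \<union> Bad)"
        using EM RM BadM by (intro finite_measure_mono) auto
      also have "\<dots> \<le> prob (A i \<inter> D i - R i) + prob Bad"
        using EM RM BadM by (intro measure_Un_le) auto
      finally show ?thesis by simp
    qed
    then have "c' * h * (prob (A i) - prob Bad) \<le> c' * h * prob (A i \<inter> D i - R i)"
      using c' h(1) by (intro mult_left_mono) auto
    moreover have "(c / 2)\<^sup>2 / 4 = c'" by (simp add: c'_def power2_eq_square)
    ultimately show ?thesis by simp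
  qed
  have bound: "h * (\<Sum>i<n. prob (A i)) \<le> 3 * \<mu> + \<alpha> * (P\<^sup>2 * C\<^sup>2 * (real n * h) + (lam / 8 * P\<^sup>2)\<^sup>2 * K4 * (real n * h)\<^sup>2) +
     prob Bad * (1 / (2 * \<alpha>) + lam / 8 * c' * (real n * h))"
  proof (unfold K4_def, rule grid_bound[where J = J and p = "\<lambda>i. g (tt i)" and a = "\<lambda>i \<omega>. 1 + lam * Y (tt i) \<omega>" and K = K and ?k1.0 = "2 * P * C + 4 * K"], unfold tt_def[symmetric])
    show "step_approx (tt i) (tt (Suc i)) C P (c / 2) z (\<lambda>t \<omega>. \<sigma> (X t \<omega>) t) I (J i) (R i)" for i by (rule JR)
    show "A i \<in> sets (F (tt i))" "g (tt i) \<in> borel_measurable (F (tt i))" for i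
      by (rule AF, rule gm, rule tt)
    show "(\<lambda>\<omega>. 1 + lam * Y (tt i) \<omega>) \<in> borel_measurable (F (tt i))" for i
      by (intro borel_measurable_add borel_measurable_times borel_measurable_const Ym tt)
    show "norm (g (tt i) \<omega>) \<le> P" if "i < n" "\<omega> \<in> A i" for i \<omega>
      unfolding g_def using tt(1) ttT[of i] that(1) Aok(2)[OF that(2)] by (intro gP) (auto simp: ok_def)
    show "0 \<le> 1 + lam * Y (tt i) \<omega> \<and> 1 + lam * Y (tt i) \<omega> \<le> 1" if "\<omega> \<in> A i" for i \<omega>
      using Aok(2)[OF that] pos by (auto simp: ok_def field_simps mult_nonneg_nonpos)
    show "Bad \<in> sets M" by (rule BadM)
  qed (use pos h(1) \<alpha>(1) \<mu>(1) c' low lam path in \<open>auto simp: c'_def\<close>)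
  have "h * (\<Sum>i<n. prob (A i)) \<le> 3 * \<mu> + \<alpha> * K5 + prob Bad * Q"
    using bound unfolding h(3) K5_def Q_def .
  also have "prob Bad * Q \<le> \<theta> / Q * Q" using Badp Q by (intro mult_right_mono) auto
  finally have tot: "h * (\<Sum>i<n. prob (A i)) \<le> 3 * \<theta>"
    using \<mu>(3) \<alpha>(2) Q by simp
  define occ where "occ \<omega> = (\<Sum>i<n. h * indicat_real (A i) \<omega>)" for \<omega>
  have indi: "integrable M (indicat_real (A i))" for i
    using AM by (intro integrable_real_indicator) (auto simp: less_top[symmetric])
  have occi: "integrable M occ"
    unfolding occ_def[abs_def] by (intro Bochner_Integration.integrable_sum integrable_mult_right indi)
  have occE: "expectation occ = h * (\<Sum>i<n. prob (A i))"
    unfolding occ_def[abs_def] using indi AM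
    by (subst Bochner_Integration.integral_sum) (auto simp: sum_distrib_left sets.Int_space_eq2 intro: integrable_mult_right)
  define G where "G = {\<omega>\<in>space M. \<epsilon> / 2 \<le> occ \<omega>}"
  have [measurable]: "occ \<in> borel_measurable M" using occi by auto
  have GM: "G \<in> sets M" unfolding G_def by measurable
  have "prob G \<le> expectation occ / (\<epsilon> / 2)"
    unfolding G_def
    by (rule integral_Markov_inequality_measure[OF occi sets.top])
       (use eps h(1) in \<open>auto simp: occ_def intro!: sum_nonneg\<close>)
  also have "\<dots> \<le> 3 * \<theta> / (\<epsilon> / 2)" using tot occE eps by (intro divide_right_mono) auto
  also have "\<dots> \<le> e" using eps by (simp add: \<theta>_def field_simps)
  finally have Gp: "prob G \<le> e" .
  have inG: "\<omega> \<in> G"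
    if w: "\<omega> \<in> space M" and \<tau>: "0 \<le> \<tau>" "\<tau> + \<epsilon> \<le> T" "\<And>r. r \<in> {0..<\<tau>} \<Longrightarrow> Y r \<omega> < 0" "0 \<le> Y \<tau> \<omega>"
      and win: "\<And>r. r \<in> {\<tau>..\<tau> + \<epsilon>} \<Longrightarrow> - 1 / lam \<le> Y r \<omega> \<and> Y r \<omega> \<le> 0 \<and> norm (X r \<omega>) \<le> N" for \<omega> \<tau>
  proof -
    \<comment> \<open>For such a path the number \<tau> is its first hitting time, so the grid
      points after the start of activity are exactly those from \<tau> on.\<close>
    have Siff: "S j \<omega> \<longleftrightarrow> \<tau> \<le> tt j" for j
    proof
      assume "S j \<omega>"
      then show "\<tau> \<le> tt j" using \<tau>(3) unfolding S_def by force
    next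
      assume "\<tau> \<le> tt j"
      then show "S j \<omega>" using \<tau> unfolding S_def by auto
    qed
    have inA: "\<omega> \<in> A i" if "\<tau> \<le> tt i" "tt i \<le> \<tau> + \<epsilon>" for i
    proof -
      have "ok j \<omega>" if "j \<le> i" "S j \<omega>" for j
        using win[of "tt j"] that ttmono[OF that(1)] \<open>tt i \<le> \<tau> + \<epsilon>\<close> by (auto simp: Siff ok_def)
      then show ?thesis using that w by (auto simp: A_def Siff)
    qed
    \<comment> \<open>The grid points of the stretch have indices from \<open>i0\<close> to
      \<open>i1\<close>, and at least \<epsilon>/h - 2 of them remain when \<open>i1\<close> is left
      out. It is left out because it may equal \<open>n\<close>, which lies beyond the range summed
      in \<open>occ\<close>.\<close>
    define i0 where "i0 = nat \<lceil>\<tau> / h\<rceil>"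
    define i1 where "i1 = nat \<lfloor>(\<tau> + \<epsilon>) / h\<rfloor>"
    have i0: "\<tau> / h \<le> real i0" "real i0 \<le> \<tau> / h + 1"
      using \<tau>(1) h(1) by (auto simp: i0_def)
    have i1: "real i1 \<le> (\<tau> + \<epsilon>) / h" "(\<tau> + \<epsilon>) / h - 1 \<le> real i1"
      using \<tau>(1) h(1) eps by (auto simp: i1_def)
    have "real i1 * h \<le> real n * h" using i1(1) h \<tau>(2) by (simp add: field_simps)
    then have i1n: "i1 \<le> n" using h(1) by simp
    have "{i0..<i1} \<subseteq> {..<n}" using i1n by auto
    then have "(\<Sum>i\<in>{i0..<i1}. h * indicat_real (A i) \<omega>) \<le> occ \<omega>"
      unfolding occ_def using h(1) by (intro sum_mono2) auto
    moreover have "(\<Sum>i\<in>{i0..<i1}. h * indicat_real (A i) \<omega>) = (\<Sum>i\<in>{i0..<i1}. h)"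
    proof (rule sum.cong[OF refl])
      fix i assume i: "i \<in> {i0..<i1}"
      have "\<tau> / h \<le> real i" using i i0(1) by (auto intro: order_trans)
      moreover have "real i \<le> (\<tau> + \<epsilon>) / h" using i i1(1) by (auto intro: order_trans[rotated])
      ultimately have "\<omega> \<in> A i" using h(1) by (intro inA) (auto simp: tt_def field_simps)
      then show "h * indicat_real (A i) \<omega> = h" by simp
    qed
    moreover have "\<epsilon> / 2 \<le> (\<Sum>i\<in>{i0..<i1}. h)"
    proof -
      have "\<epsilon> / h = (\<tau> + \<epsilon>) / h - \<tau> / h" by (simp add: add_divide_distrib)
      then have "\<epsilon> / h - 2 \<le> real i1 - real i0" using i0 i1 by linarith
      also have "\<dots> \<le> real (i1 - i0)" by simp
      finally have "(\<epsilon> / h - 2) * h \<le> real (i1 - i0) * h" using h(1) by (intro mult_right_mono) auto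
      then have "\<epsilon> - 2 * h \<le> real (i1 - i0) * h" using h(1) by (simp add: algebra_simps)
      then show ?thesis using hs(2) by simp
    qed
    ultimately show ?thesis using w by (simp add: G_def)
  qed
  show ?thesis
    by (intro bexI[OF _ GM] conjI Gp ballI allI impI) (rule inG, auto simp: Y_def)
qed

end

section \<open>Hitting times of continuous paths\<close>

lemma SUP_less_zero:
  fixes y :: "real \<Rightarrow> real"
  assumes "continuous_on {0..} y" "\<And>s. s \<in> {0..T} \<Longrightarrow> y s < 0"
  shows "(SUP s\<in>{0..T}. ereal (y s)) < 0"
proof (cases "0 \<le> T")
  case False
  \<comment> \<open>For \<open>T < 0\<close> the interval is empty and the supremum is
    -\<infinity>.\<close>
  then show ?thesis by (simp add: bot_ereal_def)
next
  case True
  have "continuous_on {0..T} y" using assms(1) by (rule continuous_on_subset) auto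
  then obtain s where s: "s \<in> {0..T}" "\<And>r. r \<in> {0..T} \<Longrightarrow> y r \<le> y s"
    using continuous_attains_sup[of "{0..T}" y] True by auto
  then have "(SUP s\<in>{0..T}. ereal (y s)) \<le> ereal (y s)" by (intro SUP_least) auto
  also have "\<dots> < 0" using assms(2)[OF s(1)] by simp
  finally show ?thesis .
qed

lemma before_hit_time:
  assumes "ereal T < hit_time y" "s \<in> {0..T}"
  shows "y s < 0"
proof (rule ccontr)
  assume "\<not> y s < 0"
  then have "hit_time y \<le> ereal s"
    unfolding hit_time_def using assms(2) by (intro Inf_lower) auto
  also have "\<dots> \<le> ereal T" using assms(2) by simp
  finally show False using assms(1) by simp
qed

lemma NT_minus_continuous:
  assumes "continuous_on {0..} y"
  shows "NT_minus y"
  unfolding NT_minus_def using SUP_less_zero[OF assms] before_hit_time by blast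

text \<open>The set of times with nonnegative value is closed by continuity, so its infimum belongs
  to it as soon as the set is nonempty.\<close>

lemma hit_time_attained:
  assumes "continuous_on {0..} y" "hit_time y < \<infinity>"
  obtains \<tau> where "hit_time y = ereal \<tau>" "0 \<le> \<tau>" "0 \<le> y \<tau>" "\<And>r. r \<in> {0..<\<tau>} \<Longrightarrow> y r < 0"
proof -
  let ?S = "{t. 0 \<le> t \<and> 0 \<le> y t}"
  have ne: "?S \<noteq> {}"
  proof
    assume "?S = {}"
    then have "hit_time y = Inf (ereal ` {})" unfolding hit_time_def by (simp only:)
    then show False using assms(2) by (simp add: top_ereal_def)
  qed
  have "?S = {0..} \<inter> y -` {0..}" by auto
  then have cl: "closed ?S" using continuous_closed_preimage[OF assms(1)] by simp
  have bb: "bdd_below ?S" by (rule bdd_belowI[of _ 0]) auto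
  have inS: "Inf ?S \<in> ?S" by (rule closed_contains_Inf[OF ne bb cl])
  have eq: "hit_time y = ereal (Inf ?S)"
  proof (rule antisym)
    show "hit_time y \<le> ereal (Inf ?S)" unfolding hit_time_def using inS by (intro Inf_lower) blast
    show "ereal (Inf ?S) \<le> hit_time y"
      unfolding hit_time_def using cInf_lower[OF _ bb] by (intro Inf_greatest) auto
  qed
  have "y r < 0" if "r \<in> {0..<Inf ?S}" for r
    using that cInf_lower[OF _ bb, of r] by force
  then show ?thesis using that[OF eq] inS by blast
qed

lemma not_NT_plusD:
  assumes "hit_time y = ereal \<tau>" "\<not> NT_plus y"
  obtains \<epsilon> where "0 < \<epsilon>" "\<And>r. r \<in> {\<tau>..\<tau> + \<epsilon>} \<Longrightarrow> y r \<le> 0"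
proof -
  obtain \<epsilon> :: real where \<epsilon>: "0 < \<epsilon>"
    "\<not> 0 < (SUP s\<in>{s. hit_time y \<le> ereal s \<and> ereal s \<le> hit_time y + ereal \<epsilon>}. ereal (y s))"
    using assms(2) unfolding NT_plus_def by blast
  have "y r \<le> 0" if "r \<in> {\<tau>..\<tau> + \<epsilon>}" for r
  proof -
    have "ereal (y r) \<le> (SUP s\<in>{s. hit_time y \<le> ereal s \<and> ereal s \<le> hit_time y + ereal \<epsilon>}. ereal (y s))"
      using that assms(1) by (intro SUP_upper) auto
    also have "\<dots> \<le> 0" using \<epsilon>(2) by simp
    finally show ?thesis by simp
  qed
  then show ?thesis using that \<epsilon>(1) by blast
qed

section \<open>Almost sure exclusion of negative excursions and condition NT\<close>

context brownian
begin

text \<open>The strip width \<beta> = 1/lam depends on \<open>T\<close>, \<open>N\<close> and the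
  coefficients but not on \<epsilon>; hence \<epsilon> can be shrunk afterwards until continuity
  keeps the path inside strip and ball. For fixed \<epsilon>, the enclosing events of probability at
  most 1/(k+1) intersect in a null set.\<close>

lemma no_negative_excursion:
  fixes X :: "real \<Rightarrow> 'a \<Rightarrow> real^'d" and b :: "real^'d \<Rightarrow> real \<Rightarrow> real^'d"
    and \<sigma> :: "real^'d \<Rightarrow> real \<Rightarrow> real^'m^'d" and \<Phi> :: "real \<Rightarrow> real^'d \<Rightarrow> real"
  assumes lb: "locally_bounded_on (UNIV \<times> {0..}) (\<lambda>(x, t). b x t)"
    and ls: "locally_bounded_on (UNIV \<times> {0..}) (\<lambda>(x, t). \<sigma> x t)"
    and X: "ito_process M F W b \<sigma> X" and C12: "C12 \<Phi>" and TN: "0 < T" "0 < N"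
    and nd: "\<exists>\<eta>>0. \<exists>c>0. \<forall>t x. 0 \<le> t \<and> t \<le> T \<and> \<bar>\<Phi> t x\<bar> \<le> \<eta> \<longrightarrow>
      c \<le> norm (transpose (\<sigma> x t) *v grad (\<Phi> t) x)"
  shows "\<exists>\<beta>>0. \<forall>\<epsilon>>0. AE \<omega> in M. \<forall>\<tau>\<ge>0. \<not> (\<tau> + \<epsilon> \<le> T \<and> (\<forall>r\<in>{0..<\<tau>}. \<Phi> r (X r \<omega>) < 0) \<and>
     0 \<le> \<Phi> \<tau> (X \<tau> \<omega>) \<and> (\<forall>r\<in>{\<tau>..\<tau> + \<epsilon>}. - \<beta> \<le> \<Phi> r (X r \<omega>) \<and> \<Phi> r (X r \<omega>) \<le> 0 \<and> norm (X r \<omega>) \<le> N))"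
proof -
  have ad: "adapted F X" and cont: "\<And>\<omega>. \<omega> \<in> space M \<Longrightarrow> continuous_on {0..} (\<lambda>t. X t \<omega>)"
    and bint: "AE \<omega> in M. \<forall>T\<ge>0. set_integrable lborel {0..T} (\<lambda>r. b (X r \<omega>) r)"
    using X by (simp_all add: ito_process_def)
  obtain I where ito: "ito_integral M F W (\<lambda>t \<omega>. \<sigma> (X t \<omega>) t) I"
    and Xeq: "AE \<omega> in M. \<forall>t\<ge>0. X t \<omega> = X 0 \<omega> + (LINT r:{0..t}|lborel. b (X r \<omega>) r) + I t \<omega>"
    using X unfolding ito_process_def by blast
  let ?Kc = "cball (0 :: real^'d) (N + 1) \<times> {0..T}"
  have cpt: "compact ?Kc" by (intro compact_Times) auto
  have "bounded ((\<lambda>(x, t). b x t) ` ?Kc)" by (rule locally_bounded_on_compact[OF lb cpt]) auto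
  then obtain C1 where C1: "0 < C1" "\<forall>v\<in>(\<lambda>(x, t). b x t) ` ?Kc. norm v \<le> C1" unfolding bounded_pos by blast
  have "bounded ((\<lambda>(x, t). \<sigma> x t) ` ?Kc)" by (rule locally_bounded_on_compact[OF ls cpt]) auto
  then obtain C2 where C2: "0 < C2" "\<forall>v\<in>(\<lambda>(x, t). \<sigma> x t) ` ?Kc. norm v \<le> C2" unfolding bounded_pos by blast
  define C where "C = max C1 C2"
  have C: "0 < C" using C1 by (simp add: C_def)
  have coeff: "norm (b x t) \<le> C \<and> norm (\<sigma> x t) \<le> C" if "t \<in> {0..T}" "norm x \<le> N + 1" for t x
  proof -
    have "(x, t) \<in> ?Kc" using that by simp
    then have "norm (b x t) \<le> C1" "norm (\<sigma> x t) \<le> C2" using C1(2) C2(2) by blast+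
    then show ?thesis by (simp add: C_def le_max_iff_disj)
  qed
  obtain P0 K where P0: "0 < P0" "0 < K" and
    PK: "(\<forall>t\<in>{0..T}. \<forall>x. norm x \<le> N \<longrightarrow> norm (grad (\<Phi> t) x) \<le> P0) \<and>
    (\<forall>t s x u. 0 \<le> t \<and> t \<le> s \<and> s \<le> T \<and> norm x \<le> N \<and> norm u \<le> 1 \<longrightarrow>
       \<bar>\<Phi> s (x + u) - \<Phi> t x - grad (\<Phi> t) x \<bullet> u\<bar> \<le> K * ((s - t) + (norm u)\<^sup>2))"
    using C12_local_bounds[OF C12 TN] by (elim exE conjE) (rule that, assumption+, rule conjI)
  have taylor: "\<bar>\<Phi> s (x + u) - \<Phi> t x - grad (\<Phi> t) x \<bullet> u\<bar> \<le> K * ((s - t) + (norm u)\<^sup>2)"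
    if "0 \<le> t" "t \<le> s" "s \<le> T" "norm x \<le> N" "norm u \<le> 1" for t s x u
    using PK that by blast
  \<comment> \<open>At least 1, so that the axis vectors are among the test vectors in
    \<open>grid_bound\<close>.\<close>
  define P where "P = max 1 P0"
  have P: "1 \<le> P" "\<And>t x. t \<in> {0..T} \<Longrightarrow> norm x \<le> N \<Longrightarrow> norm (grad (\<Phi> t) x) \<le> P"
    using PK by (auto simp: P_def le_max_iff_disj)
  obtain \<eta> c where \<eta>: "0 < \<eta>" "0 < c" "\<And>t x. 0 \<le> t \<Longrightarrow> t \<le> T \<Longrightarrow> \<bar>\<Phi> t x\<bar> \<le> \<eta> \<Longrightarrow>
      c \<le> norm (transpose (\<sigma> x t) *v grad (\<Phi> t) x)"
    using nd by blast
  define L where "L = 1 + (2 * P * C + 4 * K) + 4 * K * real CARD('d) * C\<^sup>2"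
  \<comment> \<open>The first entry places the strip |\<Phi>| \<le> 2/lam inside the nondegenerate
    one. In the second, 128 = 8 * 16 inverts the factors 1/8 of \<open>quadratic_step\<close> and
    1/16 of the quadratic variation bound.\<close>
  define lam where "lam = max (2 / \<eta>) (L * 128 / c\<^sup>2)"
  have lam: "0 < lam" "2 / lam \<le> \<eta>" "L \<le> lam / 8 * (c\<^sup>2 / 16)"
  proof -
    have "0 < 2 / \<eta>" using \<eta> by simp
    moreover have l1: "2 / \<eta> \<le> lam" by (simp add: lam_def)
    ultimately show "0 < lam" by (rule less_le_trans)
    then show "2 / lam \<le> \<eta>" using l1 \<eta>(1) by (simp add: field_simps)
    have "L * 128 / c\<^sup>2 \<le> lam" by (simp add: lam_def)
    then show "L \<le> lam / 8 * (c\<^sup>2 / 16)" using \<eta>(2) by (simp add: field_simps)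
  qed
  have nd': "c \<le> norm (transpose (\<sigma> x t) *v grad (\<Phi> t) x)" if "t \<in> {0..T}" "\<bar>\<Phi> t x\<bar> \<le> 2 / lam" for t x
    using that lam(2) by (intro \<eta>(3)) auto
  note GE = grid_estimate[OF ad cont ito bint Xeq C12 TN C P(1) P0(2) \<eta>(2) lam(1) coeff P(2) taylor nd' lam(3)[unfolded L_def]]
  show ?thesis
  proof (intro exI[of _ "1 / lam"] conjI allI impI)
    show "0 < 1 / lam" using lam by simp
    fix \<epsilon> :: real assume \<epsilon>: "0 < \<epsilon>"
    let ?bad = "\<lambda>\<omega> \<tau>. \<tau> + \<epsilon> \<le> T \<and> (\<forall>r\<in>{0..<\<tau>}. \<Phi> r (X r \<omega>) < 0) \<and> 0 \<le> \<Phi> \<tau> (X \<tau> \<omega>) \<and>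
       (\<forall>r\<in>{\<tau>..\<tau> + \<epsilon>}. - 1 / lam \<le> \<Phi> r (X r \<omega>) \<and> \<Phi> r (X r \<omega>) \<le> 0 \<and> norm (X r \<omega>) \<le> N)"
    have "\<forall>k::nat. \<exists>G\<in>sets M. prob G \<le> inverse (real (Suc k)) \<and> (\<forall>\<omega>\<in>space M. \<forall>\<tau>\<ge>0. ?bad \<omega> \<tau> \<longrightarrow> \<omega> \<in> G)"
      using GE[OF _ _ _ _ _ _ _ _ _ _ _ _ \<epsilon>] by simp
    then obtain G where G: "\<And>k::nat. G k \<in> sets M" "\<And>k. prob (G k) \<le> inverse (real (Suc k))"
      "\<And>k \<omega> \<tau>. \<omega> \<in> space M \<Longrightarrow> 0 \<le> \<tau> \<Longrightarrow> ?bad \<omega> \<tau> \<Longrightarrow> \<omega> \<in> G k" by metis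
    have IM: "(\<Inter>k. G k) \<in> sets M" using G(1) by blast
    have "prob (\<Inter>k. G k) \<le> inverse (real (Suc k))" for k
      using finite_measure_mono[of "\<Inter>k. G k" "G k"] G(1,2)[of k] by fastforce
    then have "prob (\<Inter>k. G k) \<le> 0"
      using LIMSEQ_inverse_real_of_nat by (intro LIMSEQ_le_const[of _ 0]) auto
    then have "emeasure M (\<Inter>k. G k) = 0"
      by (simp add: emeasure_eq_measure measure_le_0_iff)
    then have "AE \<omega> in M. \<forall>\<tau>\<ge>0. \<not> ?bad \<omega> \<tau>"
      using IM G(3) by (intro AE_I[of _ _ "\<Inter>k. G k"]) auto
    then show "AE \<omega> in M. \<forall>\<tau>\<ge>0. \<not> (\<tau> + \<epsilon> \<le> T \<and> (\<forall>r\<in>{0..<\<tau>}. \<Phi> r (X r \<omega>) < 0) \<and> 0 \<le> \<Phi> \<tau> (X \<tau> \<omega>) \<and>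
       (\<forall>r\<in>{\<tau>..\<tau> + \<epsilon>}. - (1 / lam) \<le> \<Phi> r (X r \<omega>) \<and> \<Phi> r (X r \<omega>) \<le> 0 \<and> norm (X r \<omega>) \<le> N))"
      by simp
  qed
qed

end

theorem corollary5p1:
  fixes M :: "'a measure"
    and F :: "real \<Rightarrow> 'a measure"
    and W :: "real \<Rightarrow> 'a \<Rightarrow> real^'m"
    and b :: "real^'d \<Rightarrow> real \<Rightarrow> real^'d"
    and \<sigma> :: "real^'d \<Rightarrow> real \<Rightarrow> real^'m^'d"
    and X :: "real \<Rightarrow> 'a \<Rightarrow> real^'d"
    and \<Phi> :: "real \<Rightarrow> real^'d \<Rightarrow> real"
    and Y :: "real \<Rightarrow> 'a \<Rightarrow> real"
    and \<tau> :: "'a \<Rightarrow> ereal"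
  assumes "filtered_prob_space M F"
    and "brownian_motion M F W"
    and "locally_bounded_on (UNIV \<times> {0..}) (\<lambda>(x, t). b x t)"
    and "locally_bounded_on (UNIV \<times> {0..}) (\<lambda>(x, t). \<sigma> x t)"
    and "ito_process M F W b \<sigma> X"
    and "C12 \<Phi>"
    and Y_def: "\<And>t \<omega>. Y t \<omega> = \<Phi> t (X t \<omega>)"
    and \<tau>_def: "\<And>\<omega>. \<tau> \<omega> = hit_time (\<lambda>t. Y t \<omega>)"
    and nondegenerate: "\<forall>T>0. \<exists>\<eta>>0. \<exists>c>0. \<forall>t x. 0 \<le> t \<and> t \<le> T \<and> \<bar>\<Phi> t x\<bar> \<le> \<eta> \<longrightarrow>
      c \<le> norm (transpose (\<sigma> x t) *v grad (\<Phi> t) x)"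
  shows "(AE \<omega> in M. \<tau> \<omega> < \<infinity> \<longrightarrow> NT_plus (\<lambda>t. Y t \<omega>)) \<and>
    (\<forall>\<omega>\<in>space M. \<tau> \<omega> = \<infinity> \<longrightarrow> (\<forall>T>0. (SUP s\<in>{0..T}. ereal (Y s \<omega>)) < 0)) \<and>
    (AE \<omega> in M. NT (\<lambda>t. X t \<omega>) \<Phi>)"
proof -
  interpret brownian M F W using assms(1,2) by unfold_locales
  have ad: "adapted F X" and cont: "\<And>\<omega>. \<omega> \<in> space M \<Longrightarrow> continuous_on {0..} (\<lambda>t. X t \<omega>)"
    using assms(5) by (simp_all add: ito_process_def)
  have Yc: "continuous_on {0..} (\<lambda>t. Y t \<omega>)" if "\<omega> \<in> space M" for \<omega>
    unfolding Y_def by (rule continuous_process(1)[OF ad cont C12_continuous(1)[OF assms(6)] that])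
  have inf: "(SUP s\<in>{0..T}. ereal (Y s \<omega>)) < 0" if "\<omega> \<in> space M" "\<tau> \<omega> = \<infinity>" for \<omega> and T :: real
    using that SUP_less_zero[OF Yc] before_hit_time[of T "\<lambda>t. Y t \<omega>"] by (simp add: \<tau>_def)
  define excl where "excl T N \<beta> \<longleftrightarrow> 0 < \<beta> \<and> (\<forall>\<epsilon>>0. AE \<omega> in M. \<forall>\<tau>\<ge>0. \<not> (\<tau> + \<epsilon> \<le> real (Suc T) \<and>
     (\<forall>r\<in>{0..<\<tau>}. \<Phi> r (X r \<omega>) < 0) \<and> 0 \<le> \<Phi> \<tau> (X \<tau> \<omega>) \<and>
     (\<forall>r\<in>{\<tau>..\<tau> + \<epsilon>}. - \<beta> \<le> \<Phi> r (X r \<omega>) \<and> \<Phi> r (X r \<omega>) \<le> 0 \<and> norm (X r \<omega>) \<le> real (Suc N))))"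
    for T N :: nat and \<beta> :: real
  have "\<exists>\<beta>. excl T N \<beta>" for T N :: nat
    unfolding excl_def
    by (rule no_negative_excursion[OF assms(3-6) of_nat_0_less_iff[THEN iffD2, OF zero_less_Suc] of_nat_0_less_iff[THEN iffD2, OF zero_less_Suc]
        nondegenerate[rule_format, OF of_nat_0_less_iff[THEN iffD2, OF zero_less_Suc]]])
  then obtain \<beta> where "\<And>T N. excl T N (\<beta> T N)" by metis
  note \<beta> = this[unfolded excl_def, THEN conjunct1] this[unfolded excl_def, THEN conjunct2, rule_format]
  \<comment> \<open>Natural numbers for horizon and radius and reciprocals for the length leave
    countably many null sets, so one null set serves all of them.\<close>
  have "AE \<omega> in M. \<forall>T N m :: nat. \<forall>\<tau>\<ge>0. \<not> (\<tau> + inverse (real (Suc m)) \<le> real (Suc T) \<and>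
     (\<forall>r\<in>{0..<\<tau>}. Y r \<omega> < 0) \<and> 0 \<le> Y \<tau> \<omega> \<and>
     (\<forall>r\<in>{\<tau>..\<tau> + inverse (real (Suc m))}. - \<beta> T N \<le> Y r \<omega> \<and> Y r \<omega> \<le> 0 \<and> norm (X r \<omega>) \<le> real (Suc N)))"
    unfolding AE_all_countable Y_def using \<beta>(2) by simp
  then have plus: "AE \<omega> in M. \<tau> \<omega> < \<infinity> \<longrightarrow> NT_plus (\<lambda>t. Y t \<omega>)"
    using AE_space
  proof eventually_elim
    case (elim \<omega>)
    show ?case
    proof (intro impI, rule ccontr)
      assume fin: "\<tau> \<omega> < \<infinity>" and neg: "\<not> NT_plus (\<lambda>t. Y t \<omega>)"
      note w = elim(2)
      obtain t where t: "hit_time (\<lambda>t. Y t \<omega>) = ereal t" "0 \<le> t" "0 \<le> Y t \<omega>" "\<And>r. r \<in> {0..<t} \<Longrightarrow> Y r \<omega> < 0"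
        using hit_time_attained[OF Yc[OF w]] fin unfolding \<tau>_def by blast
      obtain \<epsilon> where \<epsilon>: "0 < \<epsilon>" "\<And>r. r \<in> {t..t + \<epsilon>} \<Longrightarrow> Y r \<omega> \<le> 0"
        using not_NT_plusD[OF t(1) neg] by blast
      obtain T where T: "t + 1 \<le> real T" using real_arch_simple by blast
      obtain N where N: "norm (X t \<omega>) \<le> real N" using real_arch_simple by blast
      have "\<exists>d>0. \<forall>r\<in>{0..}. dist r t < d \<longrightarrow> dist (Y r \<omega>) (Y t \<omega>) < \<beta> T N"
        using Yc[OF w] t(2) \<beta>(1)[of T N] unfolding continuous_on_iff by auto
      then obtain d1 where d1: "0 < d1" "\<And>r. 0 \<le> r \<Longrightarrow> dist r t < d1 \<Longrightarrow> dist (Y r \<omega>) (Y t \<omega>) < \<beta> T N" by auto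
      have "\<exists>d>0. \<forall>r\<in>{0..}. dist r t < d \<longrightarrow> dist (X r \<omega>) (X t \<omega>) < 1"
        using cont[OF w] t(2) unfolding continuous_on_iff by (metis atLeast_iff zero_less_one)
      then obtain d2 where d2: "0 < d2" "\<And>r. 0 \<le> r \<Longrightarrow> dist r t < d2 \<Longrightarrow> dist (X r \<omega>) (X t \<omega>) < 1" by auto
      \<comment> \<open>Horizon and radius are already fixed by the hitting time and the position
        there, and with them \<beta>. The length 1/(m+1) is chosen last, so short that the path
        stays in strip and ball by continuity.\<close>
      obtain m where m: "inverse (real (Suc m)) < min \<epsilon> (min 1 (min d1 d2))"
        using reals_Archimedean[of "min \<epsilon> (min 1 (min d1 d2))"] \<epsilon>(1) d1(1) d2(1) by auto
      have "- \<beta> T N \<le> Y r \<omega> \<and> Y r \<omega> \<le> 0 \<and> norm (X r \<omega>) \<le> real (Suc N)" if r: "r \<in> {t..t + inverse (real (Suc m))}" for r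
      proof -
        have rd: "0 \<le> r" "dist r t < d1" "dist r t < d2" "r \<in> {t..t + \<epsilon>}"
          using r m t(2) by (auto simp: dist_real_def)
        have "- \<beta> T N \<le> Y r \<omega>" using d1(2)[OF rd(1,2)] t(3) by (simp add: dist_real_def)
        moreover have "norm (X r \<omega>) \<le> norm (X t \<omega>) + norm (X r \<omega> - X t \<omega>)" by (rule norm_triangle_sub)
        then have "norm (X r \<omega>) \<le> real (Suc N)" using d2(2)[OF rd(1,3)] N by (simp add: dist_norm)
        ultimately show ?thesis using \<epsilon>(2)[OF rd(4)] by blast
      qed
      moreover have "t + inverse (real (Suc m)) \<le> real (Suc T)" using m T by simp
      ultimately show False using elim(1)[rule_format, of t m T N] t by blast
    qed
  qed
  moreover have "AE \<omega> in M. NT (\<lambda>t. X t \<omega>) \<Phi>"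
    using plus AE_space
  proof eventually_elim
    case (elim \<omega>)
    have eq: "(\<lambda>t. \<Phi> t (X t \<omega>)) = (\<lambda>t. Y t \<omega>)" by (simp add: Y_def)
    show ?case
    proof (cases "\<tau> \<omega> = \<infinity>")
      case True
      then show ?thesis using inf[OF elim(2)] unfolding NT_def Let_def eq by (simp add: \<tau>_def)
    next
      case False
      then have "\<tau> \<omega> < \<infinity>" by simp
      then show ?thesis
        using elim(1) NT_minus_continuous[OF Yc[OF elim(2)]] unfolding NT_def Let_def eq by (simp add: \<tau>_def)
    qed
  qed
  ultimately show ?thesis using inf by blast
qed

end
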